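(* There is a multithreaded algorithm that, given a batch of $n$ items, returns a batch with the same items in the same order stored as a complete binary tree, within $O(n)$ work and $O(\log n)$ span.
   Context: Computation model: asynchronous dynamic multithreading on a parallel pointer machine with queued read-modify-write (QRMW) contention. Memory consists of nodes each with a fixed number of cells holding an integer or a pointer; pointers can only be stored, followed and tested for equality (no pointer arithmetic). Threads can fork threads, join (wait for termination of) a thread, suspend themselves, resume a suspended thread, terminate, create memory nodes, perform integer arithmetic, and perform read-modify-write operations (read, write, test-and-set, fetch-and-add, compare-and-swap) on memory cells, each in $O(1)$ time, except that RMW operations on the same memory cell are FIFO-queued and serviced one per time step, the issuing thread being blocked until its request is serviced. An execution is described by its execution DAG whose nodes are the executed primitive instructions, weighted by the time taken to execute them, and whose edges are the dependencies (program order within a thread, fork, join, resume). Work is the total weight of the DAG and span is the maximum total weight of a directed path. The bounds are required to hold for every execution schedule, asymptotically as $n$ grows. A batch of items is stored as a BBT: a full binary tree with items only at its leaves (the batch order is the left-to-right leaf order) in which at every internal node the heights of the two subtrees differ by at most $1$; each node stores its children, its subtree height and number of leaves, and the first and last item in its subtree. A complete binary tree is one in which every level is full except possibly the last. *)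

theory Defs
  imports Complex_Main "HOL-Library.Landau_Symbols"
begin

section \<open>The QRMW parallel pointer machine\<close>

type_synonym addr = nat
type_synonym tid = nat
type_synonym reg = nat

text \<open>Pointers are opaque: they refer to a memory node as a whole or to a thread. A cell is
  addressed by a node pointer together with a cell index that is fixed in the program text.\<close>

datatype val = NullV | IntV int | NodeV addr | ThreadV tid

datatype 'a rmw =
    Read
  | Write 'a
  | TestAndSet
  | FetchAndAdd 'a
  | CompareAndSwap 'a 'a

text \<open>New contents of the cell. Fetch-and-add does nothing unless both values are integers.\<close>

fun rmw_new :: "val rmw \<Rightarrow> val \<Rightarrow> val" where
  "rmw_new Read v = v"
| "rmw_new (Write x) v = x"
| "rmw_new TestAndSet v = IntV 1"
| "rmw_new (FetchAndAdd (IntV i)) (IntV j) = IntV (j + i)"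
| "rmw_new (FetchAndAdd _) v = v"
| "rmw_new (CompareAndSwap old new) v = (if v = old then new else v)"

text \<open>The value delivered to the issuing thread: the old contents of the cell, except for a write,
  which reveals nothing about them.\<close>

fun rmw_result :: "val rmw \<Rightarrow> val \<Rightarrow> val" where
  "rmw_result (Write x) v = x"
| "rmw_result _ v = v"

datatype arith = Add | Sub | Mul | Div | Mod

fun arith_fun :: "arith \<Rightarrow> int \<Rightarrow> int \<Rightarrow> int" where
  "arith_fun Add i j = i + j"
| "arith_fun Sub i j = i - j"
| "arith_fun Mul i j = i * j"
| "arith_fun Div i j = i div j"
| "arith_fun Mod i j = i mod j"

text \<open>A program is a finite list of instructions, so it mentions finitely many registers; thus every
  thread has a constant number of registers. Destination registers come first;
  \<open>Access d op p c\<close> performs \<open>op\<close> on cell \<open>c\<close> of the node that register \<open>p\<close> points to, and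
  \<open>Fork d l\<close> starts at program position \<open>l\<close> a thread that inherits a copy of the registers.\<close>

datatype instr =
    LoadNull reg
  | LoadInt reg int
  | Move reg reg
  | Arith arith reg reg reg
  | Jump nat
  | JumpIfEq reg reg nat
  | JumpIfLess reg reg nat
  | Self reg
  | NewNode reg
  | Access reg "reg rmw" reg nat
  | Fork reg nat
  | Join reg
  | Suspend
  | Resume reg
  | Terminate

type_synonym program = "instr list"

text \<open>The \<open>k\<close>-th instruction executed by thread \<open>t\<close> is the node \<open>(t, k)\<close> of the execution DAG.\<close>

type_synonym event = "tid \<times> nat"

record dag =
  verts :: "event set"
  weight :: "event \<Rightarrow> nat"
  edges :: "(event \<times> event) set"

definition dag_path :: "dag \<Rightarrow> event list \<Rightarrow> bool" where
  "dag_path G p \<longleftrightarrow> p \<noteq> [] \<and> set p \<subseteq> verts G \<and> successively (\<lambda>u v. (u, v) \<in> edges G) p"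

definition work :: "dag \<Rightarrow> nat" where
  "work G = (\<Sum>v\<in>verts G. weight G v)"

text \<open>The DAG of a finite execution is finite and acyclic (edges lead from earlier to later events),
  so the maximum below ranges over a finite set.\<close>

definition span :: "dag \<Rightarrow> nat" where
  "span G = Max {(\<Sum>v\<leftarrow>p. weight G v) | p. dag_path G p}"

datatype status = Ready | Waiting | Suspended | Terminated

text \<open>\<open>th_count\<close> is the number of instructions executed so far; \<open>th_deps\<close> is the set of the direct
  DAG predecessors of the thread's next instruction.\<close>

record thread =
  th_pc :: nat
  th_regs :: "reg \<Rightarrow> val"
  th_status :: status
  th_count :: nat
  th_deps :: "event set"

record request =
  rq_thread :: tid
  rq_dest :: reg
  rq_op :: "val rmw"
  rq_event :: event
  rq_issued :: nat

type_synonym memory = "addr \<rightharpoonup> val list"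

text \<open>Each cell has its own FIFO queue of pending requests, the first one at the head of the list.\<close>

record config =
  mem :: memory
  queue :: "addr \<times> nat \<Rightarrow> request list"
  threads :: "tid \<rightharpoonup> thread"
  clock :: nat
  exec_dag :: dag

definition advance :: "thread \<Rightarrow> event \<Rightarrow> nat \<Rightarrow> (reg \<Rightarrow> val) \<Rightarrow> status \<Rightarrow> thread" where
  "advance th e pc' rs' st' =
     \<lparr>th_pc = pc', th_regs = rs', th_status = st', th_count = Suc (th_count th), th_deps = {e}\<rparr>"

definition add_event :: "event \<Rightarrow> event set \<Rightarrow> nat \<Rightarrow> dag \<Rightarrow> dag" where
  "add_event e D w G =
     \<lparr>verts = insert e (verts G), weight = (weight G)(e := w), edges = edges G \<union> D \<times> {e}\<rparr>"

text \<open>Instructions that only affect the program counter and the registers of thread \<open>t\<close>;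
  an ill-typed instruction has no successor, so the thread is stuck.\<close>

fun local_step :: "tid \<Rightarrow> instr \<Rightarrow> nat \<Rightarrow> (reg \<Rightarrow> val) \<Rightarrow> (nat \<times> (reg \<Rightarrow> val)) option" where
  "local_step t (LoadNull d) pc rs = Some (Suc pc, rs(d := NullV))"
| "local_step t (LoadInt d i) pc rs = Some (Suc pc, rs(d := IntV i))"
| "local_step t (Move d r) pc rs = Some (Suc pc, rs(d := rs r))"
| "local_step t (Arith f d r r') pc rs =
     (case (rs r, rs r') of
        (IntV i, IntV j) \<Rightarrow> Some (Suc pc, rs(d := IntV (arith_fun f i j)))
      | _ \<Rightarrow> None)"
| "local_step t (Jump l) pc rs = Some (l, rs)"
| "local_step t (JumpIfEq r r' l) pc rs = Some (if rs r = rs r' then l else Suc pc, rs)"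
| "local_step t (JumpIfLess r r' l) pc rs =
     (case (rs r, rs r') of
        (IntV i, IntV j) \<Rightarrow> Some (if i < j then l else Suc pc, rs)
      | _ \<Rightarrow> None)"
| "local_step t (Self d) pc rs = Some (Suc pc, rs(d := ThreadV t))"
| "local_step t _ pc rs = None"

definition at_instr :: "program \<Rightarrow> config \<Rightarrow> tid \<Rightarrow> thread \<Rightarrow> instr \<Rightarrow> bool" where
  "at_instr P s t th i \<longleftrightarrow>
     threads s t = Some th \<and> th_status th = Ready \<and> th_pc th < length P \<and> P ! th_pc th = i"

text \<open>Thread \<open>t\<close> issues its next instruction. Every instruction other than a memory access completes
  in unit time; an access is appended to the queue of its cell and blocks the thread until it
  is serviced, which is also when its weight is set. A join can only be executed once its target has
  terminated; resuming a thread that is not suspended has no effect. Nodes have \<open>K\<close> cells.\<close>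

inductive issue :: "nat \<Rightarrow> program \<Rightarrow> config \<Rightarrow> tid \<Rightarrow> config \<Rightarrow> bool"
  for K :: nat and P :: program and s :: config and t :: tid where
  Local:
    "at_instr P s t th i \<Longrightarrow> local_step t i (th_pc th) (th_regs th) = Some (pc', rs') \<Longrightarrow>
     e = (t, th_count th) \<Longrightarrow>
     issue K P s t
       (s\<lparr>threads := (threads s)(t \<mapsto> advance th e pc' rs' Ready),
          exec_dag := add_event e (th_deps th) 1 (exec_dag s)\<rparr>)"
| NewNode:
    "at_instr P s t th (NewNode d) \<Longrightarrow> a \<notin> dom (mem s) \<Longrightarrow>
     e = (t, th_count th) \<Longrightarrow>
     issue K P s t
       (s\<lparr>mem := (mem s)(a \<mapsto> replicate K NullV),
          threads := (threads s)
            (t \<mapsto> advance th e (Suc (th_pc th)) ((th_regs th)(d := NodeV a)) Ready),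
          exec_dag := add_event e (th_deps th) 1 (exec_dag s)\<rparr>)"
| Access:
    "at_instr P s t th (Access d f p c) \<Longrightarrow> th_regs th p = NodeV a \<Longrightarrow>
     mem s a = Some cs \<Longrightarrow> c < length cs \<Longrightarrow>
     e = (t, th_count th) \<Longrightarrow>
     q = \<lparr>rq_thread = t, rq_dest = d, rq_op = map_rmw (th_regs th) f,
          rq_event = e, rq_issued = clock s\<rparr> \<Longrightarrow>
     issue K P s t
       (s\<lparr>queue := (queue s)((a, c) := queue s (a, c) @ [q]),
          threads := (threads s)(t \<mapsto> advance th e (Suc (th_pc th)) (th_regs th) Waiting),
          exec_dag := add_event e (th_deps th) 0 (exec_dag s)\<rparr>)"
| Fork:
    "at_instr P s t th (Fork d l) \<Longrightarrow> t' \<notin> dom (threads s) \<Longrightarrow>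
     e = (t, th_count th) \<Longrightarrow>
     issue K P s t
       (s\<lparr>threads := (threads s)
            (t \<mapsto> advance th e (Suc (th_pc th)) ((th_regs th)(d := ThreadV t')) Ready,
             t' \<mapsto> \<lparr>th_pc = l, th_regs = th_regs th, th_status = Ready,
                    th_count = 0, th_deps = {e}\<rparr>),
          exec_dag := add_event e (th_deps th) 1 (exec_dag s)\<rparr>)"
| Join:
    "at_instr P s t th (Join r) \<Longrightarrow> th_regs th r = ThreadV t' \<Longrightarrow>
     threads s t' = Some th' \<Longrightarrow> th_status th' = Terminated \<Longrightarrow>
     e = (t, th_count th) \<Longrightarrow>
     issue K P s t
       (s\<lparr>threads := (threads s)(t \<mapsto> advance th e (Suc (th_pc th)) (th_regs th) Ready),
          exec_dag := add_event e (th_deps th \<union> th_deps th') 1 (exec_dag s)\<rparr>)"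
| Suspend:
    "at_instr P s t th Suspend \<Longrightarrow>
     e = (t, th_count th) \<Longrightarrow>
     issue K P s t
       (s\<lparr>threads := (threads s)(t \<mapsto> advance th e (Suc (th_pc th)) (th_regs th) Suspended),
          exec_dag := add_event e (th_deps th) 1 (exec_dag s)\<rparr>)"
| Resume_suspended:
    "at_instr P s t th (Resume r) \<Longrightarrow> th_regs th r = ThreadV t' \<Longrightarrow>
     threads s t' = Some th' \<Longrightarrow> th_status th' = Suspended \<Longrightarrow>
     e = (t, th_count th) \<Longrightarrow>
     issue K P s t
       (s\<lparr>threads := (threads s)
            (t \<mapsto> advance th e (Suc (th_pc th)) (th_regs th) Ready,
             t' \<mapsto> th'\<lparr>th_status := Ready, th_deps := insert e (th_deps th')\<rparr>),
          exec_dag := add_event e (th_deps th) 1 (exec_dag s)\<rparr>)"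
| Resume_other:
    "at_instr P s t th (Resume r) \<Longrightarrow> th_regs th r = ThreadV t' \<Longrightarrow>
     threads s t' = Some th' \<Longrightarrow> th_status th' \<noteq> Suspended \<Longrightarrow>
     e = (t, th_count th) \<Longrightarrow>
     issue K P s t
       (s\<lparr>threads := (threads s)(t \<mapsto> advance th e (Suc (th_pc th)) (th_regs th) Ready),
          exec_dag := add_event e (th_deps th) 1 (exec_dag s)\<rparr>)"
| Terminate:
    "at_instr P s t th Terminate \<Longrightarrow>
     e = (t, th_count th) \<Longrightarrow>
     issue K P s t
       (s\<lparr>threads := (threads s)(t \<mapsto> advance th e (th_pc th) (th_regs th) Terminated),
          exec_dag := add_event e (th_deps th) 1 (exec_dag s)\<rparr>)"

inductive issue_all :: "nat \<Rightarrow> program \<Rightarrow> config \<Rightarrow> tid list \<Rightarrow> config \<Rightarrow> bool"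
  for K :: nat and P :: program where
  "issue_all K P s [] s"
| "issue K P s t s' \<Longrightarrow> issue_all K P s' ts s'' \<Longrightarrow> issue_all K P s (t # ts) s''"

text \<open>The request at the head of the queue of cell \<open>(a, c)\<close> is serviced. The weight of an access is
  the number of time steps from its issue to its service, both included.\<close>

definition serve :: "addr \<times> nat \<Rightarrow> config \<Rightarrow> config" where
  "serve ac s =
     (case (ac, queue s ac) of
        ((a, c), q # qs) \<Rightarrow>
          (let cs = the (mem s a);
               th = the (threads s (rq_thread q));
               G = exec_dag s
           in s\<lparr>mem := (mem s)(a \<mapsto> cs[c := rmw_new (rq_op q) (cs ! c)]),
                queue := (queue s)(ac := qs),
                threads := (threads s)(rq_thread q \<mapsto> th\<lparr>th_status := Ready,
                  th_regs := (th_regs th)(rq_dest q := rmw_result (rq_op q) (cs ! c))\<rparr>),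
                exec_dag := G\<lparr>weight :=
                  (weight G)(rq_event q := Suc (clock s - rq_issued q))\<rparr>\<rparr>)
      | _ \<Rightarrow> s)"

text \<open>One time step: the scheduler lets an arbitrary set of enabled threads issue one instruction
  each, in an arbitrary order (which decides simultaneous arrivals at a queue), and then exactly one
  request is serviced at every cell with a nonempty queue. Only idle time steps, in which neither
  happens, are left out; no request is pending during those.\<close>

definition time_step :: "nat \<Rightarrow> program \<Rightarrow> config \<Rightarrow> config \<Rightarrow> bool" where
  "time_step K P s s' \<longleftrightarrow>
     (\<exists>ts acs s1.
        distinct ts \<and> (\<forall>t\<in>set ts. \<exists>u. issue K P s t u) \<and> issue_all K P s ts s1 \<and>
        distinct acs \<and> set acs = {ac. queue s1 ac \<noteq> []} \<and>
        (ts \<noteq> [] \<or> acs \<noteq> []) \<and>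
        s' = (fold serve acs s1)\<lparr>clock := Suc (clock s1)\<rparr>)"

text \<open>The main thread is thread 0. It receives its argument, and returns its result, in register 0.\<close>

definition initial :: "memory \<Rightarrow> val \<Rightarrow> config" where
  "initial m v =
     \<lparr>mem = m,
      queue = (\<lambda>_. []),
      threads = [0 \<mapsto> \<lparr>th_pc = 0, th_regs = (\<lambda>_. NullV)(0 := v), th_status = Ready,
                       th_count = 0, th_deps = {}\<rparr>],
      clock = 0,
      exec_dag = \<lparr>verts = {}, weight = (\<lambda>_. 0), edges = {}\<rparr>\<rparr>"

definition returned :: "config \<Rightarrow> val \<Rightarrow> bool" where
  "returned s v \<longleftrightarrow>
     (\<exists>th. threads s 0 = Some th \<and> th_status th = Terminated \<and> th_regs th 0 = v)"

definition reachable :: "nat \<Rightarrow> program \<Rightarrow> config \<Rightarrow> config \<Rightarrow> bool" where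
  "reachable K P = (time_step K P)\<^sup>*\<^sup>*"

text \<open>The end of an execution: no thread can proceed any more.\<close>

definition finished :: "nat \<Rightarrow> program \<Rightarrow> config \<Rightarrow> bool" where
  "finished K P s \<longleftrightarrow> (\<nexists>s'. time_step K P s s')"

text \<open>Under every schedule the execution from \<open>s0\<close> comes to an end, the main thread has then returned,
  the result and the memory satisfy \<open>Q\<close> from the moment of the return on, and the DAG of the whole
  execution has at most the given work and span.\<close>

definition computes_within ::
  "nat \<Rightarrow> program \<Rightarrow> config \<Rightarrow> (memory \<Rightarrow> val \<Rightarrow> bool) \<Rightarrow> real \<Rightarrow> real \<Rightarrow> bool" where
  "computes_within K P s0 Q w d \<longleftrightarrow>
     (\<nexists>\<sigma>. \<sigma> 0 = s0 \<and> (\<forall>i::nat. time_step K P (\<sigma> i) (\<sigma> (Suc i)))) \<and>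
     (\<forall>s v. reachable K P s0 s \<and> returned s v \<longrightarrow> Q (mem s) v) \<and>
     (\<forall>s. reachable K P s0 s \<and> finished K P s \<longrightarrow>
        (\<exists>v. returned s v) \<and> real (work (exec_dag s)) \<le> w \<and> real (span (exec_dag s)) \<le> d)"


section \<open>Batches\<close>

datatype 'a btree = Leaf 'a | Branch "'a btree" "'a btree"

primrec items :: "'a btree \<Rightarrow> 'a list" where
  "items (Leaf x) = [x]"
| "items (Branch l r) = items l @ items r"

primrec height :: "'a btree \<Rightarrow> nat" where
  "height (Leaf x) = 0"
| "height (Branch l r) = Suc (max (height l) (height r))"

primrec bbt :: "'a btree \<Rightarrow> bool" where
  "bbt (Leaf x) \<longleftrightarrow> True"
| "bbt (Branch l r) \<longleftrightarrow>
     bbt l \<and> bbt r \<and> height l \<le> Suc (height r) \<and> height r \<le> Suc (height l)"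

text \<open>The number of nodes at depth \<open>d\<close>.\<close>

fun level_size :: "'a btree \<Rightarrow> nat \<Rightarrow> nat" where
  "level_size t 0 = 1"
| "level_size (Leaf x) (Suc d) = 0"
| "level_size (Branch l r) (Suc d) = level_size l d + level_size r d"

definition complete_btree :: "'a btree \<Rightarrow> bool" where
  "complete_btree t \<longleftrightarrow> (\<forall>d < height t. level_size t d = 2 ^ d)"

text \<open>Cells 0 to 5 of a tree node hold its two children, the height and the number of leaves of its
  subtree, and the first and last item in its subtree. A leaf has null children, and its item is
  both its first and its last item.\<close>

definition tree_node :: "memory \<Rightarrow> addr \<Rightarrow> val \<Rightarrow> val \<Rightarrow> val btree \<Rightarrow> bool" where
  "tree_node m a lp rp t \<longleftrightarrow>
     (\<exists>rest. m a = Some ([lp, rp, IntV (int (height t)), IntV (int (length (items t))),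
                          hd (items t), last (items t)] @ rest))"

text \<open>The tree \<open>t\<close> is stored at \<open>a\<close>, and its nodes are the distinct memory nodes in \<open>A\<close>.\<close>

fun stored :: "memory \<Rightarrow> addr \<Rightarrow> val btree \<Rightarrow> addr set \<Rightarrow> bool" where
  "stored m a (Leaf x) A \<longleftrightarrow> A = {a} \<and> tree_node m a NullV NullV (Leaf x)"
| "stored m a (Branch l r) A \<longleftrightarrow>
     (\<exists>b c B C. tree_node m a (NodeV b) (NodeV c) (Branch l r) \<and>
        stored m b l B \<and> stored m c r C \<and>
        B \<inter> C = {} \<and> a \<notin> B \<union> C \<and> A = insert a (B \<union> C))"

text \<open>Being full binary trees, batches are nonempty.\<close>

definition batch_at :: "memory \<Rightarrow> val \<Rightarrow> val btree \<Rightarrow> bool" where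
  "batch_at m v t \<longleftrightarrow> bbt t \<and> (\<exists>a A. v = NodeV a \<and> stored m a t A)"

definition wf_memory :: "nat \<Rightarrow> memory \<Rightarrow> bool" where
  "wf_memory K m \<longleftrightarrow> finite (dom m) \<and> (\<forall>cs\<in>ran m. length cs = K)"

end

(* Give the split between items p-1 and p of a batch of n items the priority 2^v, where v is the number
   of trailing zeros of p + min p M and 2^h = n + M is the least power of two that is at least n. The
   heap-ordered (Cartesian) tree on the splits is then a complete tree. It is computed in place, the
   internal node of the input at split p becoming the node of the output at split p: going up the
   input, the heap-ordered trees of the two subtrees of a node are joined with that node like treaps.
   A join proceeds downwards along two spines. It announces its root at once and leaves the rest to
   a forked thread whose handle is stored in the root, so that joins at different heights are pipelined:
   at height j of the input, the nodes at depth k are final at time O(j + k + log n). A last pass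
   over the tree waits for the remaining threads and restores the cached heights, sizes and items.

   No two threads ever access the same cell at the same time, so that every access has weight 1.
   This is expressed by a concurrent separation logic whose judgement safe also bounds the work and
   the depth in the DAG: a thread owns cells and the handles of threads that it may join, and a
   handle promises a deadline and the resources that the join yields. *)

theory Submission
  imports Defs "HOL-Computational_Algebra.Primes"
begin

section \<open>A program logic for work and span\<close>

text \<open>Stretch the \<open>n\<close> items over a grid of \<open>2 ^ h = n + M\<close> unit
  slots: the first \<open>M\<close> items take two slots each, the others one. Split
  \<open>p\<close> then lies at grid point \<open>p + min p M\<close>, and its priority is the
  largest power of two dividing that point. Over all grid points this ruler sequence has the perfect
  binary tree as its heap-ordered tree. Only the odd points below \<open>2 * M\<close> are missing;
  dropping one fuses two bottom leaves into a leaf one level higher, which leaves a complete tree.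

  Two obstacles shape the rest. The intermediate trees cover ranges of splits that are not aligned
  with the grid; still, a range of \<open>m\<close> items gives height \<open>log m + O(1)\<close>,
  so a join is paid for by the height of its input node, and these heights sum to
  \<open>O(n)\<close> in a balanced tree. And joins that waited for finished operands would add
  \<open>O(log n)\<close> at every height of the input; but each level of a join inspects only two
  roots, so a constant delay per level suffices, and the deadlines in handles record exactly this
  delay.\<close>

datatype key = Cell addr nat | Thr tid

text \<open>The postcondition promised by a handle is given by a name of type \<open>'q\<close>,
  interpreted later by \<open>post\<close>: storing the assertion itself would make the type of
  resources circular.\<close>

datatype 'q rsrc = Val val | Promise nat 'q

type_synonym 'q res = "key \<rightharpoonup> 'q rsrc"

type_synonym 'q assn = "'q res \<Rightarrow> bool"

definition fresh_cells :: "nat \<Rightarrow> addr \<Rightarrow> 'q res" where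
  "fresh_cells K a = (\<lambda>k. case k of Cell b c \<Rightarrow> if b = a \<and> c < K then Some (Val NullV) else None | _ \<Rightarrow> None)"

text \<open>The component \<open>gp\<close> is the cell in whose queue a waiting thread has its request.\<close>

record 'q ghost =
  gw :: nat
  gD :: nat
  gE :: nat
  gq :: 'q
  gh :: "'q res"
  gp :: "(addr \<times> nat) option"

locale logic =
  fixes K :: nat and P :: program and B :: nat
    and post :: "'q \<Rightarrow> (reg \<Rightarrow> val) \<Rightarrow> 'q assn" and main :: 'q
begin

text \<open>\<open>safe w D E q pc rs h\<close>: a thread at \<open>pc\<close> with registers \<open>rs\<close> that owns \<open>h\<close>, and whose DAG
  predecessors have depth at most \<open>D\<close>, terminates at depth at most \<open>E\<close> in a state satisfying
  \<open>post q\<close>, and it and the threads that it forks execute at most \<open>w\<close> instructions. A handle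
  \<open>Promise E' q'\<close> is consumed by the join.\<close>

inductive safe :: "nat \<Rightarrow> nat \<Rightarrow> nat \<Rightarrow> 'q \<Rightarrow> nat \<Rightarrow> (reg \<Rightarrow> val) \<Rightarrow> 'q res \<Rightarrow> bool" where
  s_local:
    "pc < length P \<Longrightarrow> (\<And>t. local_step t (P ! pc) pc rs = Some (pc', rs')) \<Longrightarrow>
     safe w (Suc D) E q pc' rs' h \<Longrightarrow> safe (Suc w) D E q pc rs h"
| s_access:
    "pc < length P \<Longrightarrow> P ! pc = Access d f p c \<Longrightarrow> rs p = NodeV a \<Longrightarrow>
     h (Cell a c) = Some (Val v) \<Longrightarrow>
     safe w (Suc D) E q (Suc pc) (rs(d := rmw_result (map_rmw rs f) v))
       (h(Cell a c \<mapsto> Val (rmw_new (map_rmw rs f) v))) \<Longrightarrow>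
     safe (Suc w) D E q pc rs h"
| s_new:
    "pc < length P \<Longrightarrow> P ! pc = NewNode d \<Longrightarrow> D < E \<Longrightarrow>
     (\<And>a. (\<And>c. Cell a c \<notin> dom h) \<Longrightarrow>
        safe w (Suc D) E q (Suc pc) (rs(d := NodeV a)) (h ++ fresh_cells K a)) \<Longrightarrow>
     safe (Suc w) D E q pc rs h"
| s_fork:
    "pc < length P \<Longrightarrow> P ! pc = Fork d l \<Longrightarrow> h = h1 ++ h2 \<Longrightarrow> dom h1 \<inter> dom h2 = {} \<Longrightarrow>
     E' \<le> B \<Longrightarrow> safe w1 (Suc D) E' q' l rs h1 \<Longrightarrow>
     (\<And>t. Thr t \<notin> dom h2 \<Longrightarrow>
        safe w2 (Suc D) E q (Suc pc) (rs(d := ThreadV t)) (h2(Thr t \<mapsto> Promise E' q'))) \<Longrightarrow>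
     safe (Suc (w1 + w2)) D E q pc rs h"
| s_join:
    "pc < length P \<Longrightarrow> P ! pc = Join r \<Longrightarrow> rs r = ThreadV t \<Longrightarrow>
     h (Thr t) = Some (Promise E' q') \<Longrightarrow> E' < E \<Longrightarrow> D < E \<Longrightarrow>
     (\<And>rs' h'. post q' rs' h' \<Longrightarrow> dom h' \<inter> dom h = {} \<Longrightarrow>
        safe w (Suc (max D E')) E q (Suc pc) rs (h(Thr t := None) ++ h')) \<Longrightarrow>
     safe (Suc w) D E q pc rs h"
| s_term:
    "pc < length P \<Longrightarrow> P ! pc = Terminate \<Longrightarrow> D < E \<Longrightarrow> post q rs h \<Longrightarrow>
     safe (Suc w) D E q pc rs h"

text \<open>In the rules for allocation and join the continuation is quantified over addresses or
  results and could hold vacuously; their premise \<open>D < E\<close> secures the bound there. For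
  a fork it comes from the child, whose deadline is at most \<open>B\<close>.\<close>

lemma safe_depth: "safe w D E q pc rs h \<Longrightarrow> E \<le> B \<Longrightarrow> D < B"
  by (induction rule: safe.induct) auto

lemma safe_mono:
  "safe w D E q pc rs h \<Longrightarrow> w \<le> w' \<Longrightarrow> D' \<le> D \<Longrightarrow> safe w' D' E q pc rs h"
proof (induction arbitrary: w' D' rule: safe.induct)
  case (s_local pc rs pc' rs' w D E q h)
  then obtain k where "w' = Suc k" "w \<le> k" by (cases w') auto
  with s_local show ?case by (auto intro!: safe.s_local[of pc rs pc' rs'])
next
  case (s_access pc d f p c rs a h v w D E q)
  then obtain k where "w' = Suc k" "w \<le> k" by (cases w') auto
  with s_access show ?case by (auto simp del: fun_upd_apply intro!: safe.s_access[of pc d f p c rs a])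
next
  case (s_new pc d D E h w q rs)
  then obtain k where "w' = Suc k" "w \<le> k" by (cases w') auto
  with s_new show ?case by (auto simp del: fun_upd_apply intro!: safe.s_new[of pc d])
next
  case (s_fork pc d l h h1 h2 E' w1 D q' rs w2 E q)
  \<comment> \<open>The surplus work goes to the continuation; the forked thread keeps
    \<open>w1\<close>.\<close>
  define k where "k = w' - Suc w1"
  then have k: "w' = Suc (w1 + k)" "w2 \<le> k" using s_fork.prems(1) by auto
  show ?case unfolding k(1)
  proof (rule safe.s_fork[OF s_fork.hyps(1-5)])
    show "safe w1 (Suc D') E' q' l rs h1" using s_fork by simp
    show "safe k (Suc D') E q (Suc pc) (rs(d := ThreadV t)) (h2(Thr t \<mapsto> Promise E' q'))"
      if "Thr t \<notin> dom h2" for t using s_fork.IH(2)[OF that, of k "Suc D'"] k s_fork.prems by (simp del: fun_upd_apply)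
  qed
next
  case (s_join pc r rs t h E' q' E D w q)
  then obtain k where "w' = Suc k" "w \<le> k" by (cases w') auto
  moreover have "Suc (max D' E') \<le> Suc (max D E')" using s_join by auto
  ultimately show ?case using s_join by (auto intro!: safe.s_join[of pc r rs t])
next
  case (s_term pc D E q rs h w)
  then obtain k where "w' = Suc k" by (cases w') auto
  with s_term show ?case by (auto intro!: safe.s_term)
qed

text \<open>A waiting thread is described by its state after service; its request is alone in the
  queue and was issued at the current clock, so that it will get weight 1. A terminated thread keeps
  the resources of its postcondition until it is joined. They then move to the joining thread, and
  what remains is that no handle to it exists. The main thread is never joined and keeps them
  forever.\<close>

definition thread_ok :: "config \<Rightarrow> (tid \<Rightarrow> 'q ghost) \<Rightarrow> (event \<Rightarrow> nat) \<Rightarrow> tid \<Rightarrow> thread \<Rightarrow> bool" where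
  "thread_ok s G dp t th \<longleftrightarrow>
     gE (G t) \<le> B \<and>
     (\<forall>e\<in>th_deps th. e \<in> verts (exec_dag s) \<and>
        dp e \<le> (if th_status th = Terminated then gE (G t) else gD (G t))) \<and>
     (case th_status th of
        Ready \<Rightarrow> safe (gw (G t)) (gD (G t)) (gE (G t)) (gq (G t)) (th_pc th) (th_regs th) (gh (G t))
      | Waiting \<Rightarrow> (\<exists>a c r v. gp (G t) = Some (a, c) \<and> queue s (a, c) = [r] \<and> rq_thread r = t \<and>
            rq_issued r = clock s \<and> rq_event r \<in> verts (exec_dag s) \<and>
            gh (G t) (Cell a c) = Some (Val v) \<and>
            safe (gw (G t)) (gD (G t)) (gE (G t)) (gq (G t)) (th_pc th)
              ((th_regs th)(rq_dest r := rmw_result (rq_op r) v))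
              ((gh (G t))(Cell a c \<mapsto> Val (rmw_new (rq_op r) v))))
      | Suspended \<Rightarrow> False
      | Terminated \<Rightarrow> post (gq (G t)) (th_regs th) (gh (G t)) \<or>
            t \<noteq> 0 \<and> (\<forall>u. Thr t \<notin> dom (gh (G u))))"

definition mem_ok :: "memory \<Rightarrow> bool" where
  "mem_ok m \<longleftrightarrow> finite (dom m) \<and> (\<forall>a cs. m a = Some cs \<longrightarrow> length cs = K)"

text \<open>Exclusive ownership is what excludes contention: two requests at one cell would need two
  owners. It also ensures that every thread is joined at most once.\<close>

definition res_ok :: "config \<Rightarrow> (tid \<Rightarrow> 'q ghost) \<Rightarrow> bool" where
  "res_ok s G \<longleftrightarrow>
     (\<forall>t. threads s t = None \<longrightarrow> gh (G t) = Map.empty) \<and>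
     (\<forall>t u. t \<noteq> u \<longrightarrow> dom (gh (G t)) \<inter> dom (gh (G u)) = {}) \<and>
     (\<forall>t a c x. gh (G t) (Cell a c) = Some x \<longrightarrow>
        (\<exists>cs. mem s a = Some cs \<and> c < length cs \<and> x = Val (cs ! c))) \<and>
     (\<forall>t u x. gh (G t) (Thr u) = Some x \<longrightarrow>
        threads s u \<noteq> None \<and> u \<noteq> 0 \<and> x = Promise (gE (G u)) (gq (G u)))"

text \<open>\<open>dp\<close> is a potential: it strictly increases along edges while no weight
  exceeds 1, so it dominates the weight of every path that ends at a given event.\<close>

definition dag_ok :: "config \<Rightarrow> (event \<Rightarrow> nat) \<Rightarrow> bool" where
  "dag_ok s dp \<longleftrightarrow>
     finite (verts (exec_dag s)) \<and>
     (\<forall>t k. (t, k) \<in> verts (exec_dag s) \<longrightarrow> (\<exists>th. threads s t = Some th \<and> k < th_count th)) \<and>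
     (\<forall>v\<in>verts (exec_dag s). weight (exec_dag s) v \<le> 1 \<and> 1 \<le> dp v \<and> dp v \<le> B) \<and>
     (\<forall>u v. (u, v) \<in> edges (exec_dag s) \<longrightarrow>
        u \<in> verts (exec_dag s) \<and> v \<in> verts (exec_dag s) \<and> dp u < dp v)"

text \<open>\<open>gw\<close> is a credit for instructions still to come. Issuing an instruction
  turns one unit of credit into a vertex of the DAG, and a fork divides the remaining
  credit.\<close>

definition invariant :: "nat \<Rightarrow> config \<Rightarrow> (tid \<Rightarrow> 'q ghost) \<Rightarrow> (event \<Rightarrow> nat) \<Rightarrow> bool" where
  "invariant W s G dp \<longleftrightarrow>
     finite (dom (threads s)) \<and> threads s 0 \<noteq> None \<and> gq (G 0) = main \<and> mem_ok (mem s) \<and> res_ok s G \<and> dag_ok s dp \<and>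
     (\<forall>t th. threads s t = Some th \<longrightarrow> thread_ok s G dp t th) \<and>
     card (verts (exec_dag s)) + (\<Sum>t\<in>dom (threads s). gw (G t)) \<le> W \<and>
     (\<forall>ac. queue s ac \<noteq> [] \<longrightarrow>
        (\<exists>t th. threads s t = Some th \<and> th_status th = Waiting \<and> gp (G t) = Some ac))"

section \<open>Preservation of the invariant by single instructions\<close>

lemma dag_ok_add:
  assumes "dag_ok s dp" "threads s t = Some th" "e = (t, th_count th)"
    and "\<And>d. d \<in> Ds \<Longrightarrow> d \<in> verts (exec_dag s) \<and> dp d \<le> D" "D < B" "wt \<le> 1"
    and "exec_dag s' = add_event e Ds wt (exec_dag s)"
    and "\<And>u thu. threads s u = Some thu \<Longrightarrow> \<exists>th'. threads s' u = Some th' \<and> th_count thu \<le> th_count th'"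
    and "threads s' t = Some th'" "th_count th' = Suc (th_count th)"
  shows "dag_ok s' (dp(e := Suc D))" and "e \<notin> verts (exec_dag s)"
    and "finite (verts (exec_dag s))"
proof -
  show e: "e \<notin> verts (exec_dag s)" using assms(1-3) unfolding dag_ok_def by fastforce
  show "finite (verts (exec_dag s))" using assms(1) unfolding dag_ok_def by auto
  have v: "\<exists>th'. threads s' u = Some th' \<and> k < th_count th'"
    if "(u, k) \<in> verts (exec_dag s)" for u k
    using assms(1) assms(8) that unfolding dag_ok_def by (meson order_less_le_trans)
  show "dag_ok s' (dp(e := Suc D))"
    unfolding dag_ok_def
  proof (intro conjI allI impI)
    show "finite (verts (exec_dag s'))"
      using assms(1,7) unfolding dag_ok_def add_event_def by auto
    show "\<exists>th'. threads s' u = Some th' \<and> k < th_count th'"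
      if "(u, k) \<in> verts (exec_dag s')" for u k
      using that v assms(3,7,9,10) unfolding add_event_def by auto
    show "\<forall>v\<in>verts (exec_dag s'). weight (exec_dag s') v \<le> 1 \<and> 1 \<le> (dp(e := Suc D)) v \<and> (dp(e := Suc D)) v \<le> B"
      using assms(1,5,6,7) unfolding dag_ok_def add_event_def by auto
    fix u v assume uv: "(u, v) \<in> edges (exec_dag s')"
    have ed: "u \<in> verts (exec_dag s) \<and> v \<in> verts (exec_dag s)" if "(u, v) \<in> edges (exec_dag s)"
      using assms(1) that unfolding dag_ok_def by blast
    have cases: "(u, v) \<in> edges (exec_dag s) \<or> u \<in> Ds \<and> v = e"
      using uv assms(7) unfolding add_event_def by auto
    have vs: "verts (exec_dag s') = insert e (verts (exec_dag s))"
      using assms(7) unfolding add_event_def by simp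
    show "u \<in> verts (exec_dag s')" "v \<in> verts (exec_dag s')"
      using cases ed assms(4) vs by blast+
    from cases show "(dp(e := Suc D)) u < (dp(e := Suc D)) v"
    proof
      assume a: "(u, v) \<in> edges (exec_dag s)"
      then have "u \<in> verts (exec_dag s)" "v \<in> verts (exec_dag s)" "dp u < dp v"
        using assms(1) unfolding dag_ok_def by blast+
      moreover then have "u \<noteq> e" "v \<noteq> e" using e by auto
      ultimately show ?thesis by simp
    next
      assume a: "u \<in> Ds \<and> v = e"
      then have "u \<in> verts (exec_dag s)" "dp u \<le> D" using assms(4) by auto
      moreover then have "u \<noteq> e" using e by auto
      ultimately show ?thesis using a by simp
    qed
  qed
qed

text \<open>For threads other than the acting one. The alternative in \<open>h\<close> is the thread
  that has just been joined and has lost its resources; \<open>thr\<close> says that no handle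
  appears out of nothing, so that a joined thread stays unreferenced.\<close>

lemma thread_ok_frame:
  assumes ok: "thread_ok s G dp u th"
    and verts: "verts (exec_dag s) \<subseteq> verts (exec_dag s')"
    and dp: "\<And>v. v \<in> verts (exec_dag s) \<Longrightarrow> dp' v = dp v"
    and G: "gw (G' u) = gw (G u)" "gD (G' u) = gD (G u)" "gE (G' u) = gE (G u)"
      "gq (G' u) = gq (G u)" "gp (G' u) = gp (G u)"
    and h: "gh (G' u) = gh (G u) \<or>
      th_status th = Terminated \<and> u \<noteq> 0 \<and> (\<forall>x. Thr u \<notin> dom (gh (G' x)))"
    and thr: "\<And>x. Thr u \<in> dom (gh (G' x)) \<Longrightarrow> \<exists>y. Thr u \<in> dom (gh (G y))"
    and clk: "clock s' = clock s"
    and q: "\<And>ac. th_status th = Waiting \<Longrightarrow> gp (G u) = Some ac \<Longrightarrow> queue s' ac = queue s ac"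
  shows "thread_ok s' G' dp' u th"
proof -
  have "thread_ok s' G' dp' u th" if hh: "gh (G' u) = gh (G u)"
  proof -
    have 1: "\<forall>e\<in>th_deps th. e \<in> verts (exec_dag s') \<and>
        dp' e \<le> (if th_status th = Terminated then gE (G' u) else gD (G' u))"
      using ok verts dp G unfolding thread_ok_def by auto
    show ?thesis
    proof (cases "th_status th")
      case Ready
      then show ?thesis using ok 1 G hh unfolding thread_ok_def by simp
    next
      case Waiting
      then obtain a c r v where w: "gp (G u) = Some (a, c)" "queue s (a, c) = [r]" "rq_thread r = u"
            "rq_issued r = clock s" "rq_event r \<in> verts (exec_dag s)"
            "gh (G u) (Cell a c) = Some (Val v)"
            "safe (gw (G u)) (gD (G u)) (gE (G u)) (gq (G u)) (th_pc th)
              ((th_regs th)(rq_dest r := rmw_result (rq_op r) v))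
              ((gh (G u))(Cell a c \<mapsto> Val (rmw_new (rq_op r) v)))"
        using ok unfolding thread_ok_def by auto
      then show ?thesis using ok 1 G hh Waiting verts clk q[OF Waiting w(1)]
        unfolding thread_ok_def by (auto simp del: fun_upd_apply)
    next
      case Suspended
      then show ?thesis using ok unfolding thread_ok_def by simp
    next
      case Terminated
      then have "post (gq (G u)) (th_regs th) (gh (G u)) \<or> u \<noteq> 0 \<and> (\<forall>x. Thr u \<notin> dom (gh (G x)))"
        using ok unfolding thread_ok_def by simp
      then have "post (gq (G' u)) (th_regs th) (gh (G' u)) \<or> u \<noteq> 0 \<and> (\<forall>x. Thr u \<notin> dom (gh (G' x)))"
        using G hh thr by metis
      then show ?thesis using ok 1 G Terminated unfolding thread_ok_def by simp
    qed
  qed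
  moreover have "thread_ok s' G' dp' u th" if "th_status th = Terminated" "u \<noteq> 0"
    "\<forall>x. Thr u \<notin> dom (gh (G' x))"
    using that ok verts dp G unfolding thread_ok_def by auto
  ultimately show ?thesis using h by blast
qed

text \<open>Common to all instructions that update the thread table only at the issuing thread. A
  fork also adds an entry and is treated in \<open>issue_Fork\<close>.\<close>

lemma inv_step:
  assumes inv: "invariant W s G dp" and th: "threads s t = Some th" "th_status th = Ready"
    and thr': "threads s' = (threads s)(t \<mapsto> th')" and cnt: "th_count th' = Suc (th_count th)"
    and e: "e = (t, th_count th)"
    and dag: "exec_dag s' = add_event e Ds wt (exec_dag s)" and wt: "wt \<le> 1"
    and Ds: "\<And>d. d \<in> Ds \<Longrightarrow> d \<in> verts (exec_dag s) \<and> dp d \<le> D" and D: "D < B"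
    and clk: "clock s' = clock s"
    and w: "gw (G' t) < gw (G t)"
    and G: "\<And>x. x \<noteq> t \<Longrightarrow> gw (G' x) = gw (G x) \<and> gD (G' x) = gD (G x) \<and> gE (G' x) = gE (G x) \<and>
      gq (G' x) = gq (G x) \<and> gp (G' x) = gp (G x)"
    and h: "\<And>x. x \<noteq> t \<Longrightarrow> gh (G' x) = gh (G x) \<or> (\<exists>thx. threads s x = Some thx \<and>
      th_status thx = Terminated \<and> x \<noteq> 0 \<and> (\<forall>y. Thr x \<notin> dom (gh (G' y))))"
    and g0: "gq (G' 0) = gq (G 0)"
    and thr: "\<And>u x. Thr u \<in> dom (gh (G' x)) \<Longrightarrow> \<exists>y. Thr u \<in> dom (gh (G y))"
    and mem: "mem_ok (mem s')" and res: "res_ok s' G'"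
    and q1: "\<And>ac u. u \<noteq> t \<Longrightarrow> queue s ac \<noteq> [] \<Longrightarrow> gp (G u) = Some ac \<Longrightarrow> queue s' ac = queue s ac"
    and q2: "\<And>ac. queue s' ac \<noteq> [] \<Longrightarrow> queue s ac \<noteq> [] \<or> th_status th' = Waiting \<and> gp (G' t) = Some ac"
    and ok: "thread_ok s' G' (dp(e := Suc D)) t th'"
  shows "invariant W s' G' (dp(e := Suc D))"
proof -
  note I = inv[unfolded invariant_def]
  have dok: "dag_ok s dp" using I by blast
  have grow: "\<exists>th'. threads s' u = Some th' \<and> th_count thu \<le> th_count th'"
    if "threads s u = Some thu" for u thu
    using that thr' cnt th(1) by auto
  have tt: "threads s' t = Some th'" using thr' by simp
  note dg = dag_ok_add[OF dok th(1) e Ds D wt dag grow tt cnt]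
  have vs: "verts (exec_dag s') = insert e (verts (exec_dag s))" using dag unfolding add_event_def by simp
  have tok: "thread_ok s' G' (dp(e := Suc D)) u thu" if u: "threads s' u = Some thu" for u thu
  proof (cases "u = t")
    case True
    then show ?thesis using u ok thr' by auto
  next
    case False
    then have su: "threads s u = Some thu" using u thr' by simp
    then have oku: "thread_ok s G dp u thu" using I by blast
    show ?thesis
    proof (rule thread_ok_frame[OF oku])
      show "gh (G' u) = gh (G u) \<or>
        th_status thu = Terminated \<and> u \<noteq> 0 \<and> (\<forall>x. Thr u \<notin> dom (gh (G' x)))"
        using h[OF False] su by auto
      fix ac assume a: "th_status thu = Waiting" "gp (G u) = Some ac"
      then have "queue s ac \<noteq> []" using oku unfolding thread_ok_def by auto
      then show "queue s' ac = queue s ac" using q1[OF False] a by simp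
    qed (use G[OF False] vs dg(2) thr clk in auto)
  qed
  have fin: "finite (dom (threads s))" and t: "t \<in> dom (threads s)" using I th by auto
  have "(\<Sum>x\<in>dom (threads s). gw (G' x)) = gw (G' t) + (\<Sum>x\<in>dom (threads s) - {t}. gw (G' x))"
    using sum.remove[OF fin t] by blast
  moreover have "(\<Sum>x\<in>dom (threads s). gw (G x)) = gw (G t) + (\<Sum>x\<in>dom (threads s) - {t}. gw (G x))"
    using sum.remove[OF fin t] by blast
  moreover have "(\<Sum>x\<in>dom (threads s) - {t}. gw (G' x)) = (\<Sum>x\<in>dom (threads s) - {t}. gw (G x))"
    using G by (intro sum.cong) auto
  moreover have "dom (threads s') = dom (threads s)" using thr' t by auto
  moreover have "card (verts (exec_dag s')) = Suc (card (verts (exec_dag s)))" using vs dg(2,3) by simp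
  ultimately have wk: "card (verts (exec_dag s')) + (\<Sum>t\<in>dom (threads s'). gw (G' t)) \<le> W"
    using I w by simp
  have qq: "\<exists>u thu. threads s' u = Some thu \<and> th_status thu = Waiting \<and> gp (G' u) = Some ac"
    if "queue s' ac \<noteq> []" for ac
    using q2[OF that]
  proof
    assume "queue s ac \<noteq> []"
    then obtain u thu where u: "threads s u = Some thu" "th_status thu = Waiting" "gp (G u) = Some ac"
      using I by blast
    then have "u \<noteq> t" using th by auto
    then show ?thesis using u thr' G by (intro exI[of _ u] exI[of _ thu]) auto
  next
    assume "th_status th' = Waiting \<and> gp (G' t) = Some ac"
    then show ?thesis using thr' by auto
  qed
  show ?thesis unfolding invariant_def
    using I thr' mem res dg(1) tok wk qq g0 by auto
qed

lemma res_okD: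
  assumes "res_ok s G"
  shows "threads s t = None \<Longrightarrow> gh (G t) = Map.empty"
    and "t \<noteq> u \<Longrightarrow> gh (G t) k = Some x \<Longrightarrow> gh (G u) k = None"
    and "gh (G t) (Cell a c) = Some x \<Longrightarrow> \<exists>cs. mem s a = Some cs \<and> c < length cs \<and> x = Val (cs ! c)"
    and "gh (G t) (Thr u) = Some x \<Longrightarrow> threads s u \<noteq> None \<and> u \<noteq> 0 \<and> x = Promise (gE (G u)) (gq (G u))"
  using assms unfolding res_ok_def by (blast | (metis disjoint_iff domIff option.distinct(1)))+

lemma res_okI:
  assumes "\<And>t. threads s t = None \<Longrightarrow> gh (G t) = Map.empty"
    and "\<And>t u k x y. t \<noteq> u \<Longrightarrow> gh (G t) k = Some x \<Longrightarrow> gh (G u) k = Some y \<Longrightarrow> False"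
    and "\<And>t a c x. gh (G t) (Cell a c) = Some x \<Longrightarrow> \<exists>cs. mem s a = Some cs \<and> c < length cs \<and> x = Val (cs ! c)"
    and "\<And>t u x. gh (G t) (Thr u) = Some x \<Longrightarrow> threads s u \<noteq> None \<and> u \<noteq> 0 \<and> x = Promise (gE (G u)) (gq (G u))"
  shows "res_ok s G"
  unfolding res_ok_def using assms(1,3,4) assms(2) by (auto; blast)

lemma local_step_kinds:
  assumes "local_step t i pc rs = Some x"
  shows "i \<noteq> Access d f p c" "i \<noteq> NewNode d" "i \<noteq> Fork d l" "i \<noteq> Join r" "i \<noteq> Terminate"
    "i \<noteq> Suspend" "i \<noteq> Resume r"
  using assms by auto

lemma ready_facts:
  assumes inv: "invariant W s G dp" and th: "threads s t = Some th" "th_status th = Ready"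
  shows "safe (gw (G t)) (gD (G t)) (gE (G t)) (gq (G t)) (th_pc th) (th_regs th) (gh (G t))"
    and "\<And>d. d \<in> th_deps th \<Longrightarrow> d \<in> verts (exec_dag s) \<and> dp d \<le> gD (G t)"
    and "gE (G t) \<le> B" and "gD (G t) < B" and "res_ok s G" and "mem_ok (mem s)"
proof -
  have "thread_ok s G dp t th" using inv th unfolding invariant_def by blast
  then show 1: "safe (gw (G t)) (gD (G t)) (gE (G t)) (gq (G t)) (th_pc th) (th_regs th) (gh (G t))"
    and "\<And>d. d \<in> th_deps th \<Longrightarrow> d \<in> verts (exec_dag s) \<and> dp d \<le> gD (G t)"
    and 2: "gE (G t) \<le> B"
    using th(2) unfolding thread_ok_def by auto
  show "gD (G t) < B" using safe_depth[OF 1 2] .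
  show "res_ok s G" "mem_ok (mem s)" using inv unfolding invariant_def by blast+
qed

lemma issue_Local:
  assumes inv: "invariant W s G dp"
    and at: "at_instr P s t th i" and ls: "local_step t i (th_pc th) (th_regs th) = Some (pc', rs')"
  shows "\<exists>G' dp'. invariant W (s\<lparr>threads := (threads s)(t \<mapsto> advance th (t, th_count th) pc' rs' Ready),
          exec_dag := add_event (t, th_count th) (th_deps th) 1 (exec_dag s)\<rparr>) G' dp'"
proof -
  have th: "threads s t = Some th" "th_status th = Ready" "P ! th_pc th = i"
    using at unfolding at_instr_def by auto
  note F = ready_facts[OF inv th(1,2)]
  obtain w where w: "gw (G t) = Suc w"
    "safe w (Suc (gD (G t))) (gE (G t)) (gq (G t)) pc' rs' (gh (G t))"
    using F(1)
  proof (cases rule: safe.cases)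
    case (s_local pc1 rs1 w)
    then have "local_step t i (th_pc th) (th_regs th) = Some (pc1, rs1)" using th by blast
    with s_local ls that show ?thesis by auto
  qed (use ls th local_step_kinds in auto)
  define G' where "G' = G(t := (G t)\<lparr>gw := w, gD := Suc (gD (G t))\<rparr>)"
  have "invariant W (s\<lparr>threads := (threads s)(t \<mapsto> advance th (t, th_count th) pc' rs' Ready),
          exec_dag := add_event (t, th_count th) (th_deps th) 1 (exec_dag s)\<rparr>) G'
     (dp((t, th_count th) := Suc (gD (G t))))"
  proof (rule inv_step[OF inv th(1,2) _ _ refl _ _ F(2) F(4)])
    show "thread_ok (s\<lparr>threads := (threads s)(t \<mapsto> advance th (t, th_count th) pc' rs' Ready),
         exec_dag := add_event (t, th_count th) (th_deps th) 1 (exec_dag s)\<rparr>)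
     G' (dp((t, th_count th) := Suc (gD (G t)))) t (advance th (t, th_count th) pc' rs' Ready)"
      using F w unfolding thread_ok_def G'_def advance_def add_event_def by auto
    show "res_ok (s\<lparr>threads := (threads s)(t \<mapsto> advance th (t, th_count th) pc' rs' Ready),
                exec_dag := add_event (t, th_count th) (th_deps th) 1 (exec_dag s)\<rparr>) G'"
      using F(5) th unfolding res_ok_def G'_def by (auto split: if_splits)
  qed (use F w in \<open>auto simp: G'_def advance_def split: if_splits\<close>)
  then show ?thesis by blast
qed

lemma issue_NewNode:
  assumes inv: "invariant W s G dp"
    and at: "at_instr P s t th (NewNode d)" and a: "a \<notin> dom (mem s)"
  shows "\<exists>G' dp'. invariant W (s\<lparr>mem := (mem s)(a \<mapsto> replicate K NullV),
          threads := (threads s)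
            (t \<mapsto> advance th (t, th_count th) (Suc (th_pc th)) ((th_regs th)(d := NodeV a)) Ready),
          exec_dag := add_event (t, th_count th) (th_deps th) 1 (exec_dag s)\<rparr>) G' dp'" (is "\<exists>G' dp'. invariant W ?s G' dp'")
proof -
  have th: "threads s t = Some th" "th_status th = Ready" "P ! th_pc th = NewNode d"
    using at unfolding at_instr_def by auto
  note F = ready_facts[OF inv th(1,2)]
  have no: "gh (G u) (Cell a c) = None" for u c
    using res_okD(3)[OF F(5), of u a c] a by (cases "gh (G u) (Cell a c)") auto
  obtain w where w: "gw (G t) = Suc w"
    "safe w (Suc (gD (G t))) (gE (G t)) (gq (G t)) (Suc (th_pc th)) ((th_regs th)(d := NodeV a))
      (gh (G t) ++ fresh_cells K a)"
    using F(1)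
  proof (cases rule: safe.cases)
    case (s_local pc1 rs1 w)
    then show ?thesis using th local_step_kinds by auto
  next
    case (s_new d' w)
    then show ?thesis using th no that[of w] by (auto simp: domIff)
  qed (use th in auto)
  define G' where "G' = G(t := (G t)\<lparr>gw := w, gD := Suc (gD (G t)), gh := gh (G t) ++ fresh_cells K a\<rparr>)"
  have hG: "gh (G' u) k = (if u = t then (gh (G t) ++ fresh_cells K a) k else gh (G u) k)" for u k
    unfolding G'_def by simp
  have fc: "fresh_cells K a k = Some x \<Longrightarrow> \<exists>c<K. k = Cell a c \<and> x = Val NullV" for k x
    unfolding fresh_cells_def by (auto split: key.splits if_splits)
  have EQ: "gE (G' u) = gE (G u)" "gq (G' u) = gq (G u)" for u unfolding G'_def by auto
  have "invariant W ?s G' (dp((t, th_count th) := Suc (gD (G t))))"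
  proof (rule inv_step[OF inv th(1,2) _ _ refl _ _ F(2) F(4)])
    show "thread_ok ?s G' (dp((t, th_count th) := Suc (gD (G t)))) t
      (advance th (t, th_count th) (Suc (th_pc th)) ((th_regs th)(d := NodeV a)) Ready)"
      using F w unfolding thread_ok_def G'_def advance_def add_event_def by auto
    show "res_ok ?s G'"
    proof (rule res_okI)
      fix u assume "threads ?s u = None"
      then show "gh (G' u) = Map.empty" using res_okD(1)[OF F(5)] th unfolding G'_def by (auto split: if_splits)
    next
      fix u v k x y assume "u \<noteq> v" "gh (G' u) k = Some x" "gh (G' v) k = Some y"
      then show False using res_okD(2)[OF F(5), of u v k] no fc
        by (auto simp: hG map_add_Some_iff split: if_splits)
           (metis option.distinct(1) res_okD(2)[OF F(5)] no fc)+
    next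
      fix u b c x assume "gh (G' u) (Cell b c) = Some x"
      then have "gh (G u) (Cell b c) = Some x \<or> fresh_cells K a (Cell b c) = Some x"
        by (auto simp: hG map_add_Some_iff split: if_splits)
      then show "\<exists>cs. mem ?s b = Some cs \<and> c < length cs \<and> x = Val (cs ! c)"
        using res_okD(3)[OF F(5), of u b c x] fc[of "Cell b c" x] a by auto
    next
      fix u v x assume "gh (G' u) (Thr v) = Some x"
      then have "gh (G u) (Thr v) = Some x" using fc[of "Thr v"]
        by (auto simp: hG map_add_Some_iff split: if_splits)
      then show "threads ?s v \<noteq> None \<and> v \<noteq> 0 \<and> x = Promise (gE (G' v)) (gq (G' v))"
        using res_okD(4)[OF F(5)] by (auto simp: EQ)
    qed
    show "mem_ok (mem ?s)" using F(6) unfolding mem_ok_def by auto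
    fix u x assume "Thr u \<in> dom (gh (G' x))"
    then show "\<exists>y. Thr u \<in> dom (gh (G y))"
      using fc[of "Thr u"] by (auto simp: hG map_add_Some_iff dom_def split: if_splits)
  qed (use F w in \<open>auto simp: G'_def advance_def split: if_splits\<close>)
  then show ?thesis by blast
qed

lemma issue_Access:
  assumes inv: "invariant W s G dp"
    and at: "at_instr P s t th (Access d f p c)" and p: "th_regs th p = NodeV a"
    and "mem s a = Some cs" "c < length cs"
    and r: "r = \<lparr>rq_thread = t, rq_dest = d, rq_op = map_rmw (th_regs th) f,
          rq_event = (t, th_count th), rq_issued = clock s\<rparr>"
  shows "\<exists>G' dp'. invariant W (s\<lparr>queue := (queue s)((a, c) := queue s (a, c) @ [r]),
          threads := (threads s)(t \<mapsto> advance th (t, th_count th) (Suc (th_pc th)) (th_regs th) Waiting),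
          exec_dag := add_event (t, th_count th) (th_deps th) 0 (exec_dag s)\<rparr>) G' dp'" (is "\<exists>G' dp'. invariant W ?s G' dp'")
proof -
  have th: "threads s t = Some th" "th_status th = Ready" "P ! th_pc th = Access d f p c"
    using at unfolding at_instr_def by auto
  note F = ready_facts[OF inv th(1,2)]
  obtain w v where w: "gw (G t) = Suc w" and hv: "gh (G t) (Cell a c) = Some (Val v)"
    and sf: "safe w (Suc (gD (G t))) (gE (G t)) (gq (G t)) (Suc (th_pc th))
      ((th_regs th)(d := rmw_result (map_rmw (th_regs th) f) v))
       ((gh (G t))(Cell a c \<mapsto> Val (rmw_new (map_rmw (th_regs th) f) v)))"
    using F(1)
  proof (cases rule: safe.cases)
    case (s_local pc1 rs1 w)
    then show ?thesis using th local_step_kinds by auto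
  next
    case (s_access d' f' p' c' a' v' w)
    then show ?thesis using th p that[of w v'] by (auto simp del: fun_upd_apply)
  qed (use th in auto)
  \<comment> \<open>A pending request would belong to a waiting thread that owns the cell, but the
    owner is \<open>t\<close>, which is ready.\<close>
  have q0: "queue s (a, c) = []"
  proof (rule ccontr)
    assume "queue s (a, c) \<noteq> []"
    then obtain u thu where u: "threads s u = Some thu" "th_status thu = Waiting" "gp (G u) = Some (a, c)"
      using inv unfolding invariant_def by blast
    then have "thread_ok s G dp u thu" using inv unfolding invariant_def by blast
    then have "gh (G u) (Cell a c) \<noteq> None" using u unfolding thread_ok_def by auto
    moreover have "u \<noteq> t" using u th by auto
    ultimately show False using res_okD(2)[OF F(5), of t u] hv by auto
  qed
  define G' where "G' = G(t := (G t)\<lparr>gw := w, gD := Suc (gD (G t)), gp := Some (a, c)\<rparr>)"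
  have "invariant W ?s G' (dp((t, th_count th) := Suc (gD (G t))))"
  proof (rule inv_step[OF inv th(1,2) _ _ refl _ _ F(2) F(4)])
    show "thread_ok ?s G' (dp((t, th_count th) := Suc (gD (G t)))) t
      (advance th (t, th_count th) (Suc (th_pc th)) (th_regs th) Waiting)"
      using F w hv sf q0 unfolding thread_ok_def G'_def advance_def add_event_def r
      by (auto simp del: fun_upd_apply simp: fun_upd_same)
    show "res_ok ?s G'"
      using F(5) th unfolding res_ok_def G'_def by (auto split: if_splits)
    fix ac u assume a: "u \<noteq> t" "queue s ac \<noteq> []" "gp (G u) = Some ac"
    then show "queue ?s ac = queue s ac" using q0 by auto
  qed (use F w in \<open>auto simp: G'_def advance_def split: if_splits\<close>)
  then show ?thesis by blast
qed

lemma issue_Terminate: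
  assumes inv: "invariant W s G dp" and at: "at_instr P s t th Terminate"
  shows "\<exists>G' dp'. invariant W (s\<lparr>threads := (threads s)(t \<mapsto> advance th (t, th_count th) (th_pc th) (th_regs th) Terminated),
          exec_dag := add_event (t, th_count th) (th_deps th) 1 (exec_dag s)\<rparr>) G' dp'" (is "\<exists>G' dp'. invariant W ?s G' dp'")
proof -
  have th: "threads s t = Some th" "th_status th = Ready" "P ! th_pc th = Terminate"
    using at unfolding at_instr_def by auto
  note F = ready_facts[OF inv th(1,2)]
  obtain w where w: "gw (G t) = Suc w" and D: "gD (G t) < gE (G t)"
    and ps: "post (gq (G t)) (th_regs th) (gh (G t))"
    using F(1)
  proof (cases rule: safe.cases)
    case (s_local pc1 rs1 w)
    then show ?thesis using th local_step_kinds by auto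
  qed (use th in auto)
  define G' where "G' = G(t := (G t)\<lparr>gw := w, gD := Suc (gD (G t))\<rparr>)"
  have "invariant W ?s G' (dp((t, th_count th) := Suc (gD (G t))))"
  proof (rule inv_step[OF inv th(1,2) _ _ refl _ _ F(2) F(4)])
    show "thread_ok ?s G' (dp((t, th_count th) := Suc (gD (G t)))) t
      (advance th (t, th_count th) (th_pc th) (th_regs th) Terminated)"
      using F w D ps unfolding thread_ok_def G'_def advance_def add_event_def by auto
    show "res_ok ?s G'"
      using F(5) th unfolding res_ok_def G'_def by (auto split: if_splits)
  qed (use F w in \<open>auto simp: G'_def advance_def split: if_splits\<close>)
  then show ?thesis by blast
qed

lemma issue_Join:
  assumes inv: "invariant W s G dp" and at: "at_instr P s t th (Join r)"
    and r: "th_regs th r = ThreadV u" and u: "threads s u = Some thu" "th_status thu = Terminated"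
  shows "\<exists>G' dp'. invariant W (s\<lparr>threads := (threads s)(t \<mapsto> advance th (t, th_count th) (Suc (th_pc th)) (th_regs th) Ready),
          exec_dag := add_event (t, th_count th) (th_deps th \<union> th_deps thu) 1 (exec_dag s)\<rparr>) G' dp'" (is "\<exists>G' dp'. invariant W ?s G' dp'")
proof -
  have th: "threads s t = Some th" "th_status th = Ready" "P ! th_pc th = Join r"
    using at unfolding at_instr_def by auto
  note F = ready_facts[OF inv th(1,2)]
  have ut: "u \<noteq> t" using th u by auto
  obtain w E' q' where w: "gw (G t) = Suc w" and hu: "gh (G t) (Thr u) = Some (Promise E' q')"
    and E': "E' < gE (G t)" and D: "gD (G t) < gE (G t)"
    and sf: "\<And>rs' h'. post q' rs' h' \<Longrightarrow> dom h' \<inter> dom (gh (G t)) = {} \<Longrightarrow>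
        safe w (Suc (max (gD (G t)) E')) (gE (G t)) (gq (G t)) (Suc (th_pc th)) (th_regs th)
          ((gh (G t))(Thr u := None) ++ h')"
    using F(1)
  proof (cases rule: safe.cases)
    case (s_local pc1 rs1 w)
    then show ?thesis using th local_step_kinds by auto
  next
    case (s_join r' t' E' q' w)
    then show ?thesis using th r that[of w E' q'] by (auto simp del: fun_upd_apply)
  qed (use th in auto)
  have Eq: "E' = gE (G u)" "q' = gq (G u)" and u0: "u \<noteq> 0" using res_okD(4)[OF F(5) hu] by auto
  have oku: "thread_ok s G dp u thu" using inv u unfolding invariant_def by blast
  \<comment> \<open>As \<open>t\<close> holds a handle of \<open>u\<close>, the resources of
    \<open>u\<close> have not been handed over before.\<close>
  then have ps: "post (gq (G u)) (th_regs thu) (gh (G u))"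
    using u hu unfolding thread_ok_def by auto
  have disj: "dom (gh (G u)) \<inter> dom (gh (G t)) = {}" using F(5) ut unfolding res_ok_def by blast
  note sf = sf[unfolded Eq, OF ps disj]
  \<comment> \<open>The last event of a terminated thread is only known to lie below its deadline,
    hence \<open>E'\<close> and not a current depth.\<close>
  define D' where "D' = max (gD (G t)) E'"
  define G' where "G' = G(u := (G u)\<lparr>gh := Map.empty\<rparr>,
     t := (G t)\<lparr>gw := w, gD := Suc D', gh := (gh (G t))(Thr u := None) ++ gh (G u)\<rparr>)"
  have hG: "gh (G' x) k = (if x = t then ((gh (G t))(Thr u := None) ++ gh (G u)) k
     else if x = u then None else gh (G x) k)" for x k
    unfolding G'_def by simp
  have EQ: "gE (G' x) = gE (G x)" "gq (G' x) = gq (G x)" for x unfolding G'_def by auto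
  have D'B: "D' < B" using F(4) F(3) E' unfolding D'_def by auto
  have sub: "gh (G' x) k = Some y \<Longrightarrow> gh (G x) k = Some y \<or> x = t \<and> gh (G u) k = Some y" for x k y
    by (auto simp: hG map_add_Some_iff split: if_splits)
  \<comment> \<open>The handle of \<open>u\<close> was owned by \<open>t\<close> alone, so neither
    another thread nor \<open>u\<close> itself can bring it back.\<close>
  have nou: "gh (G' x) (Thr u) = None" for x
  proof (cases "gh (G' x) (Thr u)")
    case (Some y)
    then have "x \<noteq> t \<Longrightarrow> gh (G x) (Thr u) = Some y" using sub by blast
    then have "x = t" using res_okD(2)[OF F(5) _ hu, of x] by auto
    then have "gh (G u) (Thr u) \<noteq> None" using Some by (auto simp: hG map_add_Some_iff)
    then show ?thesis using res_okD(2)[OF F(5) _ hu, of u] ut by auto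
  qed
  have "invariant W ?s G' (dp((t, th_count th) := Suc D'))"
  proof (rule inv_step[OF inv th(1,2) _ _ refl _ _ _ D'B])
    show "thread_ok ?s G' (dp((t, th_count th) := Suc D')) t
      (advance th (t, th_count th) (Suc (th_pc th)) (th_regs th) Ready)"
      using F w sf unfolding thread_ok_def G'_def advance_def add_event_def D'_def Eq
      by (auto simp del: fun_upd_apply simp: fun_upd_same)
    show "res_ok ?s G'"
    proof (rule res_okI)
      fix x assume "threads ?s x = None"
      then show "gh (G' x) = Map.empty" using res_okD(1)[OF F(5)] th unfolding G'_def by (auto split: if_splits)
    next
      fix x y k a b assume xy: "x \<noteq> y" and a: "gh (G' x) k = Some a" and b: "gh (G' y) k = Some b"
      have "x \<noteq> u" "y \<noteq> u" using a b ut by (auto simp: hG split: if_splits)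
      then show False using sub[OF a] sub[OF b] xy res_okD(2)[OF F(5)] by (metis option.distinct(1))
    next
      fix x b c y assume "gh (G' x) (Cell b c) = Some y"
      then show "\<exists>cs. mem ?s b = Some cs \<and> c < length cs \<and> y = Val (cs ! c)"
        using sub res_okD(3)[OF F(5)] by fastforce
    next
      fix x v y assume "gh (G' x) (Thr v) = Some y"
      then show "threads ?s v \<noteq> None \<and> v \<noteq> 0 \<and> y = Promise (gE (G' v)) (gq (G' v))"
        using sub res_okD(4)[OF F(5)] by (fastforce simp: EQ)
    qed
    show "\<And>x. x \<noteq> t \<Longrightarrow> gh (G' x) = gh (G x) \<or> (\<exists>thx. threads s x = Some thx \<and>
      th_status thx = Terminated \<and> x \<noteq> 0 \<and> (\<forall>y. Thr x \<notin> dom (gh (G' y))))"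
      using u nou u0 by (auto simp: G'_def domIff)
    fix v x assume "Thr v \<in> dom (gh (G' x))"
    then show "\<exists>y. Thr v \<in> dom (gh (G y))" using sub by blast
  next
    show "\<And>d. d \<in> th_deps th \<union> th_deps thu \<Longrightarrow> d \<in> verts (exec_dag s) \<and> dp d \<le> D'"
      using F(2) oku u unfolding thread_ok_def D'_def Eq by fastforce
  qed (use F w ut in \<open>auto simp: G'_def advance_def split: if_splits\<close>)
  then show ?thesis by blast
qed

lemma thread_ok_ready:
  assumes "th_status th = Ready" "gE (G t) \<le> B"
    and "\<And>e. e \<in> th_deps th \<Longrightarrow> e \<in> verts (exec_dag s) \<and> dp e \<le> gD (G t)"
    and "safe (gw (G t)) (gD (G t)) (gE (G t)) (gq (G t)) (th_pc th) (th_regs th) (gh (G t))"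
  shows "thread_ok s G dp t th"
  using assms unfolding thread_ok_def by simp

text \<open>The child takes \<open>h1\<close>, the parent keeps \<open>h2\<close> and receives the
  handle in exchange. The handle is new because handles refer to existing threads only.\<close>

lemma issue_Fork:
  assumes inv: "invariant W s G dp" and at: "at_instr P s t th (Fork d l)" and u: "u \<notin> dom (threads s)"
  shows "\<exists>G' dp'. invariant W (s\<lparr>threads := (threads s)
            (t \<mapsto> advance th (t, th_count th) (Suc (th_pc th)) ((th_regs th)(d := ThreadV u)) Ready,
             u \<mapsto> \<lparr>th_pc = l, th_regs = th_regs th, th_status = Ready,
                    th_count = 0, th_deps = {(t, th_count th)}\<rparr>),
          exec_dag := add_event (t, th_count th) (th_deps th) 1 (exec_dag s)\<rparr>) G' dp'" (is "\<exists>G' dp'. invariant W ?s G' dp'")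
proof -
  have th: "threads s t = Some th" "th_status th = Ready" "P ! th_pc th = Fork d l"
    using at unfolding at_instr_def by auto
  note F = ready_facts[OF inv th(1,2)]
  note I = inv[unfolded invariant_def]
  have ut: "u \<noteq> t" and u0: "u \<noteq> 0" using u th I by auto
  have Gu: "gh (G u) = Map.empty" using res_okD(1)[OF F(5)] u by auto
  have nou: "gh (G x) (Thr u) = None" for x
    using res_okD(4)[OF F(5), of x u] u by (cases "gh (G x) (Thr u)") auto
  obtain h1 h2 E' q' w1 w2 where w: "gw (G t) = Suc (w1 + w2)" and h: "gh (G t) = h1 ++ h2"
    and dj: "dom h1 \<inter> dom h2 = {}" and E'B: "E' \<le> B"
    and sf1: "safe w1 (Suc (gD (G t))) E' q' l (th_regs th) h1"
    and sf2: "safe w2 (Suc (gD (G t))) (gE (G t)) (gq (G t)) (Suc (th_pc th)) ((th_regs th)(d := ThreadV u))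
       (h2(Thr u \<mapsto> Promise E' q'))"
    using F(1)
  proof (cases rule: safe.cases)
    case (s_local pc1 rs1 w)
    then show ?thesis using th local_step_kinds by auto
  next
    case (s_fork d' l' h1 h2 E' w1 q' w2)
    have "Thr u \<notin> dom h2" using nou[of t] s_fork by (auto simp: map_add_def split: option.splits)
    then show ?thesis using s_fork th that[of w1 w2 h1 h2 E' q'] by auto
  qed (use th in auto)
  define e where "e = (t, th_count th)"
  let ?D = "gD (G t)" let ?dp = "dp(e := Suc ?D)"
  define th' where "th' = advance th e (Suc (th_pc th)) ((th_regs th)(d := ThreadV u)) Ready"
  define thu where "thu = \<lparr>th_pc = l, th_regs = th_regs th, th_status = Ready, th_count = 0, th_deps = {e}\<rparr>"
  define s' where "s' = ?s"
  have s': "threads s' = (threads s)(t \<mapsto> th', u \<mapsto> thu)" "mem s' = mem s" "queue s' = queue s"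
    "clock s' = clock s" "exec_dag s' = add_event e (th_deps th) 1 (exec_dag s)"
    unfolding s'_def th'_def thu_def e_def by auto
  define G' where "G' = G(t := (G t)\<lparr>gw := w2, gD := Suc ?D, gh := h2(Thr u \<mapsto> Promise E' q')\<rparr>,
     u := \<lparr>gw = w1, gD = Suc ?D, gE = E', gq = q', gh = h1, gp = None\<rparr>)"
  have hG: "gh (G' x) k = (if x = u then h1 k else if x = t then (h2(Thr u \<mapsto> Promise E' q')) k
     else gh (G x) k)" for x k
    unfolding G'_def by simp
  have ht: "gh (G t) k = (case h2 k of None \<Rightarrow> h1 k | Some y \<Rightarrow> Some y)" for k
    unfolding h map_add_def by simp
  have h12: "h1 k = Some x \<Longrightarrow> gh (G t) k = Some x" "h2 k = Some x \<Longrightarrow> gh (G t) k = Some x"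
    "h1 k = Some x \<Longrightarrow> h2 k = Some y \<Longrightarrow> False" for k x y
    using dj ht[of k] by (auto split: option.splits)
  have sub: "\<exists>z. gh (G z) k = Some y" if "k \<noteq> Thr u" "gh (G' x) k = Some y" for x k y
    using that h12(1,2)[of k y] unfolding hG by (metis fun_upd_other)
  have EQ: "gE (G' x) = (if x = u then E' else gE (G x))"
    "gq (G' x) = (if x = u then q' else gq (G x))" for x using ut unfolding G'_def by auto
  have dok: "dag_ok s dp" using I by blast
  have grow: "\<exists>th'. threads s' x = Some th' \<and> th_count thx \<le> th_count th'"
    if "threads s x = Some thx" for x thx
    using that s' th(1) u unfolding th'_def advance_def by auto
  have tt: "threads s' t = Some th'" "th_count th' = Suc (th_count th)"
    using s' ut unfolding th'_def advance_def by auto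
  note dg = dag_ok_add[OF dok th(1) e_def F(2) F(4) _ s'(5) grow tt, simplified]
  have vs: "verts (exec_dag s') = insert e (verts (exec_dag s))" using s' unfolding add_event_def by simp
  have tok: "thread_ok s' G' ?dp x thx" if x: "threads s' x = Some thx" for x thx
  proof -
    consider "x = t" | "x = u" | "x \<noteq> t" "x \<noteq> u" by blast
    then show ?thesis
    proof cases
      case 1
      have "thx = th'" using 1 x s' ut by simp
      moreover have "G' t = (G t)\<lparr>gw := w2, gD := Suc ?D, gh := h2(Thr u \<mapsto> Promise E' q')\<rparr>"
        using ut unfolding G'_def by simp
      ultimately show ?thesis unfolding 1
        by (intro thread_ok_ready) (use F(3) sf2 vs in \<open>simp_all only: th'_def advance_def, simp_all\<close>)
    next
      case 2
      have "thx = thu" using 2 x s' by simp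
      moreover have "G' u = \<lparr>gw = w1, gD = Suc ?D, gE = E', gq = q', gh = h1, gp = None\<rparr>"
        unfolding G'_def by simp
      ultimately show ?thesis unfolding 2
        by (intro thread_ok_ready) (use E'B sf1 vs in \<open>simp_all add: thu_def\<close>)
    next
      case 3
      then have sx: "threads s x = Some thx" using x s' by auto
      then have ok: "thread_ok s G dp x thx" using I by blast
      have Gx: "G' x = G x" using 3 unfolding G'_def by simp
      have vv: "?dp v = dp v" if "v \<in> verts (exec_dag s)" for v using that dg(2) by auto
      show ?thesis
      proof (rule thread_ok_frame[OF ok])
        show "verts (exec_dag s) \<subseteq> verts (exec_dag s')" using vs by blast
        show "gh (G' x) = gh (G x) \<or> th_status thx = Terminated \<and> x \<noteq> 0 \<and> (\<forall>y. Thr x \<notin> dom (gh (G' y)))"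
          using Gx by simp
        fix y assume "Thr x \<in> dom (gh (G' y))"
        then show "\<exists>z. Thr x \<in> dom (gh (G z))"
          using 3 sub by (metis domD domI key.inject(2))
      qed (simp_all only: vv s' Gx)
    qed
  qed
  have res: "res_ok s' G'"
  proof (rule res_okI)
    fix x assume "threads s' x = None"
    then show "gh (G' x) = Map.empty"
      using res_okD(1)[OF F(5)] s' unfolding G'_def by (auto split: if_splits)
  next
    fix x y k a b assume xy: "x \<noteq> y" and a: "gh (G' x) k = Some a" and b: "gh (G' y) k = Some b"
    have ku: "k \<noteq> Thr u"
      using xy a b ut nou h12(1)[of "Thr u"] by (auto simp: hG split: if_splits)
    show False
      using xy a b ku h12[of k] res_okD(2)[OF F(5), of x y k] res_okD(2)[OF F(5), of x t k]
        res_okD(2)[OF F(5), of t y k]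
      by (auto simp: hG split: if_splits)
  next
    fix x b c y assume "gh (G' x) (Cell b c) = Some y"
    then have "\<exists>z. gh (G z) (Cell b c) = Some y" using sub by blast
    then show "\<exists>cs. mem s' b = Some cs \<and> c < length cs \<and> y = Val (cs ! c)"
      using res_okD(3)[OF F(5)] s' by auto
  next
    fix x v y assume a: "gh (G' x) (Thr v) = Some y"
    show "threads s' v \<noteq> None \<and> v \<noteq> 0 \<and> y = Promise (gE (G' v)) (gq (G' v))"
    proof (cases "v = u")
      case True
      then show ?thesis using a u0 nou[of x] nou[of t] h12(1,2)[of "Thr u"] s'
        by (auto simp: hG EQ split: if_splits)
    next
      case False
      then have "\<exists>z. gh (G z) (Thr v) = Some y" using a sub by blast
      then show ?thesis using res_okD(4)[OF F(5)] s' False by (auto simp: EQ)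
    qed
  qed
  have fin: "finite (dom (threads s))" and tin: "t \<in> dom (threads s)" using I th by auto
  have 1: "(\<Sum>x\<in>dom (threads s). gw (G x)) = gw (G t) + (\<Sum>x\<in>dom (threads s) - {t}. gw (G x))"
    using sum.remove[OF fin tin] by blast
  have 2: "dom (threads s') = insert u (insert t (dom (threads s) - {t}))" using s' tin by auto
  have 3: "(\<Sum>x\<in>dom (threads s'). gw (G' x)) =
     w1 + (w2 + (\<Sum>x\<in>dom (threads s) - {t}. gw (G' x)))"
  proof -
    have gw': "gw (G' x) = (if x = u then w1 else if x = t then w2 else gw (G x))" for x
      unfolding G'_def by simp
    have "u \<notin> insert t (dom (threads s) - {t})" using u ut by blast
    then show ?thesis unfolding 2 using fin ut
      by (simp only: sum.insert finite_insert finite_Diff gw' if_True Diff_iff insertI1 simp_thms if_False)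
         (simp add: gw')
  qed
  have 4: "(\<Sum>x\<in>dom (threads s) - {t}. gw (G' x)) = (\<Sum>x\<in>dom (threads s) - {t}. gw (G x))"
    using u by (intro sum.cong) (auto simp: G'_def)
  have 5: "card (verts (exec_dag s')) = Suc (card (verts (exec_dag s)))" using vs dg(2,3) by simp
  have 6: "card (verts (exec_dag s')) + (\<Sum>t\<in>dom (threads s'). gw (G' t)) \<le> W"
    using I 1 3 4 5 w by simp
  have 7: "\<exists>x thx. threads s' x = Some thx \<and> th_status thx = Waiting \<and> gp (G' x) = Some ac"
    if "queue s' ac \<noteq> []" for ac
  proof -
    have "queue s ac \<noteq> []" using that s'(3) by simp
    then obtain x thx where x: "threads s x = Some thx" "th_status thx = Waiting" "gp (G x) = Some ac"
      using I by blast
    then have "x \<noteq> t" "x \<noteq> u" using th u by auto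
    then show ?thesis using x s' unfolding G'_def by (intro exI[of _ x] exI[of _ thx]) auto
  qed
  have "invariant W s' G' ?dp"
    unfolding invariant_def using I s' res dg(1) tok 6 7 u0 by (auto simp: EQ)
  then show ?thesis unfolding s'_def by blast
qed

lemma safe_instr:
  assumes "safe w D E q pc rs h"
  shows "P ! pc \<noteq> Suspend" "P ! pc \<noteq> Resume r"
  using assms by (cases rule: safe.cases; use local_step_kinds in force)+

lemma issue_inv:
  assumes inv: "invariant W s G dp" and iss: "issue K P s t s'"
  shows "\<exists>G' dp'. invariant W s' G' dp'"
    and "card (verts (exec_dag s')) = Suc (card (verts (exec_dag s)))"
proof -
  have no: "\<not> at_instr P s t th Suspend" "\<not> at_instr P s t th (Resume r)" for th r
    using ready_facts(1)[OF inv] safe_instr unfolding at_instr_def by blast+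
  from iss show "\<exists>G' dp'. invariant W s' G' dp'"
  proof cases
    case (Local th i pc' rs' e)
    then show ?thesis using issue_Local[OF inv] by metis
  next
    case (NewNode th d a e)
    then show ?thesis using issue_NewNode[OF inv] by metis
  next
    case (Access th d f p c a cs e q)
    show ?thesis using issue_Access[OF inv Access(2-5) Access(7)[unfolded Access(6)]]
      unfolding Access(1) Access(6) .
  next
    case (Fork th d l t' e)
    then show ?thesis using issue_Fork[OF inv] by metis
  next
    case (Join th r t' th' e)
    then show ?thesis using issue_Join[OF inv] by metis
  next
    case (Terminate th e)
    then show ?thesis using issue_Terminate[OF inv] by metis
  qed (use no in auto)
  have fresh: "(t, th_count th) \<notin> verts (exec_dag s)" if "at_instr P s t th i" for th i
    using inv that unfolding invariant_def dag_ok_def at_instr_def by fastforce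
  have fin: "finite (verts (exec_dag s))" using inv unfolding invariant_def dag_ok_def by blast
  from iss show "card (verts (exec_dag s')) = Suc (card (verts (exec_dag s)))"
    by cases (use fresh fin in \<open>auto simp: add_event_def\<close>)
qed

section \<open>Whole time steps: service of requests, termination and progress\<close>

lemma issue_all_inv:
  assumes "issue_all K P s ts s'" and "invariant W s G dp"
  shows "(\<exists>G' dp'. invariant W s' G' dp') \<and> card (verts (exec_dag s')) = card (verts (exec_dag s)) + length ts"
  using assms
proof (induction arbitrary: G dp rule: issue_all.induct)
  case (1 s)
  then show ?case by auto
next
  case (2 s t s' ts s'')
  then show ?case using issue_inv[OF 2(4) 2(1)] by fastforce
qed

text \<open>The served request was alone in its queue and carries the current clock, so its queue
  becomes empty and its weight becomes 1.\<close>

lemma serve_inv: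
  assumes inv: "invariant W s G dp" and ne: "queue s ac \<noteq> []"
  shows "\<exists>G'. invariant W (serve ac s) G' dp"
    and "queue (serve ac s) = (queue s)(ac := [])"
    and "verts (exec_dag (serve ac s)) = verts (exec_dag s)"
proof -
  note I = inv[unfolded invariant_def]
  obtain t th where th: "threads s t = Some th" "th_status th = Waiting" "gp (G t) = Some ac"
    using I ne by blast
  have "thread_ok s G dp t th" using I th by blast
  then obtain a c r v where w: "ac = (a, c)" "queue s (a, c) = [r]" "rq_thread r = t"
        "rq_issued r = clock s" "rq_event r \<in> verts (exec_dag s)"
        "gh (G t) (Cell a c) = Some (Val v)" and EB: "gE (G t) \<le> B"
      and sf: "safe (gw (G t)) (gD (G t)) (gE (G t)) (gq (G t)) (th_pc th)
              ((th_regs th)(rq_dest r := rmw_result (rq_op r) v))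
              ((gh (G t))(Cell a c \<mapsto> Val (rmw_new (rq_op r) v)))"
      and dps: "\<And>e. e \<in> th_deps th \<Longrightarrow> e \<in> verts (exec_dag s) \<and> dp e \<le> gD (G t)"
    using th unfolding thread_ok_def by auto
  have R: "res_ok s G" using I by blast
  obtain cs where cs: "mem s a = Some cs" "c < length cs" "v = cs ! c"
    using res_okD(3)[OF R w(6)] by auto
  define th' where "th' = th\<lparr>th_status := Ready,
       th_regs := (th_regs th)(rq_dest r := rmw_result (rq_op r) v)\<rparr>"
  define s' where "s' = serve ac s"
  have s'eq: "s' = s\<lparr>mem := (mem s)(a \<mapsto> cs[c := rmw_new (rq_op r) v]),
      queue := (queue s)(ac := []), threads := (threads s)(t \<mapsto> th'),
      exec_dag := (exec_dag s)\<lparr>weight := (weight (exec_dag s))(rq_event r := 1)\<rparr>\<rparr>"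
    unfolding s'_def serve_def th'_def using w cs th by (simp add: Let_def)
  have s': "mem s' = (mem s)(a \<mapsto> cs[c := rmw_new (rq_op r) v])" "queue s' = (queue s)(ac := [])"
    "threads s' = (threads s)(t \<mapsto> th')" "clock s' = clock s"
    "verts (exec_dag s') = verts (exec_dag s)" "edges (exec_dag s') = edges (exec_dag s)"
    "weight (exec_dag s') = (weight (exec_dag s))(rq_event r := 1)"
    unfolding s'eq by auto
  show "queue (serve ac s) = (queue s)(ac := [])" "verts (exec_dag (serve ac s)) = verts (exec_dag s)"
    using s' unfolding s'_def by auto
  define G' where "G' = G(t := (G t)\<lparr>gh := (gh (G t))(Cell a c \<mapsto> Val (rmw_new (rq_op r) v))\<rparr>)"
  have Gx: "gw (G' x) = gw (G x)" "gD (G' x) = gD (G x)" "gE (G' x) = gE (G x)"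
    "gq (G' x) = gq (G x)" "gp (G' x) = gp (G x)" for x
    unfolding G'_def by auto
  have Gt: "gh (G' t) = (gh (G t))(Cell a c \<mapsto> Val (rmw_new (rq_op r) v))"
    unfolding G'_def by simp
  have Go: "x \<noteq> t \<Longrightarrow> gh (G' x) = gh (G x)" for x unfolding G'_def by simp
  have Gd: "dom (gh (G' x)) = dom (gh (G x))" for x
    using w(6) unfolding G'_def by auto
  have GT: "gh (G' x) (Thr y) = gh (G x) (Thr y)" for x y unfolding G'_def by simp
  have no: "gh (G x) (Cell a c) = None" if "x \<noteq> t" for x
    by (rule res_okD(2)[OF R _ w(6)]) (use that in simp)
  have "res_ok s' G'"
  proof (rule res_okI)
    fix x assume "threads s' x = None"
    then show "gh (G' x) = Map.empty" using s' Go res_okD(1)[OF R] by (auto split: if_splits)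
  next
    fix x y k u v assume "x \<noteq> y" "gh (G' x) k = Some u" "gh (G' y) k = Some v"
    then show False using Gd[of x] Gd[of y] res_okD(2)[OF R] by (metis domD domI option.distinct(1))
  next
    fix x b d y assume h: "gh (G' x) (Cell b d) = Some y"
    show "\<exists>cs. mem s' b = Some cs \<and> d < length cs \<and> y = Val (cs ! d)"
    proof (cases "Cell b d = Cell a c")
      case True
      then have "x = t" using h no Go by (metis option.distinct(1))
      then show ?thesis using True h Gt s' cs by auto
    next
      case False
      then have "gh (G x) (Cell b d) = Some y" using h unfolding G'_def by (auto split: if_splits)
      then obtain cs' where "mem s b = Some cs'" "d < length cs'" "y = Val (cs' ! d)"
        using res_okD(3)[OF R] by blast
      then show ?thesis using s' cs False by (cases "b = a") auto
    qed
  next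
    fix x v y assume "gh (G' x) (Thr v) = Some y"
    then show "threads s' v \<noteq> None \<and> v \<noteq> 0 \<and> y = Promise (gE (G' v)) (gq (G' v))"
      using res_okD(4)[OF R] s' by (simp add: GT Gx)
  qed
  moreover have "dag_ok s' dp"
  proof -
    have cnt: "th_count th' = th_count th" unfolding th'_def by simp
    have "dag_ok s dp" using I by blast
    then show ?thesis unfolding dag_ok_def s' using th cnt by fastforce
  qed
  moreover have "mem_ok (mem s')" using I cs s' unfolding mem_ok_def by auto
  moreover have "dom (threads s') = dom (threads s)" using s' th by auto
  moreover have "thread_ok s' G' dp x thx" if x: "threads s' x = Some thx" for x thx
  proof (cases "x = t")
    case True
    then have "thx = th'" using x s' by simp
    then show ?thesis unfolding True
      by (intro thread_ok_ready) (use EB sf dps in \<open>simp_all only: Gx Gt s', simp_all add: th'_def\<close>)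
  next
    case False
    then have sx: "threads s x = Some thx" using x s' by simp
    then have ok: "thread_ok s G dp x thx" using I by blast
    show ?thesis
    proof (rule thread_ok_frame[OF ok])
      show "gh (G' x) = gh (G x) \<or> th_status thx = Terminated \<and> x \<noteq> 0 \<and> (\<forall>y. Thr x \<notin> dom (gh (G' y)))"
        using Go False by simp
      show "\<exists>z. Thr x \<in> dom (gh (G z))" if "Thr x \<in> dom (gh (G' y))" for y
        using that Gd by blast
      fix bd assume b: "th_status thx = Waiting" "gp (G x) = Some bd"
      then obtain d e u where "bd = (d, e)" "gh (G x) (Cell d e) = Some u"
        using ok unfolding thread_ok_def by auto
      then have "bd \<noteq> ac" using no[OF False] w(1) by auto
      then show "queue s' bd = queue s bd" using s' by simp
    qed (simp_all add: s' Gx)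
  qed
  moreover have "\<exists>x thx. threads s' x = Some thx \<and> th_status thx = Waiting \<and> gp (G' x) = Some bd"
    if bd: "queue s' bd \<noteq> []" for bd
  proof -
    have "bd \<noteq> ac" "queue s bd \<noteq> []" using bd s' by (auto split: if_splits)
    then obtain x thx where x: "threads s x = Some thx" "th_status thx = Waiting" "gp (G x) = Some bd"
      using I by blast
    then have "x \<noteq> t" using th \<open>bd \<noteq> ac\<close> by auto
    then show ?thesis using x s' Gx by (intro exI[of _ x] exI[of _ thx]) simp
  qed
  ultimately have "invariant W s' G' dp" using I th s' unfolding invariant_def by (auto simp: Gx)
  then show "\<exists>G'. invariant W (serve ac s) G' dp" unfolding s'_def by blast
qed

lemma serve_all_inv:
  assumes "invariant W s G dp" "distinct acs" "set acs \<subseteq> {ac. queue s ac \<noteq> []}"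
  shows "(\<exists>G'. invariant W (fold serve acs s) G' dp) \<and>
    queue (fold serve acs s) = (\<lambda>ac. if ac \<in> set acs then [] else queue s ac) \<and>
    verts (exec_dag (fold serve acs s)) = verts (exec_dag s)"
  using assms
proof (induction acs arbitrary: s G)
  case Nil
  then show ?case by auto
next
  case (Cons ac acs)
  then have ne: "queue s ac \<noteq> []" by auto
  note S = serve_inv[OF Cons.prems(1) ne]
  obtain G' where G': "invariant W (serve ac s) G' dp" using S(1) by blast
  have "set acs \<subseteq> {bd. queue (serve ac s) bd \<noteq> []}"
  proof
    fix bd assume "bd \<in> set acs"
    then have "bd \<noteq> ac" "queue s bd \<noteq> []" using Cons.prems(2,3) by auto
    then show "bd \<in> {bd. queue (serve ac s) bd \<noteq> []}" using S(2) by simp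
  qed
  from Cons.IH[OF G' _ this] Cons.prems(2) S show ?case by (auto simp: fun_eq_iff)
qed

text \<open>The state between time steps. Every queue holds at most one request, so serving each
  nonempty queue once leaves nothing pending.\<close>

definition quiet :: "config \<Rightarrow> bool" where
  "quiet s \<longleftrightarrow> (\<forall>ac. queue s ac = [])"

lemma quiet_status:
  assumes "invariant W s G dp" "quiet s" "threads s t = Some th"
  shows "th_status th = Ready \<or> th_status th = Terminated"
proof -
  have "thread_ok s G dp t th" using assms unfolding invariant_def by blast
  then show ?thesis using assms(2) unfolding thread_ok_def quiet_def
    by (cases "th_status th") auto
qed

text \<open>The clock enters the invariant only through pending requests.\<close>

lemma inv_clock:
  assumes "invariant W s G dp" "quiet s"
  shows "invariant W (s\<lparr>clock := k\<rparr>) G dp"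
proof -
  have "thread_ok (s\<lparr>clock := k\<rparr>) G dp t th" if "threads s t = Some th" for t th
  proof -
    have "thread_ok s G dp t th" using that assms unfolding invariant_def by blast
    then show ?thesis using quiet_status[OF assms that] unfolding thread_ok_def by auto
  qed
  then show ?thesis using assms(1) unfolding invariant_def res_ok_def dag_ok_def by simp
qed

lemma time_step_inv:
  assumes inv: "invariant W s G dp" "quiet s" and st: "time_step K P s s'"
  shows "\<exists>G' dp'. invariant W s' G' dp'" "quiet s'"
    "card (verts (exec_dag s)) < card (verts (exec_dag s'))"
proof -
  obtain ts acs s1 where *: "issue_all K P s ts s1" "distinct acs" "set acs = {ac. queue s1 ac \<noteq> []}"
    "ts \<noteq> [] \<or> acs \<noteq> []" "s' = (fold serve acs s1)\<lparr>clock := Suc (clock s1)\<rparr>"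
    using st unfolding time_step_def by blast
  obtain G1 dp1 where 1: "invariant W s1 G1 dp1"
    and c: "card (verts (exec_dag s1)) = card (verts (exec_dag s)) + length ts"
    using issue_all_inv[OF *(1) inv(1)] by blast
  \<comment> \<open>From a quiet state a step cannot consist of services alone. So every time step
    adds a vertex, and \<open>W\<close> bounds the number of steps.\<close>
  have "ts \<noteq> []"
  proof
    assume "ts = []"
    then have "s1 = s" using *(1) by (auto elim: issue_all.cases)
    then show False using \<open>ts = []\<close> *(3,4) inv(2) unfolding quiet_def by auto
  qed
  have sub: "set acs \<subseteq> {ac. queue s1 ac \<noteq> []}" using *(3) by blast
  note S = serve_all_inv[OF 1 *(2) sub]
  have q: "quiet (fold serve acs s1)" using S *(3) unfolding quiet_def by auto
  show "\<exists>G' dp'. invariant W s' G' dp'" using S inv_clock[OF _ q] *(5) by blast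
  show "quiet s'" using q *(5) unfolding quiet_def by simp
  show "card (verts (exec_dag s)) < card (verts (exec_dag s'))"
    using S c \<open>ts \<noteq> []\<close> *(5) by (cases ts) auto
qed

lemma reachable_inv:
  assumes "reachable K P s s'" "invariant W s G dp" "quiet s"
  shows "(\<exists>G' dp'. invariant W s' G' dp') \<and> quiet s'"
  using assms(1) unfolding reachable_def
proof (induction rule: rtranclp_induct)
  case base
  then show ?case using assms by blast
next
  case (step y z)
  then show ?case using time_step_inv by blast
qed

lemma inv_card: "invariant W s G dp \<Longrightarrow> card (verts (exec_dag s)) \<le> W"
  unfolding invariant_def by auto

text \<open>A blocked thread waits for one with a smaller deadline, so the ready thread with the smallest
  deadline can proceed.\<close>

lemma progress:
  assumes inv: "invariant W s G dp" "quiet s" and fin: "finished K P s"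
    and t: "threads s t = Some th"
  shows "th_status th = Terminated"
proof (rule ccontr)
  assume nt: "th_status th \<noteq> Terminated"
  note I = inv(1)[unfolded invariant_def]
  define R where "R = {t. \<exists>th. threads s t = Some th \<and> th_status th \<noteq> Terminated}"
  have "t \<in> R" using t nt unfolding R_def by blast
  then obtain u where u: "u \<in> R" and min: "\<And>x. x \<in> R \<Longrightarrow> gE (G u) \<le> gE (G x)"
    using ex_has_least_nat[of "\<lambda>x. x \<in> R" t "\<lambda>x. gE (G x)"] by blast
  obtain thu where thu: "threads s u = Some thu" "th_status thu = Ready"
    using u quiet_status[OF inv] unfolding R_def by blast
  note F = ready_facts[OF inv(1) thu]
  have "\<exists>s1. issue K P s u s1"
    using F(1)
  proof (cases rule: safe.cases)
    case (s_local pc' rs' w)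
    then have "at_instr P s u thu (P ! th_pc thu)" using thu unfolding at_instr_def by simp
    from issue.Local[OF this s_local(3) refl] show ?thesis by blast
  next
    case (s_access d f p c a v w)
    then obtain cs where "mem s a = Some cs" "c < length cs"
      using res_okD(3)[OF F(5)] by blast
    moreover have "at_instr P s u thu (Access d f p c)"
      using thu s_access unfolding at_instr_def by simp
    ultimately show ?thesis using s_access(4) by (intro exI, rule_tac issue.Access[OF _ _ _ _ refl refl])
  next
    case (s_new d w)
    have "finite (dom (mem s))" using F(6) unfolding mem_ok_def by blast
    then obtain a where a: "a \<notin> dom (mem s)" using ex_new_if_finite[OF infinite_UNIV_nat] by blast
    have "at_instr P s u thu (NewNode d)" using thu s_new unfolding at_instr_def by simp
    from issue.NewNode[OF this a refl] show ?thesis by blast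
  next
    case (s_fork d l h1 h2 E' w1 q' w2)
    obtain t' where t': "t' \<notin> dom (threads s)" using ex_new_if_finite[OF infinite_UNIV_nat, of "dom (threads s)"] I by blast
    have "at_instr P s u thu (Fork d l)" using thu s_fork unfolding at_instr_def by simp
    from issue.Fork[OF this t' refl] show ?thesis by blast
  next
    case (s_join r t' E' q' w)
    then have "threads s t' \<noteq> None" "E' = gE (G t')" using res_okD(4)[OF F(5) s_join(5)] by auto
    then obtain th' where th': "threads s t' = Some th'" by blast
    have trm: "th_status th' = Terminated"
    proof (rule ccontr)
      assume "th_status th' \<noteq> Terminated"
      then have "t' \<in> R" using th' unfolding R_def by blast
      then show False using min[of t'] s_join(6) \<open>E' = gE (G t')\<close> by linarith
    qed
    have "at_instr P s u thu (Join r)" using thu s_join unfolding at_instr_def by simp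
    from issue.Join[OF this s_join(4) th' trm refl] show ?thesis by blast
  next
    case (s_term w)
    then have "at_instr P s u thu Terminate" using thu unfolding at_instr_def by simp
    from issue.Terminate[OF this refl] show ?thesis by blast
  qed
  then obtain s1 where s1: "issue K P s u s1" by blast
  obtain G1 dp1 where i1: "invariant W s1 G1 dp1" using issue_inv[OF inv(1) s1] by blast
  \<comment> \<open>\<open>time_step\<close> wants the nonempty queues as a list. Each of them is
    recorded as \<open>gp\<close> of some waiting thread, so they are finitely many.\<close>
  have "{ac. queue s1 ac \<noteq> []} \<subseteq> (\<lambda>t. the (gp (G1 t))) ` dom (threads s1)"
    using i1 unfolding invariant_def by force
  moreover have "finite (dom (threads s1))" using i1 unfolding invariant_def by blast
  ultimately have "finite {ac. queue s1 ac \<noteq> []}" using finite_surj by blast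
  then obtain acs where "set acs = {ac. queue s1 ac \<noteq> []}" "distinct acs"
    using finite_distinct_list by blast
  then have "time_step K P s ((fold serve acs s1)\<lparr>clock := Suc (clock s1)\<rparr>)"
    unfolding time_step_def using s1
    by (intro exI[of _ "[u]"] exI[of _ acs] exI[of _ s1]) (auto intro: issue_all.intros)
  then show False using fin unfolding finished_def by blast
qed

section \<open>From the depth potential and the credits to span and work\<close>

lemma path_depth:
  assumes ok: "dag_ok s dp" and p: "dag_path (exec_dag s) p"
  shows "(\<Sum>v\<leftarrow>p. weight (exec_dag s) v) \<le> dp (last p)"
proof -
  have "p \<noteq> []" "set p \<subseteq> verts (exec_dag s)" "successively (\<lambda>u v. (u, v) \<in> edges (exec_dag s)) p"
    using p unfolding dag_path_def by auto
  then show ?thesis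
  proof (induction p rule: rev_nonempty_induct)
    case (single x)
    then show ?case using ok unfolding dag_ok_def by fastforce
  next
    case (snoc x xs)
    then have "(last xs, x) \<in> edges (exec_dag s)" by (simp add: successively_append_iff)
    then have "dp (last xs) < dp x" using ok unfolding dag_ok_def by blast
    moreover have "weight (exec_dag s) x \<le> 1" using snoc.prems ok unfolding dag_ok_def by simp
    moreover have "(\<Sum>v\<leftarrow>xs. weight (exec_dag s) v) \<le> dp (last xs)"
      using snoc by (simp add: successively_append_iff)
    ultimately show ?case by simp
  qed
qed

lemma inv_work_span:
  assumes inv: "invariant W s G dp" and ne: "verts (exec_dag s) \<noteq> {}"
  shows "work (exec_dag s) \<le> W" "span (exec_dag s) \<le> B"
proof -
  have ok: "dag_ok s dp" using inv unfolding invariant_def by blast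
  have "work (exec_dag s) \<le> (\<Sum>v\<in>verts (exec_dag s). 1)"
    unfolding work_def using ok unfolding dag_ok_def by (intro sum_mono) blast
  then show "work (exec_dag s) \<le> W" using inv_card[OF inv] by simp
  let ?S = "{(\<Sum>v\<leftarrow>p. weight (exec_dag s) v) | p. dag_path (exec_dag s) p}"
  have le: "x \<le> B" if x: "x \<in> ?S" for x
  proof -
    obtain p where p: "dag_path (exec_dag s) p" "x = (\<Sum>v\<leftarrow>p. weight (exec_dag s) v)" using x by blast
    then have "last p \<in> verts (exec_dag s)" unfolding dag_path_def by auto
    then have "dp (last p) \<le> B" using ok unfolding dag_ok_def by blast
    then show ?thesis using path_depth[OF ok p(1)] p(2) by simp
  qed
  obtain v where "v \<in> verts (exec_dag s)" using ne by blast
  then have "dag_path (exec_dag s) [v]" unfolding dag_path_def by simp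
  then have "?S \<noteq> {}" by blast
  moreover have "finite ?S" using le by (meson finite_nat_set_iff_bounded_le)
  ultimately show "span (exec_dag s) \<le> B" unfolding span_def using le by (simp add: Max_le_iff)
qed

text \<open>\<open>Q\<close> has to follow from the owned cells alone, since it must survive
  whatever other threads do after the return. The terminated main thread retains its resources, so
  it holds from then on.\<close>

theorem adequacy:
  assumes sf: "safe W 0 E main 0 ((\<lambda>_. NullV)(0 := v)) h" and EB: "E \<le> B"
    and m: "wf_memory K m"
    and h: "\<And>k x. h k = Some x \<Longrightarrow> \<exists>a c cs. k = Cell a c \<and> m a = Some cs \<and> c < length cs \<and> x = Val (cs ! c)"
    and post: "\<And>m' rs h'. post main rs h' \<Longrightarrow> (\<And>a cs. m' a = Some cs \<Longrightarrow> length cs = K) \<Longrightarrow>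
      (\<And>a c x. h' (Cell a c) = Some x \<Longrightarrow> \<exists>cs. m' a = Some cs \<and> c < length cs \<and> x = Val (cs ! c)) \<Longrightarrow>
      Q m' (rs 0)"
  shows "computes_within K P (initial m v) Q (real W) (real B)"
proof -
  define G :: "tid \<Rightarrow> 'q ghost" where
    "G = (\<lambda>t. if t = 0 then \<lparr>gw = W, gD = 0, gE = E, gq = main, gh = h, gp = None\<rparr>
       else \<lparr>gw = 0, gD = 0, gE = E, gq = main, gh = Map.empty, gp = None\<rparr>)"
  let ?s = "initial m v"
  have "res_ok ?s G"
    by (rule res_okI) (use h in \<open>fastforce simp: G_def initial_def split: if_splits\<close>)+
  moreover have "thread_ok ?s G (\<lambda>_. 0) t th" if "threads ?s t = Some th" for t th
    using that sf EB by (intro thread_ok_ready) (auto simp: initial_def G_def split: if_splits)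
  moreover have "dag_ok ?s (\<lambda>_. 0)" unfolding dag_ok_def initial_def by auto
  moreover have "mem_ok (mem ?s)" using m unfolding mem_ok_def wf_memory_def initial_def
    by (auto intro: ranI)
  moreover have "dom (threads ?s) = {0}" unfolding initial_def by auto
  ultimately have inv: "invariant W ?s G (\<lambda>_. 0)" unfolding invariant_def
    by (auto simp: G_def initial_def)
  have q0: "quiet ?s" unfolding quiet_def initial_def by simp
  have no_inf: False if "\<sigma> 0 = ?s" "\<forall>i::nat. time_step K P (\<sigma> i) (\<sigma> (Suc i))" for \<sigma>
  proof -
    have "(\<exists>G' dp'. invariant W (\<sigma> i) G' dp') \<and> quiet (\<sigma> i) \<and> i \<le> card (verts (exec_dag (\<sigma> i)))" for i
    proof (induction i)
      case 0
      then show ?case using that inv q0 by auto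
    next
      case (Suc i)
      then obtain G' dp' where "invariant W (\<sigma> i) G' dp'" "quiet (\<sigma> i)" by blast
      then show ?case using time_step_inv that(2) Suc by (meson Suc_leI order_le_less_trans)
    qed
    \<comment> \<open>After \<open>Suc W\<close> steps there would be more than \<open>W\<close>
      events.\<close>
    from this[of "Suc W"] show False using inv_card by fastforce
  qed
  have Q: "Q (mem s) x" if re: "reachable K P ?s s" and ret: "returned s x" for s x
  proof -
    obtain G' dp' where i: "invariant W s G' dp'" using reachable_inv[OF re inv q0] by blast
    obtain th where th: "threads s 0 = Some th" "th_status th = Terminated" "th_regs th 0 = x"
      using ret unfolding returned_def by blast
    have "thread_ok s G' dp' 0 th" using i th unfolding invariant_def by blast
    then have "post main (th_regs th) (gh (G' 0))"
      using th i unfolding thread_ok_def invariant_def by simp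
    moreover have "res_ok s G'" "mem_ok (mem s)" using i unfolding invariant_def by blast+
    ultimately have "Q (mem s) (th_regs th 0)"
      using res_okD(3) unfolding mem_ok_def by (intro post) blast+
    then show ?thesis using th by simp
  qed
  have fin: "(\<exists>v. returned s v) \<and> real (work (exec_dag s)) \<le> real W \<and> real (span (exec_dag s)) \<le> real B"
    if re: "reachable K P ?s s" and fi: "finished K P s" for s
  proof -
    obtain G' dp' where i: "invariant W s G' dp'" and q: "quiet s" using reachable_inv[OF re inv q0] by blast
    obtain th where th: "threads s 0 = Some th" using i unfolding invariant_def by blast
    have t: "th_status th = Terminated" using progress[OF i q fi th] .
    then have ret: "\<exists>v. returned s v" using th unfolding returned_def by blast
    \<comment> \<open>The main thread is initially not terminated, so at least one step was made and
      the DAG has a path to maximize over.\<close>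
    have "s \<noteq> ?s" using t th unfolding initial_def by auto
    then obtain s1 where "reachable K P ?s s1" "time_step K P s1 s"
      using re unfolding reachable_def by (metis rtranclp.cases)
    then have "0 < card (verts (exec_dag s))"
      using time_step_inv(3) reachable_inv[OF _ inv q0] by (metis less_nat_zero_code neq0_conv)
    then have "verts (exec_dag s) \<noteq> {}" by auto
    then show ?thesis using inv_work_span[OF i] ret by simp
  qed
  show ?thesis unfolding computes_within_def using no_inf Q fin by blast
qed

end

section \<open>Assertions\<close>

definition star :: "'q assn \<Rightarrow> 'q assn \<Rightarrow> 'q assn" (infixr "**" 55) where
  "(A ** C) h \<longleftrightarrow> (\<exists>h1 h2. h = h1 ++ h2 \<and> dom h1 \<inter> dom h2 = {} \<and> A h1 \<and> C h2)"

definition cell :: "addr \<Rightarrow> nat \<Rightarrow> val \<Rightarrow> 'q assn" where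
  "cell a c v = (\<lambda>h. h = [Cell a c \<mapsto> Val v])"

definition cell_any :: "addr \<Rightarrow> nat \<Rightarrow> 'q assn" where
  "cell_any a c = (\<lambda>h. \<exists>v. cell a c v h)"

definition hdl :: "tid \<Rightarrow> nat \<Rightarrow> 'q \<Rightarrow> 'q assn" where
  "hdl t E q = (\<lambda>h. h = [Thr t \<mapsto> Promise E q])"

definition ent :: "'q assn \<Rightarrow> 'q assn \<Rightarrow> bool" (infix "\<turnstile>" 50) where
  "A \<turnstile> C \<longleftrightarrow> (\<forall>h. A h \<longrightarrow> C h)"

lemma star_comm: "A ** C = C ** A"
  unfolding fun_eq_iff star_def by (metis inf_commute map_add_comm)

lemma star_assoc: "(A ** C) ** F = A ** C ** F"
proof (intro ext iffI)
  fix h assume "((A ** C) ** F) h"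
  then obtain h1 h2 h3 where "h = (h1 ++ h2) ++ h3" "dom h1 \<inter> dom h2 = {}"
    "dom (h1 ++ h2) \<inter> dom h3 = {}" "A h1" "C h2" "F h3"
    unfolding star_def by blast
  then show "(A ** C ** F) h" unfolding star_def
    by (intro exI[of _ h1] exI[of _ "h2 ++ h3"] conjI exI[of _ h2] exI[of _ h3]) (auto simp: map_add_assoc)
next
  fix h assume "(A ** C ** F) h"
  then obtain h1 h2 h3 where "h = h1 ++ (h2 ++ h3)" "dom h2 \<inter> dom h3 = {}"
    "dom h1 \<inter> dom (h2 ++ h3) = {}" "A h1" "C h2" "F h3"
    unfolding star_def by blast
  then show "((A ** C) ** F) h" unfolding star_def
    by (intro exI[of _ "h1 ++ h2"] exI[of _ h3] conjI exI[of _ h1] exI[of _ h2]) (auto simp: map_add_assoc)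
qed

lemma star_left_comm: "A ** C ** F = C ** A ** F"
  by (metis star_assoc star_comm)

lemmas star_ac = star_assoc star_comm star_left_comm

lemma ent_refl [simp]: "A \<turnstile> A"
  unfolding ent_def by blast

lemma ent_trans: "A \<turnstile> C \<Longrightarrow> C \<turnstile> F \<Longrightarrow> A \<turnstile> F"
  unfolding ent_def by blast

lemma ent_star: "A \<turnstile> A' \<Longrightarrow> C \<turnstile> C' \<Longrightarrow> A ** C \<turnstile> A' ** C'"
  unfolding ent_def star_def by blast

lemma cell_ent_any: "cell a c v \<turnstile> cell_any a c"
  unfolding ent_def cell_any_def by blast

text \<open>\<open>has\<close>, \<open>upd\<close> and \<open>rem\<close> are the forms in which
  symbolic execution reads a cell, overwrites a cell and consumes a handle. Their
  \<open>here\<close> and \<open>skip\<close> rules search a right-nested chain of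
  conjuncts.\<close>

definition has :: "'q assn \<Rightarrow> key \<Rightarrow> 'q rsrc \<Rightarrow> bool" where
  "has A k x \<longleftrightarrow> (\<forall>h. A h \<longrightarrow> h k = Some x)"

lemma has_here: "has (cell a c v ** A) (Cell a c) (Val v)"
  unfolding has_def star_def cell_def by (auto simp: map_add_def split: option.splits)

lemma has_last: "has (cell a c v) (Cell a c) (Val v)"
  unfolding has_def cell_def by auto

lemma has_skip: "has A k x \<Longrightarrow> has (C ** A) k x"
  unfolding has_def star_def by auto

definition upd :: "'q assn \<Rightarrow> key \<Rightarrow> val \<Rightarrow> 'q assn \<Rightarrow> bool" where
  "upd A k v A' \<longleftrightarrow> (\<forall>h. A h \<longrightarrow> (\<exists>u. h k = Some (Val u)) \<and> A' (h(k \<mapsto> Val v)))"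

lemma upd_last: "upd (cell a c v) (Cell a c) u (cell a c u)"
  unfolding upd_def cell_def by auto

lemma upd_last_any: "upd (cell_any a c) (Cell a c) u (cell a c u)"
  unfolding upd_def cell_any_def cell_def by auto

lemma upd_skip:
  assumes "upd A k v A'"
  shows "upd (C ** A) k v (C ** A')"
  unfolding upd_def
proof (intro allI impI)
  fix h assume "(C ** A) h"
  then obtain h1 h2 where h: "h = h1 ++ h2" "dom h1 \<inter> dom h2 = {}" "C h1" "A h2"
    unfolding star_def by blast
  then have u: "\<exists>u. h2 k = Some (Val u)" "A' (h2(k \<mapsto> Val v))" using assms unfolding upd_def by auto
  have "h(k \<mapsto> Val v) = h1 ++ (h2(k \<mapsto> Val v))" using h by simp
  moreover have "dom h1 \<inter> dom (h2(k \<mapsto> Val v)) = {}" using h u by auto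
  ultimately show "(\<exists>u. h k = Some (Val u)) \<and> (C ** A') (h(k \<mapsto> Val v))"
    using u h unfolding star_def by (metis map_add_find_right)
qed

lemma upd_here: "upd (cell a c v ** A) (Cell a c) u (cell a c u ** A)"
  "upd (cell_any a c ** A) (Cell a c) u (cell a c u ** A)"
  using upd_skip[OF upd_last] upd_skip[OF upd_last_any] by (metis star_comm)+

definition rem :: "'q assn \<Rightarrow> key \<Rightarrow> 'q rsrc \<Rightarrow> 'q assn \<Rightarrow> bool" where
  "rem A k x R \<longleftrightarrow> (\<forall>h. A h \<longrightarrow> h k = Some x \<and> R (h(k := None)))"

lemma rem_here: "rem (hdl t E q ** A) (Thr t) (Promise E q) A"
  unfolding rem_def
proof (intro allI impI)
  fix h assume "(hdl t E q ** A) h"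
  then obtain h2 where h: "h = [Thr t \<mapsto> Promise E q] ++ h2" "Thr t \<notin> dom h2" "A h2"
    unfolding star_def hdl_def by auto
  then have "h(Thr t := None) = h2" by (auto simp: map_add_def fun_eq_iff split: option.splits)
  then show "h (Thr t) = Some (Promise E q) \<and> A (h(Thr t := None))"
    using h by (auto simp: map_add_def split: option.splits)
qed

lemma rem_skip:
  assumes "rem A k x R"
  shows "rem (C ** A) k x (C ** R)"
  unfolding rem_def
proof (intro allI impI)
  fix h assume "(C ** A) h"
  then obtain h1 h2 where h: "h = h1 ++ h2" "dom h1 \<inter> dom h2 = {}" "C h1" "A h2"
    unfolding star_def by blast
  then have u: "h2 k = Some x" "R (h2(k := None))" using assms unfolding rem_def by auto
  then have "h1 k = None" using h by auto
  then have "h(k := None) = h1 ++ (h2(k := None))" using h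
    by (auto simp: map_add_def fun_eq_iff split: option.splits)
  moreover have "dom h1 \<inter> dom (h2(k := None)) = {}" using h by auto
  ultimately show "h k = Some x \<and> (C ** R) (h(k := None))"
    using u h unfolding star_def by (metis map_add_find_right)
qed

section \<open>Symbolic execution on assertions\<close>

context logic
begin

definition asafe :: "nat \<Rightarrow> nat \<Rightarrow> nat \<Rightarrow> 'q \<Rightarrow> nat \<Rightarrow> (reg \<Rightarrow> val) \<Rightarrow> 'q assn \<Rightarrow> bool" where
  "asafe w D E q pc rs A \<longleftrightarrow> (\<forall>h. A h \<longrightarrow> safe w D E q pc rs h)"

lemma asafe_ent: "A \<turnstile> A' \<Longrightarrow> asafe w D E q pc rs A' \<Longrightarrow> asafe w D E q pc rs A"
  unfolding asafe_def ent_def by blast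

lemma asafe_mono: "asafe w D E q pc rs A \<Longrightarrow> w \<le> w' \<Longrightarrow> D' \<le> D \<Longrightarrow> asafe w' D' E q pc rs A"
  unfolding asafe_def using safe_mono by blast

text \<open>Forks need witnesses and have the rule \<open>asafe_fork\<close> instead.\<close>

fun pre :: "nat \<Rightarrow> nat \<Rightarrow> nat \<Rightarrow> 'q \<Rightarrow> instr \<Rightarrow> nat \<Rightarrow> (reg \<Rightarrow> val) \<Rightarrow> 'q assn \<Rightarrow> bool" where
  "pre w D E q (Access d Read p c) pc rs A \<longleftrightarrow>
     (\<exists>a v. rs p = NodeV a \<and> has A (Cell a c) (Val v) \<and> asafe w (Suc D) E q (Suc pc) (rs(d := v)) A)"
| "pre w D E q (Access d (Write r) p c) pc rs A \<longleftrightarrow>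
     (\<exists>a A'. rs p = NodeV a \<and> upd A (Cell a c) (rs r) A' \<and>
       asafe w (Suc D) E q (Suc pc) (rs(d := rs r)) A')"
| "pre w D E q (NewNode d) pc rs A \<longleftrightarrow> D < E \<and>
     (\<forall>a. asafe w (Suc D) E q (Suc pc) (rs(d := NodeV a)) (A ** (\<lambda>h. h = fresh_cells K a)))"
| "pre w D E q (Join r) pc rs A \<longleftrightarrow>
     (\<exists>t E' q' R. rs r = ThreadV t \<and> rem A (Thr t) (Promise E' q') R \<and> E' < E \<and> D < E \<and>
       asafe w (Suc (max D E')) E q (Suc pc) rs ((\<lambda>h. \<exists>rs'. post q' rs' h) ** R))"
| "pre w D E q Terminate pc rs A \<longleftrightarrow> D < E \<and> A \<turnstile> post q rs"
| "pre w D E q (Self d) pc rs A \<longleftrightarrow> False"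
| "pre w D E q i pc rs A \<longleftrightarrow>
     (case local_step 0 i pc rs of Some (pc', rs') \<Rightarrow> asafe w (Suc D) E q pc' rs' A | None \<Rightarrow> False)"

lemma local_step_tid: "(\<forall>d. i \<noteq> Self d) \<Longrightarrow> local_step t i pc rs = local_step 0 i pc rs"
  by (cases i) auto

text \<open>One application per instruction: the premises fetch the instruction, and the simplifier
  evaluates \<open>pre\<close>, which leaves the next program counter and a search for the conjunct
  concerned.\<close>

lemma step:
  assumes "pc < length P" "P ! pc = i" "0 < w" "pre (w - 1) D E q i pc rs A"
  shows "asafe w D E q pc rs A"
  using assms(3,1) assms(4)[folded assms(2)]
proof -
  assume assms: "0 < w" "pc < length P" "pre (w - 1) D E q (P ! pc) pc rs A"
  obtain w' where w: "w = Suc w'" using assms(1) by (cases w) auto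
  have local: "asafe w D E q pc rs A"
    if ns: "\<forall>d. P ! pc \<noteq> Self d" and ls: "(case local_step 0 (P ! pc) pc rs of Some (pc', rs') \<Rightarrow> asafe w' (Suc D) E q pc' rs' A | None \<Rightarrow> False)"
  proof -
    obtain pc' rs' where l: "local_step 0 (P ! pc) pc rs = Some (pc', rs')" "asafe w' (Suc D) E q pc' rs' A"
      using ls by (auto split: option.splits)
    have l': "local_step t (P ! pc) pc rs = Some (pc', rs')" for t
      using local_step_tid[OF ns] l(1) by (rule trans)
    show ?thesis unfolding asafe_def w
      using s_local[of pc rs pc' rs', OF assms(2) l'] l(2) unfolding asafe_def by blast
  qed
  note pre = assms(3)[unfolded w, simplified]
  show ?thesis
  proof (cases "P ! pc")
    case (Access d f p c)
    show ?thesis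
    proof (cases f)
      case Read
      obtain a v where r: "rs p = NodeV a" "has A (Cell a c) (Val v)" "asafe w' (Suc D) E q (Suc pc) (rs(d := v)) A"
        using pre Access Read by auto
      show ?thesis unfolding asafe_def w
      proof (intro allI impI)
        fix h assume h: "A h"
        then have hk: "h (Cell a c) = Some (Val v)" using r unfolding has_def by blast
        then have "h(Cell a c \<mapsto> Val v) = h" by auto
        then show "safe (Suc w') D E q pc rs h"
          using s_access[of pc d f p c rs a h v, OF assms(2) Access r(1) hk] r(3) h Read unfolding asafe_def by simp
      qed
    next
      case (Write r)
      obtain a A' where r: "rs p = NodeV a" "upd A (Cell a c) (rs r) A'"
        "asafe w' (Suc D) E q (Suc pc) (rs(d := rs r)) A'"
        using pre Access Write by auto
      show ?thesis unfolding asafe_def w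
      proof (intro allI impI)
        fix h assume h: "A h"
        then obtain u where "h (Cell a c) = Some (Val u)" "A' (h(Cell a c \<mapsto> Val (rs r)))"
          using r(2) unfolding upd_def by blast
        then show "safe (Suc w') D E q pc rs h"
          using s_access[of pc d f p c rs a h u, OF assms(2) Access r(1)] r(3) Write unfolding asafe_def by simp
      qed
    qed (use pre Access in auto)
  next
    case (NewNode d)
    show ?thesis unfolding asafe_def w
    proof (intro allI impI)
      fix h assume h: "A h"
      show "safe (Suc w') D E q pc rs h"
      proof (rule s_new[OF assms(2) NewNode])
        show "D < E" using pre NewNode by simp
        fix a assume f: "\<And>c. Cell a c \<notin> dom h"
        have "h (Cell a c) = None" for c using f[of c] by (simp add: domIff)
        then have "dom h \<inter> dom (fresh_cells K a) = {}"
          unfolding fresh_cells_def by (auto split: key.splits if_splits)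
        then have "(A ** (\<lambda>h. h = fresh_cells K a)) (h ++ fresh_cells K a)"
          using h unfolding star_def by blast
        moreover have "asafe w' (Suc D) E q (Suc pc) (rs(d := NodeV a)) (A ** (\<lambda>h. h = fresh_cells K a))"
          using pre NewNode by simp
        ultimately show "safe w' (Suc D) E q (Suc pc) (rs(d := NodeV a)) (h ++ fresh_cells K a)"
          unfolding asafe_def by blast
      qed
    qed
  next
    case (Join r)
    obtain t E' q' R where j: "rs r = ThreadV t" "rem A (Thr t) (Promise E' q') R" "E' < E" "D < E"
       "asafe w' (Suc (max D E')) E q (Suc pc) rs ((\<lambda>h. \<exists>rs'. post q' rs' h) ** R)"
      using pre Join by auto
    show ?thesis unfolding asafe_def w
    proof (intro allI impI)
      fix h assume "A h"
      then have h: "h (Thr t) = Some (Promise E' q')" "R (h(Thr t := None))"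
        using j(2) unfolding rem_def by auto
      show "safe (Suc w') D E q pc rs h"
      proof (rule s_join[of pc r rs t h E' q', OF assms(2) Join j(1) h(1) j(3,4)])
        fix rs' h' assume p: "post q' rs' h'" "dom h' \<inter> dom h = {}"
        then have "dom h' \<inter> dom (h(Thr t := None)) = {}" by auto
        then have "((\<lambda>h. \<exists>rs'. post q' rs' h) ** R) (h(Thr t := None) ++ h')"
          using p h(2) unfolding star_def by (metis map_add_comm)
        then show "safe w' (Suc (max D E')) E q (Suc pc) rs (h(Thr t := None) ++ h')"
          using j(5) unfolding asafe_def by blast
      qed
    qed
  next
    case Terminate
    then have "D < E" "A \<turnstile> post q rs" using pre by simp_all
    then show ?thesis using s_term[OF assms(2) Terminate] unfolding asafe_def ent_def w by blast
  qed (use pre local in \<open>auto simp: local_step_tid\<close>)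
qed

lemma asafe_fork:
  assumes "pc < length P" "P ! pc = Fork d l" "A \<turnstile> A1 ** A2" "E' \<le> B" "w1 + w2 < w"
    "asafe w1 (Suc D) E' q' l rs A1"
    "\<And>t. asafe w2 (Suc D) E q (Suc pc) (rs(d := ThreadV t)) (hdl t E' q' ** A2)"
  shows "asafe w D E q pc rs A"
proof -
  have "asafe (Suc (w1 + w2)) D E q pc rs A"
    unfolding asafe_def
  proof (intro allI impI)
    fix h assume "A h"
    then obtain h1 h2 where h: "h = h1 ++ h2" "dom h1 \<inter> dom h2 = {}" "A1 h1" "A2 h2"
      using assms(3) unfolding ent_def star_def by blast
    show "safe (Suc (w1 + w2)) D E q pc rs h"
    proof (rule s_fork[OF assms(1,2) h(1,2) assms(4)])
      show "safe w1 (Suc D) E' q' l rs h1" using assms(6) h unfolding asafe_def by blast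
      fix t assume t: "Thr t \<notin> dom h2"
      then have "h2(Thr t \<mapsto> Promise E' q') = [Thr t \<mapsto> Promise E' q'] ++ h2"
        by (auto simp: map_add_def fun_eq_iff split: option.splits)
      then have "(hdl t E' q' ** A2) (h2(Thr t \<mapsto> Promise E' q'))"
        using h t unfolding star_def hdl_def
        by (intro exI[of _ "[Thr t \<mapsto> Promise E' q']"] exI[of _ h2]) auto
      then show "safe w2 (Suc D) E q (Suc pc) (rs(d := ThreadV t)) (h2(Thr t \<mapsto> Promise E' q'))"
        using assms(7) unfolding asafe_def by blast
    qed
  qed
  then show ?thesis by (rule asafe_mono) (use assms(5) in auto)
qed

end

section \<open>The program and its specification\<close>

text \<open>Registers: 0 argument and result, 1 current node, 2 position of its first item, 3 \<open>M\<close>,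
  4 and 5 node and child index of the cell that receives the result, 6 and 7 left and right operand,
  9 priority, 10 and 11 thread handles, 12 null, 13, 14, 15 the constants 0, 2, 1, the others scratch. In an internal node, cell 2 holds the priority until the last pass,
  and cells 3 and 4 hold the handles of the threads that deliver the children, or null. The leaves
  have 0, their height, in cell 2, which serves as their priority.

  Entry points: 0 main, 21 build (80 and 84 for a left and right child), 34 loop for the priority,
  44 join, 48 and 58 the left and right operand becomes the root (68 and 74 the forked rest of the
  join), 52 delivery of the root, 63 the middle node becomes the root, 89 last pass (118 and 120 for a
  left and right child).\<close>

definition prog :: program where
  "prog = [
    LoadInt 13 0, LoadInt 15 1, LoadInt 14 2, Access 8 Read 0 3, LoadInt 3 1,
    JumpIfLess 3 8 7, Jump 9, Arith Mul 3 3 14, Jump 5,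
    Arith Sub 3 3 8, NewNode 4, LoadInt 5 0, LoadInt 2 0, Move 1 0, Fork 10 21, Join 10,
    Access 0 Read 4 0, Move 1 0, Fork 10 89, Join 10, Terminate,
    Access 8 Read 1 2, JumpIfEq 8 13 52, Access 6 Read 1 0, Access 7 Read 1 1, Access 8 Read 6 3,
    Arith Add 8 8 2, Fork 10 80, Fork 11 84, JumpIfLess 8 3 32, Arith Add 8 8 3, Jump 33,
    Arith Add 8 8 8, LoadInt 9 1,
    Arith Mul 18 9 14, Arith Mod 16 8 18, JumpIfLess 13 16 39, Move 9 18, Jump 34,
    Access 18 (Write 9) 1 2, Join 10, Access 6 Read 1 0, Join 11, Access 7 Read 1 1,
    Access 16 Read 6 2, Access 17 Read 7 2, JumpIfLess 16 9 57, JumpIfLess 16 17 58,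
    Access 10 Read 6 4, Fork 11 68, Access 18 (Write 11) 6 4, Move 1 6,
    JumpIfEq 5 13 55, Access 18 (Write 1) 4 1, Terminate, Access 18 (Write 1) 4 0, Terminate,
    JumpIfLess 17 9 63,
    Access 10 Read 7 3, Fork 11 74, Access 18 (Write 11) 7 3, Move 1 7, Jump 52,
    Access 18 (Write 12) 1 3, Access 18 (Write 12) 1 4, Access 18 (Write 6) 1 0,
    Access 18 (Write 7) 1 1, Jump 52,
    Move 4 6, LoadInt 5 1, JumpIfEq 10 12 72, Join 10, Access 6 Read 4 1, Jump 44,
    Move 4 7, LoadInt 5 0, JumpIfEq 10 12 78, Join 10, Access 7 Read 4 0, Jump 44,
    Move 4 1, Move 1 6, LoadInt 5 0, Jump 21,
    Move 4 1, Move 1 7, LoadInt 5 1, Move 2 8, Jump 21,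
    Access 8 Read 1 2, JumpIfEq 8 13 117, Access 10 Read 1 3, JumpIfEq 10 12 94, Join 10,
    Access 6 Read 1 0, Access 10 Read 1 4, JumpIfEq 10 12 98, Join 10, Access 7 Read 1 1,
    Fork 10 118, Fork 11 120, Join 10, Join 11,
    Access 8 Read 6 2, Access 9 Read 7 2, JumpIfLess 9 8 107, Move 8 9, Arith Add 8 8 15,
    Access 18 (Write 8) 1 2, Access 8 Read 6 3, Access 9 Read 7 3, Arith Add 8 8 9,
    Access 18 (Write 8) 1 3, Access 8 Read 6 4, Access 18 (Write 8) 1 4, Access 8 Read 7 5,
    Access 18 (Write 8) 1 5, Terminate,
    Move 1 6, Jump 89, Move 1 7, Jump 89]"

text \<open>A tree with the addresses of its nodes and, at internal nodes, their priorities, which are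
  irrelevant in input batches.\<close>

datatype pt = PL addr val | PN addr nat pt pt

primrec addr_of :: "pt \<Rightarrow> addr" where
  "addr_of (PL a x) = a"
| "addr_of (PN a r l u) = a"

primrec prio :: "pt \<Rightarrow> nat" where
  "prio (PL a x) = 0"
| "prio (PN a r l u) = r"

primrec erase :: "pt \<Rightarrow> val btree" where
  "erase (PL a x) = Leaf x"
| "erase (PN a r l u) = Branch (erase l) (erase u)"

abbreviation "ht t \<equiv> height (erase t)"
abbreviation "sz t \<equiv> length (items (erase t))"

text \<open>The comparisons come in the order in which the program makes them. The result is
  heap-ordered although ties are broken towards \<open>A\<close>, because for the priorities in
  question no tie at the top occurs (\<open>jn_cart\<close>).\<close>

fun jn :: "pt \<Rightarrow> addr \<Rightarrow> nat \<Rightarrow> pt \<Rightarrow> pt" where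
  "jn A x r C =
     (if prio A < r then
        if prio C < r then PN x r A C
        else (case C of PN c p l u \<Rightarrow> PN c p (jn A x r l) u | _ \<Rightarrow> PN x r A C)
      else if prio A < prio C then
        (case C of PN c p l u \<Rightarrow> PN c p (jn A x r l) u | _ \<Rightarrow> PN x r A C)
      else (case A of PN a p l u \<Rightarrow> PN a p l (jn u x r C) | _ \<Rightarrow> PN x r A C))"

declare jn.simps [simp del]

text \<open>\<open>QSlot d c s T\<close> specifies a thread that stores the root of \<open>T\<close> into cell \<open>c\<close> of \<open>d\<close>, where each level
  of \<open>T\<close> is final at most 20 time units after the one above it.\<close>

datatype spec = QSlot addr nat nat pt | QFix pt | QMain pt

text \<open>\<open>tv\<close> is the content of the handle cell: null if the child is already in
  place, otherwise the thread that will deliver it. \<open>X\<close>, the resources of the delivered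
  tree, is a parameter so that \<open>trest\<close> can recurse on the tree through it.\<close>

definition fut :: "addr \<Rightarrow> nat \<Rightarrow> nat \<Rightarrow> pt \<Rightarrow> spec assn \<Rightarrow> val \<Rightarrow> spec assn" where
  "fut d c s T X tv = (\<lambda>h. tv = NullV \<and> (cell d c (NodeV (addr_of T)) ** X) h \<or>
     (\<exists>t s'. tv = ThreadV t \<and> s' \<le> s \<and> hdl t s' (QSlot d c s' T) h))"

definition slot :: "addr \<Rightarrow> nat \<Rightarrow> nat \<Rightarrow> pt \<Rightarrow> spec assn \<Rightarrow> spec assn" where
  "slot d c s T X = (\<lambda>h. \<exists>tv. (cell d (c + 3) tv ** fut d c s T X tv) h)"

text \<open>The priority cell of the root is left out and added by \<open>tree\<close>, so that a
  join can read it before knowing whether the root is a leaf.\<close>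

primrec trest :: "pt \<Rightarrow> nat \<Rightarrow> spec assn" where
  "trest (PL a x) s = cell a 0 NullV ** cell a 1 NullV ** cell a 3 (IntV 1) ** cell a 4 x ** cell a 5 x"
| "trest (PN a r l u) s = cell_any a 5 **
     slot a 0 (s + 20) l (cell (addr_of l) 2 (IntV (int (prio l))) ** trest l (s + 20)) **
     slot a 1 (s + 20) u (cell (addr_of u) 2 (IntV (int (prio u))) ** trest u (s + 20))"

definition tree :: "nat \<Rightarrow> pt \<Rightarrow> spec assn" where
  "tree s T = cell (addr_of T) 2 (IntV (int (prio T))) ** trest T s"

abbreviation tfut :: "addr \<Rightarrow> nat \<Rightarrow> nat \<Rightarrow> pt \<Rightarrow> val \<Rightarrow> spec assn" where
  "tfut d c s T \<equiv> fut d c s T (tree s T)"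

abbreviation tslot :: "addr \<Rightarrow> nat \<Rightarrow> nat \<Rightarrow> pt \<Rightarrow> spec assn" where
  "tslot d c s T \<equiv> slot d c s T (tree s T)"

lemma trest_PN: "trest (PN a r l u) s = cell_any a 5 **
     tslot a 0 (s + 20) l ** tslot a 1 (s + 20) u"
  by (simp add: tree_def)

primrec batch :: "pt \<Rightarrow> spec assn" where
  "batch (PL a x) = cell a 2 (IntV 0) ** cell a 0 NullV ** cell a 1 NullV ** cell a 3 (IntV 1) **
     cell a 4 x ** cell a 5 x"
| "batch (PN a r l u) = cell a 2 (IntV (int (ht (PN a r l u)))) **
     cell a 0 (NodeV (addr_of l)) ** cell a 1 (NodeV (addr_of u)) **
     cell a 3 (IntV (int (sz (PN a r l u)))) **
     cell a 4 (hd (items (erase (PN a r l u)))) ** cell a 5 (last (items (erase (PN a r l u)))) **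
     batch l ** batch u"

text \<open>In \<open>QMain\<close> the conjunct that is always true absorbs the auxiliary node in
  which the main thread receives the root.\<close>

fun post :: "spec \<Rightarrow> (reg \<Rightarrow> val) \<Rightarrow> spec assn" where
  "post (QSlot d c s T) rs = cell d c (NodeV (addr_of T)) ** tree s T"
| "post (QFix T) rs = batch T"
| "post (QMain T) rs = (\<lambda>h. rs 0 = NodeV (addr_of T) \<and> (batch T ** (\<lambda>_. True)) h)"

lemma fut_mono: "s \<le> s' \<Longrightarrow> X \<turnstile> X' \<Longrightarrow> fut d c s T X tv \<turnstile> fut d c s' T X' tv"
  unfolding ent_def fut_def using ent_star[of "cell d c (NodeV (addr_of T))" "cell d c (NodeV (addr_of T))" X X']
  unfolding ent_def by (auto intro: order_trans)

lemma slot_mono: "s \<le> s' \<Longrightarrow> X \<turnstile> X' \<Longrightarrow> slot d c s T X \<turnstile> slot d c s' T X'"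
  using fut_mono[of s s' X X' d c T] ent_star[OF ent_refl] unfolding ent_def slot_def by metis

lemma trest_mono: "s \<le> s' \<Longrightarrow> trest T s \<turnstile> trest T s'"
proof (induction T arbitrary: s s')
  case (PL a x)
  then show ?case by simp
next
  case (PN a r l u)
  then have le: "s + 20 \<le> s' + 20" by simp
  show ?case unfolding trest.simps
    by (rule ent_star[OF ent_refl ent_star[OF slot_mono[OF le ent_star[OF ent_refl PN.IH(1)[OF le]]]
          slot_mono[OF le ent_star[OF ent_refl PN.IH(2)[OF le]]]]])
qed

lemma tree_mono: "s \<le> s' \<Longrightarrow> tree s T \<turnstile> tree s' T"
  unfolding tree_def by (rule ent_star[OF ent_refl trest_mono])

lemma slot_intro: "cell d (c + 3) tv ** fut d c s T X tv \<turnstile> slot d c s T X"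
  unfolding ent_def slot_def by blast

lemma slot_ready: "cell d (c + 3) NullV ** cell d c (NodeV (addr_of T)) ** X \<turnstile> slot d c s T X"
  by (rule ent_trans[OF ent_star[OF ent_refl] slot_intro]) (simp add: ent_def fut_def)

lemma slot_pending: "s' \<le> s \<Longrightarrow>
  cell d (c + 3) (ThreadV t) ** hdl t s' (QSlot d c s' T) \<turnstile> slot d c s T X"
  by (rule ent_trans[OF ent_star[OF ent_refl] slot_intro]) (auto simp: ent_def fut_def)

definition consts_ok :: "nat \<Rightarrow> (reg \<Rightarrow> val) \<Rightarrow> bool" where
  "consts_ok M rs \<longleftrightarrow> rs 12 = NullV \<and> rs 13 = IntV 0 \<and> rs 14 = IntV 2 \<and> rs 15 = IntV 1 \<and> rs 3 = IntV (int M)"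

locale rebalance =
  fixes K B M :: nat and goal :: pt
begin

sublocale logic K prog B post "QMain goal" .

end

section \<open>Pipelined joins\<close>

lemma length_prog [simp]: "length prog = 122"
  by (simp add: prog_def)

context rebalance
begin

text \<open>Lets the search for a conjunct fix the witness by unification before the continuation is
  looked at.\<close>

lemma exI_conjI: "A x \<Longrightarrow> C x \<Longrightarrow> \<exists>x. A x \<and> C x"
  by blast

lemma asafe_fut:
  assumes "tv = NullV \<Longrightarrow> asafe w D E q pc rs (cell d c (NodeV (addr_of T)) ** X ** R)"
    and "\<And>t s'. tv = ThreadV t \<Longrightarrow> s' \<le> s \<Longrightarrow> asafe w D E q pc rs (hdl t s' (QSlot d c s' T) ** R)"
  shows "asafe w D E q pc rs (fut d c s T X tv ** R)"
  unfolding asafe_def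
proof (intro allI impI)
  fix h assume "(fut d c s T X tv ** R) h"
  then obtain h1 h2 where h: "h = h1 ++ h2" "dom h1 \<inter> dom h2 = {}" "fut d c s T X tv h1" "R h2"
    unfolding star_def by blast
  from h(3) show "safe w D E q pc rs h" unfolding fut_def
  proof (elim disjE exE conjE)
    assume "tv = NullV" "(cell d c (NodeV (addr_of T)) ** X) h1"
    moreover then have "((cell d c (NodeV (addr_of T)) ** X) ** R) h" using h unfolding star_def by blast
    ultimately show ?thesis using assms(1) unfolding star_assoc asafe_def by blast
  next
    fix t s' assume a: "tv = ThreadV t" "s' \<le> s" "hdl t s' (QSlot d c s' T) h1"
    then have "(hdl t s' (QSlot d c s' T) ** R) h" using h unfolding star_def by blast
    then show ?thesis using assms(2) a unfolding asafe_def by blast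
  qed
qed

declare One_nat_def [simp del]

text \<open>The fragment that tests a handle, joins it and reads the child occurs four times in the
  program, hence the program counters as parameters.\<close>

lemma await:
  assumes "pc3 < length prog" "prog ! pc = JumpIfEq 10 12 pc2" "prog ! pc1 = Join 10"
    "prog ! pc2 = Access y Read p c" "Suc pc = pc1" "Suc pc1 = pc2" "Suc pc2 = pc3"
    and "rs 10 = tv" "rs 12 = NullV" "rs p = NodeV d" "s < E" "D + 1 < E" "3 \<le> w"
    and cont: "asafe (w - 3) (max D s + 3) E q pc3 (rs(y := NodeV (addr_of T)))
      (cell d c (NodeV (addr_of T)) ** tree s T ** R)"
  shows "asafe w D E q pc rs (tfut d c s T tv ** R)"
proof -
  \<comment> \<open>The final read, reached directly or after the join; \<open>max D s + 2\<close>
    covers both ways.\<close>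
  have rd: "asafe w' D' E q pc2 rs (cell d c (NodeV (addr_of T)) ** tree s T ** R)"
    if "w - 2 \<le> w'" "D' \<le> max D s + 2" for w' D'
    apply (rule step[OF _ assms(4)])
    using assms that apply simp
    using assms that apply simp
    apply (simp add: assms)
    apply (rule exI_conjI, rule has_here)
    apply (rule asafe_mono[OF cont])
    using that assms by auto
  show ?thesis
  proof (rule asafe_fut)
    assume "tv = NullV"
    then show "asafe w D E q pc rs (cell d c (NodeV (addr_of T)) ** tree s T ** R)"
      apply (intro step[OF _ assms(2)])
      using assms apply simp
      using assms apply simp
      apply (simp add: assms)
      apply (rule rd)
      using assms by auto
  next
    fix t s' assume t: "tv = ThreadV t" "s' \<le> s"
    have "(\<lambda>h. \<exists>rs'. post (QSlot d c s' T) rs' h) ** R \<turnstile> (cell d c (NodeV (addr_of T)) ** tree s T) ** R"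
      using ent_star[OF ent_star[OF ent_refl tree_mono[OF t(2)]] ent_refl] by simp
    note e = this[unfolded star_assoc]
    show "asafe w D E q pc rs (hdl t s' (QSlot d c s' T) ** R)"
      apply (rule step[OF _ assms(2)])
      using assms apply simp
      using assms apply simp
      apply (simp add: assms t)
      apply (rule step[OF _ assms(3)])
      using assms apply simp
      using assms apply simp
      apply (simp only: pre.simps)
      apply (intro exI conjI, simp add: assms t, rule rem_here)
      using assms t apply simp
      using assms t apply simp
      apply (simp only: assms)
      apply (rule asafe_ent[OF e rd])
      using assms t by auto
  qed
qed

lemma asafe_slot:
  assumes "\<And>tv. asafe w D E q pc rs (cell d (c + 3) tv ** fut d c s T X tv ** R)"
  shows "asafe w D E q pc rs (slot d c s T X ** R)"
  unfolding asafe_def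
proof (intro allI impI)
  fix h assume "(slot d c s T X ** R) h"
  then obtain h1 h2 tv where "h = h1 ++ h2" "dom h1 \<inter> dom h2 = {}"
    "(cell d (c + 3) tv ** fut d c s T X tv) h1" "R h2"
    unfolding star_def slot_def by blast
  then have "((cell d (c + 3) tv ** fut d c s T X tv) ** R) h"
    unfolding star_def[of "cell d (c + 3) tv ** fut d c s T X tv"] by blast
  then show "safe w D E q pc rs h" using assms unfolding star_assoc asafe_def by blast
qed

text \<open>A cell index is part of the program text, so the side \<open>sd\<close> selects between
  two pieces of code.\<close>

lemma write_root:
  assumes "rs 1 = NodeV y" "rs 4 = NodeV d" "rs 5 = IntV (int sd)" "sd < 2" "rs 13 = IntV 0"
    "D + 3 \<le> E" "3 \<le> w" and post: "\<And>rs'. cell d sd (NodeV y) ** R \<turnstile> post q rs'"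
  shows "asafe w D E q 52 rs (cell_any d sd ** R)"
proof -
  have sd: "sd = 0 \<or> sd = 1" using assms(4) by auto
  show ?thesis
  proof (cases "sd = 0")
    case True
    note F = assms(1-7)[unfolded True, simplified]
    show ?thesis unfolding True
      apply (rule step, simp, simp add: prog_def, use F in simp, simp add: F)
      apply (rule step, simp, simp add: prog_def, use F in simp, simp add: F)
      apply (rule exI_conjI, ((rule upd_here upd_last upd_last_any | rule upd_skip)+)[1])
      apply (rule step, simp, simp add: prog_def, use F in simp, simp add: F post[unfolded True])
      using F by simp
  next
    case False
    then have T: "sd = 1" using sd by simp
    note F = assms(1-7)[unfolded T, simplified]
    show ?thesis unfolding T
      apply (rule step, simp, simp add: prog_def, use F in simp, simp add: F)
      apply (rule step, simp, simp add: prog_def, use F in simp, simp add: F)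
      apply (rule exI_conjI, ((rule upd_here upd_last upd_last_any | rule upd_skip)+)[1])
      apply (rule step, simp, simp add: prog_def, use F in simp, simp add: F post[unfolded T])
      using F by simp
  qed
qed

definition jnode :: "addr \<Rightarrow> nat \<Rightarrow> spec assn" where
  "jnode x r = cell_any x 0 ** cell_any x 1 ** cell x 2 (IntV (int r)) ** cell_any x 3 **
     cell_any x 4 ** cell_any x 5"

lemma ready0: "s1 \<le> s2 \<Longrightarrow>
    cell x 3 NullV ** cell x 0 (NodeV (addr_of T)) ** tree s1 T \<turnstile> tslot x 0 s2 T"
  by (rule ent_trans[OF ent_star[OF ent_refl ent_star[OF ent_refl tree_mono]]])
     (auto intro: slot_ready[where c = 0, simplified])

lemma ready1: "s1 \<le> s2 \<Longrightarrow>
    cell x 4 NullV ** cell x 1 (NodeV (addr_of T)) ** tree s1 T \<turnstile> tslot x 1 s2 T"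
  by (rule ent_trans[OF ent_star[OF ent_refl ent_star[OF ent_refl tree_mono]]])
     (auto intro: slot_ready[where c = 1, simplified])

lemma tree_ready:
  assumes "sA \<le> s + 20" "sC \<le> s + 20"
  shows "cell x 2 (IntV (int r)) ** cell_any x 5 **
     (cell x 3 NullV ** cell x 0 (NodeV (addr_of A)) ** tree sA A) **
     (cell x 4 NullV ** cell x 1 (NodeV (addr_of C)) ** tree sC C) \<turnstile> tree s (PN x r A C)"
  unfolding tree_def[of s "PN x r A C"] addr_of.simps prio.simps trest_PN
  by (intro ent_star ent_refl ready0 ready1 assms)

text \<open>The pipelining step: with the root announced for \<open>s\<close>, the untouched child
  keeps its earlier deadline and the remaining join is promised for \<open>s + 20\<close>, as
  \<open>tree\<close> demands.\<close>

lemma tree_left: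
  assumes "sA \<le> s"
  shows "cell a 2 (IntV (int p)) ** cell_any a 5 ** tslot a 0 (sA + 20) l **
     (cell a 4 (ThreadV t) ** hdl t (s + 20) (QSlot a 1 (s + 20) T)) \<turnstile> tree s (PN a p l T)"
  unfolding tree_def[of s "PN a p l T"] addr_of.simps prio.simps trest_PN
  by (intro ent_star ent_refl slot_mono tree_mono slot_pending[where c = 1, simplified]) (use assms in auto)

lemma tree_right:
  assumes "sC \<le> s"
  shows "cell b 2 (IntV (int p)) ** cell_any b 5 **
     (cell b 3 (ThreadV t) ** hdl t (s + 20) (QSlot b 0 (s + 20) T)) **
     tslot b 1 (sC + 20) u \<turnstile> tree s (PN b p T u)"
  unfolding tree_def[of s "PN b p T u"] addr_of.simps prio.simps trest_PN
  by (intro ent_star ent_refl slot_mono tree_mono slot_pending[where c = 0, simplified]) (use assms in auto)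

lemma place_ok:
  assumes "rs 1 = NodeV x" "rs 6 = NodeV (addr_of A)" "rs 7 = NodeV (addr_of C)" "rs 12 = NullV"
    "rs 4 = NodeV d" "rs 5 = IntV (int sd)" "sd < 2" "rs 13 = IntV 0"
    "sA \<le> s" "sC \<le> s" "D + 8 \<le> s" "8 \<le> w"
  shows "asafe w D s (QSlot d sd s (PN x r A C)) 63 rs
     (cell_any d sd ** jnode x r ** tree sA A ** tree sC C)"
  unfolding jnode_def star_assoc
    apply (rule step, simp, simp add: prog_def, use assms in simp, simp add: assms)
    apply (rule exI_conjI, ((rule upd_here upd_last upd_last_any | rule upd_skip)+)[1])
    apply (rule step, simp, simp add: prog_def, use assms in simp, simp add: assms)
    apply (rule exI_conjI, ((rule upd_here upd_last upd_last_any | rule upd_skip)+)[1])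
    apply (rule step, simp, simp add: prog_def, use assms in simp, simp add: assms)
    apply (rule exI_conjI, ((rule upd_here upd_last upd_last_any | rule upd_skip)+)[1])
    apply (rule step, simp, simp add: prog_def, use assms in simp, simp add: assms)
    apply (rule exI_conjI, ((rule upd_here upd_last upd_last_any | rule upd_skip)+)[1])
    apply (rule step, simp, simp add: prog_def, use assms in simp, simp add: assms)
    apply (rule write_root)
    apply (simp_all add: assms)
    using assms(11) apply simp
    using assms(12) apply simp
    apply (rule ent_star[OF ent_refl])
    apply (rule ent_trans[OF _ tree_ready[of sA s sC x r A C]])
    apply (simp add: star_ac)
    using assms(9,10) by auto

text \<open>The timing reproduces itself one level down. The child to be joined is due at
  \<open>sA + 20\<close>, hence by \<open>s\<close>; waiting for it and reaching the next join takes
  at most 4 further steps; that join must start 13 steps before its deadline \<open>s + 20\<close>.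
  The bound \<open>B\<close> has to cover the deadlines of the forked joins on all lower
  levels.\<close>

definition join_safe :: "pt \<Rightarrow> addr \<Rightarrow> nat \<Rightarrow> pt \<Rightarrow> bool" where
  "join_safe A x r C \<longleftrightarrow> (\<forall>w D s sA sC rs d sd.
     consts_ok M rs \<and> rs 1 = NodeV x \<and> rs 6 = NodeV (addr_of A) \<and> rs 7 = NodeV (addr_of C) \<and>
     rs 9 = IntV (int r) \<and> rs 4 = NodeV d \<and> rs 5 = IntV (int sd) \<and> sd < 2 \<and>
     sA + 20 \<le> s \<and> sC + 20 \<le> s \<and> D + 13 \<le> s \<and> s + 20 * ht (jn A x r C) \<le> B \<and>
     20 * ht (jn A x r C) \<le> w \<longrightarrow>
     asafe w D s (QSlot d sd s (jn A x r C)) 44 rs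
       (cell_any d sd ** jnode x r ** tree sA A ** tree sC C))"

text \<open>The old handle of the right child is read before the fork and reaches the forked thread
  in an inherited register. The cell is therefore free to hold the new handle, and waiting for the
  old child is left to the forked thread.\<close>

lemma left_wins:
  assumes c: "consts_ok M rs" and regs: "rs 1 = NodeV x" "rs 6 = NodeV a" "rs 7 = NodeV (addr_of C)"
    "rs 9 = IntV (int r)" "rs 4 = NodeV d" "rs 5 = IntV (int sd)" and sd: "sd < 2"
    and t: "sA + 20 \<le> s" "sC + 20 \<le> s" "D + 9 \<le> s"
    and b: "s + 20 + 20 * ht (jn u x r C) \<le> B" and w: "20 * ht (jn u x r C) + 16 \<le> w"
    and IH: "join_safe u x r C"
  shows "asafe w D s (QSlot d sd s (PN a p l (jn u x r C))) 48 rs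
     (cell_any d sd ** jnode x r ** tree sA (PN a p l u) ** tree sC C)"
proof -
  note c' = c[unfolded consts_ok_def]
  let ?T = "jn u x r C"
  have rearrange: "cell_any d sd ** jnode x r ** tree sA (PN a p l u) ** tree sC C =
    tslot a 1 (sA + 20) u ** cell_any d sd ** jnode x r ** cell a 2 (IntV (int p)) **
    cell_any a 5 ** tslot a 0 (sA + 20) l ** tree sC C"
    unfolding tree_def[of sA "PN a p l u"] addr_of.simps prio.simps trest_PN by (simp only: star_ac)
  show ?thesis unfolding rearrange
    apply (rule asafe_slot)
    apply simp
    apply (rule step, simp, simp add: prog_def, use w in simp, simp add: c' regs)
    apply (rule exI_conjI, ((rule has_here has_last | rule has_skip)+)[1])
    subgoal for tv
      apply (rule asafe_fork[where ?A1.0 = "tfut a 1 (sA + 20) u tv ** tree sC C ** jnode x r"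
        and ?A2.0 = "cell a 4 tv ** cell_any d sd ** cell a 2 (IntV (int p)) **
          cell_any a 5 ** tslot a 0 (sA + 20) l" and E' = "s + 20"
        and q' = "QSlot a 1 (s + 20) ?T" and ?w1.0 = "20 * ht ?T + 7" and ?w2.0 = 6])
      apply simp
      apply (simp add: prog_def)
      apply (simp only: star_ac ent_refl)
      using b apply simp
      using w apply simp
      subgoal
        apply (rule step, simp, simp add: prog_def, use w in simp, simp add: c' regs)
        apply (rule step, simp, simp add: prog_def, use w in simp, simp add: c' regs)
        apply (rule await[where ?pc1.0 = 71 and ?pc2.0 = 72 and ?pc3.0 = 73],
            simp, simp add: prog_def, simp add: prog_def, simp add: prog_def, simp, simp, simp)
        apply (simp_all only: c' regs fun_upd_apply)
        apply simp_all
        using t apply simp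
        using t apply simp
        apply (rule step, simp, simp add: prog_def, use w in simp, simp add: c' regs)
        apply (rule asafe_ent[OF _ IH[unfolded join_safe_def, rule_format, where sA = "sA + 20" and sC = sC and d = a and sd = 1]])
        apply (rule ent_trans[of _ "cell a 1 (NodeV (addr_of u)) ** jnode x r ** tree (sA + 20) u ** tree sC C"])
        apply (simp only: star_ac ent_refl)
        apply (rule ent_star[OF cell_ent_any ent_refl])
        using t b w by (auto simp: c' regs consts_ok_def)
      subgoal for t
        apply (rule step, simp, simp add: prog_def, use w in simp, simp add: c' regs)
        apply (rule exI_conjI, ((rule upd_here upd_last upd_last_any | rule upd_skip)+)[1])
        apply (rule step, simp, simp add: prog_def, use w in simp, simp add: c' regs)
        apply (rule asafe_ent[OF _ write_root[where R = "hdl t (s + 20) (QSlot a 1 (s + 20) ?T) **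
             cell a 4 (ThreadV t) ** cell a 2 (IntV (int p)) ** cell_any a 5 **
             tslot a 0 (sA + 20) l" and y = a and d = d and sd = sd]])
        using t sd apply (simp_all add: c' regs star_ac)
        apply (rule ent_star[OF ent_refl])
        apply (rule ent_trans[OF _ tree_left[where sA = sA and t = t]])
        apply (simp only: star_ac ent_refl)
        using t apply simp
        done
      done
    done
qed

lemma right_wins:
  assumes c: "consts_ok M rs" and regs: "rs 1 = NodeV x" "rs 6 = NodeV (addr_of A)" "rs 7 = NodeV b"
    "rs 9 = IntV (int r)" "rs 4 = NodeV d" "rs 5 = IntV (int sd)" and sd: "sd < 2"
    and t: "sA + 20 \<le> s" "sC + 20 \<le> s" "D + 9 \<le> s"
    and b: "s + 20 + 20 * ht (jn A x r l) \<le> B" and w: "20 * ht (jn A x r l) + 16 \<le> w"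
    and IH: "join_safe A x r l"
  shows "asafe w D s (QSlot d sd s (PN b p (jn A x r l) u)) 58 rs
     (cell_any d sd ** jnode x r ** tree sA A ** tree sC (PN b p l u))"
proof -
  note c' = c[unfolded consts_ok_def]
  let ?T = "jn A x r l"
  have rearrange: "cell_any d sd ** jnode x r ** tree sA A ** tree sC (PN b p l u) =
    tslot b 0 (sC + 20) l ** cell_any d sd ** jnode x r ** cell b 2 (IntV (int p)) **
    cell_any b 5 ** tslot b 1 (sC + 20) u ** tree sA A"
    unfolding tree_def[of sC "PN b p l u"] addr_of.simps prio.simps trest_PN by (simp only: star_ac)
  show ?thesis unfolding rearrange
    apply (rule asafe_slot)
    apply simp
    apply (rule step, simp, simp add: prog_def, use w in simp, simp add: c' regs)
    apply (rule exI_conjI, ((rule has_here has_last | rule has_skip)+)[1])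
    subgoal for tv
      apply (rule asafe_fork[where ?A1.0 = "tfut b 0 (sC + 20) l tv ** tree sA A ** jnode x r"
        and ?A2.0 = "cell b 3 tv ** cell_any d sd ** cell b 2 (IntV (int p)) **
          cell_any b 5 ** tslot b 1 (sC + 20) u" and E' = "s + 20"
        and q' = "QSlot b 0 (s + 20) ?T" and ?w1.0 = "20 * ht ?T + 7" and ?w2.0 = 6])
      apply simp
      apply (simp add: prog_def)
      apply (simp only: star_ac ent_refl)
      using b apply simp
      using w apply simp
      subgoal
        apply (rule step, simp, simp add: prog_def, use w in simp, simp add: c' regs)
        apply (rule step, simp, simp add: prog_def, use w in simp, simp add: c' regs)
        apply (rule await[where ?pc1.0 = 77 and ?pc2.0 = 78 and ?pc3.0 = 79],
            simp, simp add: prog_def, simp add: prog_def, simp add: prog_def, simp, simp, simp)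
        apply (simp_all only: c' regs fun_upd_apply)
        apply simp_all
        using t apply simp
        using t apply simp
        apply (rule step, simp, simp add: prog_def, use w in simp, simp add: c' regs)
        apply (rule asafe_ent[OF _ IH[unfolded join_safe_def, rule_format, where sC = "sC + 20" and sA = sA and d = b and sd = 0]])
        apply (rule ent_trans[of _ "cell b 0 (NodeV (addr_of l)) ** jnode x r ** tree sA A ** tree (sC + 20) l"])
        apply (simp only: star_ac ent_refl)
        apply (rule ent_star[OF cell_ent_any ent_refl])
        using t b w by (auto simp: c' regs consts_ok_def)
      subgoal for t
        apply (rule step, simp, simp add: prog_def, use w in simp, simp add: c' regs)
        apply (rule exI_conjI, ((rule upd_here upd_last upd_last_any | rule upd_skip)+)[1])
        apply (rule step, simp, simp add: prog_def, use w in simp, simp add: c' regs)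
        apply (rule step, simp, simp add: prog_def, use w in simp, simp add: c' regs)
        apply (rule asafe_ent[OF _ write_root[where R = "hdl t (s + 20) (QSlot b 0 (s + 20) ?T) **
             cell b 3 (ThreadV t) ** cell b 2 (IntV (int p)) ** cell_any b 5 **
             tslot b 1 (sC + 20) u" and y = b and d = d and sd = sd]])
        using t sd apply (simp_all add: c' regs star_ac)
        apply (rule ent_star[OF ent_refl])
        apply (rule ent_trans[OF _ tree_right[where sC = sC and t = t]])
        apply (simp only: star_ac ent_refl)
        using t apply simp
        done
      done
    done
qed

lemma join_ok: "0 < r \<Longrightarrow> join_safe A x r C"
proof (induction "size A + size C" arbitrary: A C rule: less_induct)
  case less
  show ?case
    unfolding join_safe_def
  proof (intro allI impI, elim conjE)
    fix w D s sA sC rs d sd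
    assume c: "consts_ok M rs" and regs: "rs 1 = NodeV x" "rs 6 = NodeV (addr_of A)" "rs 7 = NodeV (addr_of C)"
     "rs 9 = IntV (int r)" "rs 4 = NodeV d" "rs 5 = IntV (int sd)" and sd: "sd < (2 :: nat)"
     and t: "sA + 20 \<le> s" "sC + 20 \<le> s" "D + 13 \<le> s"
     and b: "s + 20 * ht (jn A x r C) \<le> B" and w: "20 * ht (jn A x r C) \<le> w"
    note c' = c[unfolded consts_ok_def]
    let ?q = "QSlot d sd s (jn A x r C)"
    let ?A = "cell_any d sd ** jnode x r ** tree sA A ** tree sC C"
    have "0 < ht (jn A x r C)"
      by (subst jn.simps) (auto split: pt.splits)
    then have w20: "20 \<le> w" using w by simp
    have rearrange: "?A = cell (addr_of A) 2 (IntV (int (prio A))) ** cell (addr_of C) 2 (IntV (int (prio C))) **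
      trest A sA ** trest C sC ** cell_any d sd ** jnode x r"
      unfolding tree_def by (simp only: star_ac)
    \<comment> \<open>Each of the three outcomes is reached after two reads and two comparisons,
      hence the slack of 4 in work and depth.\<close>
    have right: "asafe w' D' s ?q 58 rs' ?A"
      if w': "w \<le> w' + 4" "D' \<le> D + 4" and rs': "rs' = rs(16 := IntV (int (prio A)), 17 := IntV (int (prio C)))"
        and p: "r \<le> prio C" "prio A < r \<or> prio A < prio C" for w' D' rs'
    proof -
      obtain b' p' l u where C: "C = PN b' p' l u" using p(1) less.prems by (cases C) auto
      have j: "jn A x r C = PN b' p' (jn A x r l) u" using p C by (subst jn.simps) auto
      have h: "20 * ht (jn A x r l) + 20 \<le> 20 * ht (jn A x r C)" unfolding j by simp
      show ?thesis unfolding j unfolding C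
        by (rule right_wins)
          (use c regs sd t b w w' h less C rs' in \<open>auto simp: consts_ok_def intro: less.hyps\<close>)
    qed
    have left: "asafe w' D' s ?q 48 rs' ?A"
      if w': "w \<le> w' + 4" "D' \<le> D + 4" and rs': "rs' = rs(16 := IntV (int (prio A)), 17 := IntV (int (prio C)))"
        and p: "r \<le> prio A" "prio C \<le> prio A" for w' D' rs'
    proof -
      obtain a' p' l u where A: "A = PN a' p' l u" using p(1) less.prems by (cases A) auto
      have j: "jn A x r C = PN a' p' l (jn u x r C)" using p A by (subst jn.simps) auto
      have h: "20 * ht (jn u x r C) + 20 \<le> 20 * ht (jn A x r C)" unfolding j by simp
      show ?thesis unfolding j unfolding A
        by (rule left_wins)
          (use c regs sd t b w w' h less A rs' in \<open>auto simp: consts_ok_def intro: less.hyps\<close>)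
    qed
    have place: "asafe w' D' s ?q 63 rs' ?A"
      if w': "w \<le> w' + 4" "D' \<le> D + 4" and rs': "rs' = rs(16 := IntV (int (prio A)), 17 := IntV (int (prio C)))"
        and p: "prio A < r" "prio C < r" for w' D' rs'
    proof -
      have j: "jn A x r C = PN x r A C" using p by (subst jn.simps) auto
      show ?thesis unfolding j
        by (rule place_ok) (use c' regs sd t w20 w' rs' in auto)
    qed
    show "asafe w D s ?q 44 rs ?A"
      apply (subst rearrange)
      apply (rule step, simp, simp add: prog_def, use w20 in simp, simp add: c' regs)
      apply (rule exI_conjI, ((rule has_here has_last | rule has_skip)+)[1])
      apply (rule step, simp, simp add: prog_def, use w20 in simp, simp add: c' regs)
      apply (rule exI_conjI, ((rule has_here has_last | rule has_skip)+)[1])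
      apply (subst rearrange[symmetric])
      apply (cases "prio A < r")
      apply (rule step, simp, simp add: prog_def, use w20 in simp, simp add: c' regs)
      apply (rule step, simp, simp add: prog_def, use w20 in simp, simp add: c' regs)
      apply (cases "prio C < r")
      apply (simp, rule place, simp, simp, simp, simp, simp)
      apply (simp, rule right, simp, simp, simp, simp, simp)
      apply (rule step, simp, simp add: prog_def, use w20 in simp, simp add: c' regs)
      apply (rule step, simp, simp add: prog_def, use w20 in simp, simp add: c' regs)
      apply (cases "prio A < prio C")
      apply (simp, rule right, simp, simp, simp, simp, simp)
      apply (simp, rule left, simp, simp, simp, simp, simp)
      done
  qed
qed

end

section \<open>Heap-ordered trees over the splits\<close>

definition vpos :: "nat \<Rightarrow> nat \<Rightarrow> nat" where
  "vpos M p = p + min p M"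

definition val2 :: "nat \<Rightarrow> nat \<Rightarrow> nat" where
  "val2 M p = multiplicity 2 (vpos M p)"

abbreviation lb :: "nat \<Rightarrow> nat \<Rightarrow> nat" where
  "lb M p \<equiv> 2 ^ val2 M p"

lemma pos_mono: "i < j \<Longrightarrow> vpos M i < vpos M j"
  unfolding vpos_def by auto

lemma pos_mono_iff: "vpos M i < vpos M j \<longleftrightarrow> i < j"
  using pos_mono by (metis linorder_neqE_nat order_less_asym)

lemma pos_inj: "vpos M i = vpos M j \<longleftrightarrow> i = j"
  using pos_mono by (metis linorder_neqE_nat less_irrefl)

lemma pos_pos: "0 < vpos M p \<longleftrightarrow> 0 < p"
  unfolding vpos_def by auto

text \<open>Grid points that are not positions are odd, so only points of least priority can be
  missing.\<close>

lemma pos_even: "even c \<Longrightarrow> \<exists>p. vpos M p = c"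
proof (cases "c \<le> 2 * M")
  case True
  assume "even c"
  then have "vpos M (c div 2) = c" unfolding vpos_def using True by auto
  then show ?thesis by blast
next
  case False
  then have "vpos M (c - M) = c" unfolding vpos_def by auto
  then show ?thesis by blast
qed

lemma dvd_val2: "0 < p \<Longrightarrow> 2 ^ k dvd vpos M p \<longleftrightarrow> k \<le> val2 M p"
  unfolding val2_def using pos_pos[of M p] by (intro power_dvd_iff_le_multiplicity) auto

text \<open>Both positions are odd multiples \<open>a\<close> and \<open>b\<close> of the same power
  \<open>2 ^ v\<close>. Between them lies \<open>a + 1\<close> times that power, which is divisible
  by \<open>2 ^ (v + 1)\<close>; being even, it is the position of a split. So the maximum over
  consecutive splits is never tied.\<close>

lemma val2_between:
  assumes "0 < i" "i < j" "val2 M i = val2 M j"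
  obtains k where "i < k" "k < j" "val2 M i < val2 M k"
proof -
  let ?v = "val2 M i"
  obtain a where a: "vpos M i = 2 ^ ?v * a" using dvd_val2[OF assms(1)] by (metis dvdE order_refl)
  obtain b where b: "vpos M j = 2 ^ ?v * b"
    using dvd_val2[of j ?v M] assms by (metis dvdE gr_zeroI not_less_zero order_refl)
  have "odd a"
  proof
    assume "even a"
    then have "2 ^ Suc ?v dvd vpos M i" unfolding a by auto
    then show False using dvd_val2[OF assms(1), of "Suc ?v" M] by simp
  qed
  moreover have "odd b"
  proof
    assume "even b"
    then have "2 ^ Suc ?v dvd vpos M j" unfolding b by auto
    then show False using dvd_val2[of j "Suc ?v" M] assms by simp
  qed
  moreover have "a < b" using pos_mono[OF assms(2), of M] unfolding a b by simp
  ultimately have ab: "a + 1 < b" "even (a + 1)" by presburger+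
  then obtain k where k: "vpos M k = 2 ^ ?v * (a + 1)" using pos_even[of "2 ^ ?v * (a + 1)"] by auto
  have "i < k" using pos_mono_iff[of M i k] unfolding k a by simp
  have "2 ^ ?v * (a + 1) < 2 ^ ?v * b" using ab by (intro mult_strict_left_mono) auto
  then have "k < j" using pos_mono_iff[of M k j] unfolding k b by blast
  obtain m where "a + 1 = 2 * m" using ab(2) by blast
  then have "vpos M k = 2 ^ Suc ?v * m" using k by simp
  then have "2 ^ Suc ?v dvd vpos M k" by simp
  then have "val2 M i < val2 M k" using dvd_val2[of k "Suc ?v" M] \<open>i < k\<close> by auto
  with \<open>i < k\<close> \<open>k < j\<close> show ?thesis using that by blast
qed

text \<open>\<open>i\<close> is the index of the first item, so the root sits at split
  \<open>i + sz l\<close>. Strict heap order can be demanded because maxima are not tied.\<close>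

primrec cart :: "nat \<Rightarrow> pt \<Rightarrow> nat \<Rightarrow> bool" where
  "cart M (PL a x) i \<longleftrightarrow> True"
| "cart M (PN a r l u) i \<longleftrightarrow> r = lb M (i + sz l) \<and> prio l < r \<and> prio u < r \<and>
     cart M l i \<and> cart M u (i + sz l)"

lemma sz_pos [simp]: "0 < sz t"
  by (induction t) auto

lemma sz_PN: "sz (PN a r l u) = sz l + sz u"
  by simp

lemma cart_max: "cart M t i \<Longrightarrow> i < q \<Longrightarrow> q < i + sz t \<Longrightarrow> lb M q \<le> prio t"
proof (induction t arbitrary: i)
  case (PL a x)
  then show ?case by simp
next
  case (PN a r l u)
  consider "q < i + sz l" | "q = i + sz l" | "i + sz l < q" by linarith
  then show ?case
  proof cases
    case 1
    then have "lb M q \<le> prio l" "prio l < prio (PN a r l u)" using PN.IH(1)[of i] PN.prems by simp_all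
    then show ?thesis by linarith
  next
    case 2
    then show ?thesis using PN.prems by simp
  next
    case 3
    then have "lb M q \<le> prio u" "prio u < prio (PN a r l u)"
      using PN.IH(2)[of "i + sz l"] PN.prems by simp_all
    then show ?thesis by linarith
  qed
qed

lemma prio_jn: "prio (jn A x r C) \<in> {prio A, r, prio C}"
  by (subst jn.simps) (auto split: pt.splits)

text \<open>Apart from ties this is the usual treap join. A tie at the top, between the two roots or
  between a root and the middle split, would by \<open>val2_between\<close> enclose a split of
  larger priority, which contradicts maximality.\<close>

lemma jn_cart:
  assumes "cart M A i" "cart M C (i + sz A)" "r = lb M (i + sz A)"
  shows "cart M (jn A x r C) i \<and> items (erase (jn A x r C)) = items (erase A) @ items (erase C)"
  using assms
proof (induction "size A + size C" arbitrary: A C i rule: less_induct)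
  case less
  let ?m = "i + sz A"
  have m: "0 < ?m" using sz_pos[of A] by linarith
  \<comment> \<open>Rules out that the roots of \<open>A\<close> and \<open>C\<close> tie: the
    larger split \<open>k\<close> between them lies in \<open>A\<close>, in \<open>C\<close> or in
    the middle, and each is bounded by \<open>prio A\<close>.\<close>
  have no_A: "val2 M p = val2 M q \<Longrightarrow> lb M p = prio A \<Longrightarrow> i < p \<Longrightarrow> p < ?m \<Longrightarrow> ?m < q \<Longrightarrow> r \<le> prio A
     \<Longrightarrow> q < ?m + sz C \<Longrightarrow> prio C \<le> prio A \<Longrightarrow> False" for p q
  proof -
    assume a: "val2 M p = val2 M q" "lb M p = prio A" "i < p" "p < ?m" "?m < q" "r \<le> prio A"
      "q < ?m + sz C" "prio C \<le> prio A"
    obtain k where k: "p < k" "k < q" "val2 M p < val2 M k" using val2_between[of p q M] a by auto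
    then have "prio A < lb M k" using a(2) by (metis one_less_numeral_iff power_strict_increasing semiring_norm(76))
    moreover have "lb M k \<le> prio A"
      using cart_max[OF less.prems(1), of k] cart_max[OF less.prems(2), of k] k a less.prems(3)
      by (cases k ?m rule: linorder_cases) auto
    ultimately show False by simp
  qed
  have no_eq: "val2 M p = val2 M q \<Longrightarrow> 0 < p \<Longrightarrow> p < q \<Longrightarrow> \<forall>k. p < k \<and> k < q \<longrightarrow> lb M k \<le> lb M p \<Longrightarrow> False" for p q
    by (rule val2_between[of p q M]) (auto simp: not_less[symmetric])
  consider (C) "prio A < prio C" "r \<le> prio C"
    | (A) "r \<le> prio A" "prio C \<le> prio A" | (P) "prio A < r" "prio C < r" by linarith
  then show ?case
  proof cases
    case P
    then have "jn A x r C = PN x r A C" by (subst jn.simps) auto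
    then show ?thesis using less.prems P by simp
  next
    case A
    have "0 < r" using less.prems by simp
    then obtain a p l u where Aeq: "A = PN a p l u" using A by (cases A) auto
    have j: "jn A x r C = PN a p l (jn u x r C)" using A Aeq by (subst jn.simps) auto
    have cu: "cart M u (i + sz l)" "p = lb M (i + sz l)" "cart M l i" "prio l < p" "prio u < p"
      using less.prems(1) Aeq by auto
    have m': "i + sz l + sz u = ?m" using Aeq by simp
    have IH: "cart M (jn u x r C) (i + sz l)" "items (erase (jn u x r C)) = items (erase u) @ items (erase C)"
      using less.hyps[of u C "i + sz l"] Aeq less.prems cu m' by (auto simp: add.assoc)
    have lt: "i < i + sz l" "i + sz l < ?m" using m' sz_pos[of l] sz_pos[of u] by linarith+
    have "r \<noteq> p"
    proof
      assume "r = p"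
      then have "val2 M (i + sz l) = val2 M ?m" using less.prems(3) cu(2) by simp
      then show False
      proof (rule no_eq)
        show "\<forall>k. i + sz l < k \<and> k < ?m \<longrightarrow> lb M k \<le> lb M (i + sz l)"
          using cart_max[OF less.prems(1)] lt Aeq cu(2) by auto
      qed (use lt in auto)
    qed
    moreover have "prio C \<noteq> p"
    proof
      assume Cp: "prio C = p"
      then obtain c l' u' where Ceq: "C = PN c p l' u'" using cu(2) by (cases C) auto
      have "val2 M (i + sz l) = val2 M (?m + sz l')" using less.prems(2) cu(2) Ceq by simp
      then show False
        by (rule no_A) (use cu(2) Aeq lt A Ceq sz_pos[of l'] sz_pos[of u'] in \<open>auto\<close>)
    qed
    ultimately have "prio (jn u x r C) < p" using prio_jn[of u x r C] A Aeq cu by auto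
    then show ?thesis unfolding j using IH cu Aeq by simp
  next
    case C
    obtain a p l u where Ceq: "C = PN a p l u" using C less.prems(3) by (cases C) auto
    have j: "jn A x r C = PN a p (jn A x r l) u" using C Ceq by (subst jn.simps) auto
    have cu: "cart M u (?m + sz l)" "p = lb M (?m + sz l)" "cart M l ?m" "prio l < p" "prio u < p"
      using less.prems(2) Ceq by auto
    have IH: "cart M (jn A x r l) i" "items (erase (jn A x r l)) = items (erase A) @ items (erase l)"
      using less.hyps[of A l i] Ceq less.prems cu by auto
    have "r \<noteq> p"
    proof
      assume "r = p"
      then have "val2 M ?m = val2 M (?m + sz l)" using less.prems(3) cu(2) by simp
      then show False
      proof (rule no_eq)
        show "\<forall>k. ?m < k \<and> k < ?m + sz l \<longrightarrow> lb M k \<le> lb M ?m"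
        proof (intro allI impI)
          fix k assume "?m < k \<and> k < ?m + sz l"
          then have "lb M k \<le> prio l" using cart_max[OF cu(3)] by blast
          then show "lb M k \<le> lb M ?m" using cu(4) \<open>r = p\<close> less.prems(3) by linarith
        qed
      qed (use m sz_pos[of l] in auto)
    qed
    then have "prio (jn A x r l) < p" using prio_jn[of A x r l] C Ceq cu by auto
    then show ?thesis unfolding j using IH cu Ceq by (simp add: add.assoc)
  qed
qed

primrec build :: "nat \<Rightarrow> pt \<Rightarrow> nat \<Rightarrow> pt" where
  "build M (PL a x) i = PL a x"
| "build M (PN a h l u) i = jn (build M l i) a (lb M (i + sz l)) (build M u (i + sz l))"

lemma build_cart: "cart M (build M t i) i \<and> items (erase (build M t i)) = items (erase t)"
proof (induction t arbitrary: i)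
  case (PL a x)
  then show ?case by simp
next
  case (PN a h l u)
  then show ?case using jn_cart[of M "build M l i" i "build M u (i + sz l)" "lb M (i + sz l)" a] by simp
qed

section \<open>Height and shape of the heap-ordered trees\<close>

lemma cart_prio: "cart M t i \<Longrightarrow> prio t = 0 \<or> (\<exists>q. i < q \<and> q < i + sz t \<and> prio t = lb M q)"
proof (cases t)
  case (PN a r l u)
  then show "cart M t i \<Longrightarrow> ?thesis" using sz_pos[of l] sz_pos[of u]
    by (intro disjI2 exI[of _ "i + sz l"]) (simp del: sz_pos)
qed simp

text \<open>Priorities are powers of two that strictly decrease on the way down, so the exponent
  drops on every level.\<close>

lemma cart_height_prio: "cart M t i \<Longrightarrow> prio t < 2 ^ e \<Longrightarrow> ht t \<le> e"
proof (induction t arbitrary: i e)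
  case (PL a x)
  then show ?case by simp
next
  case (PN a r l u)
  let ?v = "val2 M (i + sz l)"
  have "ht l \<le> ?v" "ht u \<le> ?v" using PN.IH(1)[of i ?v] PN.IH(2)[of "i + sz l" ?v] PN.prems by auto
  moreover have "?v < e" using PN.prems by simp
  ultimately show ?case by simp
qed

text \<open>For a range in arbitrary position the priority of the root can be far larger than the
  size, so \<open>cart_height_prio\<close> is applied to its children. If \<open>q\<close> has
  smaller priority \<open>2 ^ v\<close> than the root, both positions are multiples of
  \<open>2 ^ v\<close>, so their distance is at least \<open>2 ^ v\<close>; and distances are below
  \<open>2 * sz t\<close>. Hence the children have height at most \<open>h + 1\<close>.\<close>

lemma cart_height:
  assumes c: "cart M t i" and s: "sz t \<le> 2 ^ h"
  shows "ht t \<le> h + 2"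
proof (cases t)
  case (PL a x)
  then show ?thesis by simp
next
  case (PN a r l u)
  let ?p = "i + sz l"
  have small: "lb M q < 2 ^ (h + 1)" if q: "i < q" "q < i + sz t" "lb M q < lb M ?p" for q
  proof -
    have "val2 M q \<le> val2 M ?p" using q(3) by simp
    then have d: "2 ^ val2 M q dvd vpos M q" "2 ^ val2 M q dvd vpos M ?p"
      using dvd_val2[of q "val2 M q" M] dvd_val2[of ?p "val2 M q" M] q sz_pos[of l] by auto
    have "q \<noteq> ?p" using q(3) by auto
    \<comment> \<open>The factor 2 is the largest stretch from items to grid slots.\<close>
    have bound: "b - a < 2 * sz t" if "a = vpos M x" "b = vpos M y" "i < x" "y < i + sz t" "x < y" for a b x y
      using that unfolding vpos_def by auto
    have pr: "i < ?p" "?p < i + sz t" using sz_pos[of l] sz_pos[of u] PN by auto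
    have "2 ^ val2 M q < 2 * sz t"
    proof (cases "q < ?p")
      case True
      then have "2 ^ val2 M q \<le> vpos M ?p - vpos M q"
        using d pos_mono[OF True, of M] by (intro dvd_imp_le dvd_diff_nat) auto
      then show ?thesis using bound[OF refl refl q(1) pr(2) True] by linarith
    next
      case False
      then have F: "?p < q" using \<open>q \<noteq> ?p\<close> by simp
      then have "2 ^ val2 M q \<le> vpos M q - vpos M ?p"
        using d pos_mono[OF F, of M] by (intro dvd_imp_le dvd_diff_nat) auto
      then show ?thesis using bound[OF refl refl pr(1) q(2) F] by linarith
    qed
    then show ?thesis using s by simp
  qed
  have cl: "cart M l i" "cart M u ?p" "prio l < lb M ?p" "prio u < lb M ?p" using c PN by auto
  have "prio l < 2 ^ (h + 1)"
    using cart_prio[OF cl(1)] small cl(3) PN by fastforce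
  moreover have "prio u < 2 ^ (h + 1)"
    using cart_prio[OF cl(2)] small cl(4) PN sz_pos[of l] by fastforce
  ultimately show ?thesis using cart_height_prio[OF cl(1)] cart_height_prio[OF cl(2)] PN by fastforce
qed

lemma sz_le_height: "sz t \<le> 2 ^ ht t"
proof (induction t)
  case (PL a x)
  then show ?case by simp
next
  case (PN a r l u)
  have "sz l \<le> 2 ^ max (ht l) (ht u)" "sz u \<le> 2 ^ max (ht l) (ht u)"
    using PN by (auto intro: order_trans[OF _ power_increasing])
  then show ?case by simp
qed

text \<open>Bounds each intermediate tree by the height of its input subtree, against which the work
  and the deadlines of the joins are charged.\<close>

lemma build_height: "ht (build M t i) \<le> ht t + 2"
  using cart_height[of M "build M t i" i "ht t"] build_cart[of M t i] sz_le_height[of t] by simp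

text \<open>Induction over the aligned grid intervals of length \<open>2 ^ k\<close>: the root is at
  the midpoint, and the halves are aligned again. An interval of length 2 is either two items or one
  item of two slots, and the latter is where a leaf ends one level above the bottom.\<close>

lemma cart_complete:
  assumes "cart M t i" "vpos M i = a * 2 ^ k" "vpos M (i + sz t) = (a + 1) * 2 ^ k"
  shows "ht t \<le> k \<and> k \<le> ht t + 1 \<and> bbt (erase t) \<and> (\<forall>d<k. level_size (erase t) d = 2 ^ d)"
  using assms
proof (induction k arbitrary: t i a)
  case 0
  then have "sz t = 1" using sz_pos[of t] unfolding vpos_def by (auto split: if_splits simp: min_def)
  then obtain b x where "t = PL b x"
  proof (cases t)
    case (PN b r l u)
    then show ?thesis using \<open>sz t = 1\<close> sz_pos[of l] sz_pos[of u] by simp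
  qed
  then show ?case by simp
next
  case (Suc k)
  show ?case
  proof (cases "k = 0")
    case True
    have "sz t \<le> 2" using Suc.prems(2,3) True unfolding vpos_def by (auto split: if_splits simp: min_def)
    then consider b x where "t = PL b x" | b r c x d y where "t = PN b r (PL c x) (PL d y)"
    proof (cases t)
      case (PN b r l u)
      then have "sz l + sz u \<le> 2" using \<open>sz t \<le> 2\<close> by simp
      then have "sz l \<le> 1" "sz u \<le> 1" using sz_pos[of l] sz_pos[of u] by linarith+
      moreover have "\<exists>c x. l = PL c x" if "sz l \<le> 1" for l
      proof (cases l)
        case (PN b' r' l' u')
        then show ?thesis using that sz_pos[of l'] sz_pos[of u'] by auto
      qed simp
      ultimately obtain c x d y where "l = PL c x" "u = PL d y" by blast
      then show ?thesis using that(2) PN by simp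
    qed
    then show ?thesis using True by cases auto
  next
    case False
    let ?c = "(2 * a + 1) * 2 ^ k"
    \<comment> \<open>As \<open>k\<close> is positive, the midpoint is even and therefore a split,
      so the root has priority at least \<open>2 ^ k\<close>.\<close>
    have "even ?c" using False by simp
    then obtain p0 where p0: "vpos M p0 = ?c" using pos_even by blast
    have "i < p0" "p0 < i + sz t"
      using pos_mono_iff[of M i p0] pos_mono_iff[of M p0 "i + sz t"] p0 Suc.prems by auto
    moreover have "k \<le> val2 M p0" using dvd_val2[of p0 k M] p0 \<open>i < p0\<close> by auto
    ultimately have big: "2 ^ k \<le> prio t"
      using cart_max[OF Suc.prems(1), of p0] by (meson le_trans one_le_numeral power_increasing)
    then obtain b r l u where t: "t = PN b r l u" by (cases t) auto
    let ?p = "i + sz l"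
    have c: "cart M l i" "cart M u ?p" "r = lb M ?p" using Suc.prems(1) t by auto
    have "k \<le> val2 M ?p" using big t c(3) by simp
    then have "2 ^ k dvd vpos M ?p" using dvd_val2[of ?p k M] sz_pos[of l] by auto
    then obtain e where e: "vpos M ?p = 2 ^ k * e" by blast
    have "vpos M i < vpos M ?p" "vpos M ?p < vpos M (i + sz t)"
      using t sz_pos[of l] sz_pos[of u] by (auto intro!: pos_mono)
    \<comment> \<open>The root is a multiple of \<open>2 ^ k\<close> strictly inside the interval,
      and the midpoint is the only one.\<close>
    then have "2 * a * 2 ^ k < e * 2 ^ k" "e * 2 ^ k < (2 * a + 2) * 2 ^ k"
      using e Suc.prems(2,3) by (simp_all add: algebra_simps)
    then have "2 * a < e" "e < 2 * a + 2" by (metis mult_less_cancel2)+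
    then have "e = 2 * a + 1" by simp
    then have m: "vpos M ?p = (2 * a + 1) * 2 ^ k" using e by simp
    have 1: "ht l \<le> k \<and> k \<le> ht l + 1 \<and> bbt (erase l) \<and> (\<forall>d<k. level_size (erase l) d = 2 ^ d)"
      using Suc.IH[OF c(1), of "2 * a"] m Suc.prems(2) by (simp add: algebra_simps)
    have 2: "ht u \<le> k \<and> k \<le> ht u + 1 \<and> bbt (erase u) \<and> (\<forall>d<k. level_size (erase u) d = 2 ^ d)"
      using Suc.IH[OF c(2), of "2 * a + 1"] m Suc.prems(3) t by (simp add: algebra_simps)
    have "level_size (erase t) d = 2 ^ d" if "d < Suc k" for d
      using that 1 2 t by (cases d) auto
    then show ?thesis using 1 2 t by auto
  qed
qed

lemma complete_build:
  assumes "sz t \<le> 2 ^ h" "2 ^ h = sz t + M" "M < sz t"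
  shows "bbt (erase (build M t 0))" "complete_btree (erase (build M t 0))"
proof -
  have "vpos M 0 = 0 * 2 ^ h" unfolding vpos_def by simp
  moreover have "vpos M (0 + sz (build M t 0)) = (0 + 1) * 2 ^ h"
    using build_cart[of M t 0] assms unfolding vpos_def by simp
  ultimately have *: "ht (build M t 0) \<le> h \<and> h \<le> ht (build M t 0) + 1 \<and> bbt (erase (build M t 0)) \<and>
      (\<forall>d<h. level_size (erase (build M t 0)) d = 2 ^ d)"
    using cart_complete build_cart by blast
  then show "bbt (erase (build M t 0))" "complete_btree (erase (build M t 0))"
    unfolding complete_btree_def by auto
qed

text \<open>Odd numbers contribute nothing and \<open>2 * c\<close> contributes one more than
  \<open>c\<close>, so doubling the range adds \<open>2 ^ h - 1\<close>.\<close>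

lemma sum_multiplicity_2: "(\<Sum>c = 1..<2 ^ h. multiplicity 2 (c::nat)) \<le> 2 ^ h"
proof (induction h)
  case 0
  then show ?case by simp
next
  case (Suc h)
  have "(\<Sum>c = 1..<2 ^ Suc h. multiplicity 2 (c::nat)) =
     (\<Sum>c \<in> {c \<in> {1..<2 ^ Suc h}. even c}. multiplicity 2 (c::nat)) + (\<Sum>c \<in> {c \<in> {1..<2 ^ Suc h}. odd c}. multiplicity 2 (c::nat))"
    by (subst sum.union_disjoint[symmetric]) (auto intro: sum.cong)
  also have "(\<Sum>c \<in> {c \<in> {1..<2 ^ Suc h}. odd c}. multiplicity 2 (c::nat)) = 0"
    by (auto intro: not_dvd_imp_multiplicity_0)
  also have "{c \<in> {1..<2 ^ Suc h}. even c} = (\<lambda>c. 2 * c) ` {1..<2 ^ h :: nat}"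
    by (auto elim!: evenE)
  also have "(\<Sum>c \<in> (\<lambda>c. 2 * c) ` {1..<2 ^ h}. multiplicity 2 (c::nat)) = (\<Sum>c = 1..<2 ^ h. multiplicity 2 (2 * c::nat))"
    by (subst sum.reindex) (auto simp: inj_on_def)
  also have "\<dots> = (\<Sum>c = 1..<2 ^ h. Suc (multiplicity 2 (c::nat)))"
    by (intro sum.cong refl multiplicity_times_same) auto
  also have "\<dots> = (\<Sum>c = 1..<2 ^ h. multiplicity 2 (c::nat)) + (2 ^ h - 1)"
    by (simp add: sum.distrib sum_Suc)
  finally show ?case using Suc by simp
qed

text \<open>The positions of the splits are distinct grid points below \<open>2 ^ h\<close>. This
  bounds the total cost of finding the priorities.\<close>

lemma sum_val2:
  assumes "n + M \<le> 2 ^ h" "0 < n"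
  shows "(\<Sum>p = 1..<n. val2 M p) \<le> 2 ^ h"
proof -
  have "(\<Sum>p = 1..<n. val2 M p) = (\<Sum>c \<in> vpos M ` {1..<n}. multiplicity 2 c)"
    unfolding val2_def by (subst sum.reindex) (auto simp: inj_on_def pos_inj)
  also have "\<dots> \<le> (\<Sum>c = 1..<2 ^ h. multiplicity 2 (c::nat))"
    by (rule sum_mono2) (use assms in \<open>auto simp: vpos_def\<close>)
  also have "\<dots> \<le> 2 ^ h" by (rule sum_multiplicity_2)
  finally show ?thesis .
qed

section \<open>Correctness of the program\<close>

context rebalance
begin

declare One_nat_def [simp del]

section \<open>Construction of the heap-ordered tree by the program\<close>

lemma has_left: "has A k x \<Longrightarrow> has (A ** C) k x"
  using has_skip by (metis star_comm)

lemma has_batch: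
  "has (batch T) (Cell (addr_of T) 2) (Val (IntV (int (ht T))))"
  "has (batch T) (Cell (addr_of T) 3) (Val (IntV (int (sz T))))"
  "has (batch T) (Cell (addr_of T) 4) (Val (hd (items (erase T))))"
  "has (batch T) (Cell (addr_of T) 5) (Val (last (items (erase T))))"
  by (cases T; simp; (rule has_here has_last | rule has_skip)+)+

text \<open>Trial division by growing powers of two: five instructions for each trailing zero and
  three to leave the loop.\<close>

lemma loop_ok:
  assumes "rs 13 = IntV 0" "rs 14 = IntV 2" "rs 8 = IntV (int c)" "rs 9 = IntV (2 ^ j)"
    and "0 < c" "j \<le> multiplicity 2 c" "5 * (multiplicity 2 c - j) + 3 \<le> w"
    and "\<And>rs'. (\<And>k. k \<notin> {9, 16, 18} \<Longrightarrow> rs' k = rs k) \<Longrightarrow> rs' 9 = IntV (2 ^ multiplicity 2 c) \<Longrightarrow>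
      asafe (w - (5 * (multiplicity 2 c - j) + 3)) (D + 5 * (multiplicity 2 c - j) + 3) E q 39 rs' A"
  shows "asafe w D E q 34 rs A"
  using assms
proof (induction "multiplicity 2 c - j" arbitrary: j rs w D)
  case 0
  then have j: "j = multiplicity 2 c" by simp
  have nd: "\<not> 2 ^ Suc j dvd c" unfolding j using \<open>0 < c\<close> by (subst power_dvd_iff_le_multiplicity) auto
  have m: "0 < int c mod (2 ^ j * 2)"
  proof -
    have "\<not> int (2 ^ Suc j) dvd int c" using nd by (simp only: int_dvd_int_iff not_False_eq_True)
    moreover have "int (2 ^ Suc j) = 2 ^ j * 2" by simp
    ultimately have "int c mod (2 ^ j * 2) \<noteq> 0" by (metis dvd_eq_mod_eq_0)
    moreover have "0 \<le> int c mod (2 ^ j * 2)" by (rule pos_mod_sign) simp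
    ultimately show ?thesis by linarith
  qed
  note A = 0(2-8)
  show ?case
    apply (rule step, simp, simp add: prog_def, use A in simp, simp add: A)
    apply (rule step, simp, simp add: prog_def, use A in simp, simp add: A)
    apply (rule step, simp, simp add: prog_def, use A in simp, simp add: A m)
    apply (rule asafe_mono)
    apply (rule 0(9))
    using A j by auto
next
  case (Suc n)
  then have j: "j < multiplicity 2 c" by simp
  have d: "2 ^ Suc j dvd c" using j \<open>0 < c\<close> by (subst power_dvd_iff_le_multiplicity) auto
  have m: "int c mod (2 ^ j * 2) = 0"
  proof -
    have "int (2 ^ Suc j) dvd int c" using d by (simp only: int_dvd_int_iff)
    moreover have "int (2 ^ Suc j) = 2 ^ j * 2" by simp
    ultimately show ?thesis by (metis dvd_eq_mod_eq_0)
  qed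
  note A = Suc(3-9)
  have e: "multiplicity 2 c - j = Suc (multiplicity 2 c - Suc j)" using j by simp
  show ?case
    apply (rule step, simp, simp add: prog_def, use A e in simp, simp add: A)
    apply (rule step, simp, simp add: prog_def, use A e in simp, simp add: A)
    apply (rule step, simp, simp add: prog_def, use A e in simp, simp add: A m)
    apply (rule step, simp, simp add: prog_def, use A e in simp, simp add: A)
    apply (rule step, simp, simp add: prog_def, use A e in simp, simp add: A)
    apply (rule Suc(1)[where j = "Suc j"])
    using Suc(2) apply simp
    using A j apply simp
    using A j apply simp
    using A j apply simp
    using A j apply (simp add: mult.commute)
    using A j apply simp
    using A j apply simp
    using A j e apply simp
    apply (rule asafe_mono)
    apply (rule Suc(10))
    using e by auto
qed

text \<open>The last two summands of the second equation pay for the priority loop and for the join,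
  whose result has height at most \<open>ht + 2\<close> by \<open>build_height\<close>.\<close>

primrec build_work :: "pt \<Rightarrow> nat \<Rightarrow> nat" where
  "build_work (PL a x) i = 10"
| "build_work (PN a h l u) i = build_work l i + build_work u (i + sz l) + 60 +
     5 * val2 M (i + sz l) + 20 * (ht (PN a h l u) + 2)"

text \<open>\<open>s\<close> is one time for the whole batch by which every node has been reached
  and has its priority. The descent costs 20 per height, but \<open>5 * L\<close> is counted once: a
  node starts its loop after forking its children, so all loops overlap. From \<open>s\<close> on,
  each height of the input postpones the root by 20.\<close>

lemma build_ok:
  assumes "consts_ok M rs" "rs 1 = NodeV (addr_of T)" "rs 2 = IntV (int i)" "rs 4 = NodeV d"
    "rs 5 = IntV (int sd)" "sd < 2"
    and "\<And>p. i < p \<Longrightarrow> p < i + sz T \<Longrightarrow> val2 M p \<le> L"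
    and "D + 20 * ht T + 5 * L + 40 \<le> s" "s + 20 * (ht T + 1) + 20 * (ht T + 2) \<le> B"
    and "build_work T i \<le> w"
  shows "asafe w D (s + 20 * (ht T + 1)) (QSlot d sd (s + 20 * (ht T + 1)) (build M T i)) 21 rs
     (cell_any d sd ** batch T)"
  using assms
proof (induction T arbitrary: rs i d sd D w)
  case (PL a x)
  note c' = PL(1)[unfolded consts_ok_def]
  note R = PL(2-)[simplified]
  show ?case
    unfolding batch.simps
    apply (rule step, simp, simp add: prog_def, use R in simp, simp add: c' R)
    apply (rule exI_conjI, ((rule has_here has_last | rule has_skip)+)[1])
    apply (rule step, simp, simp add: prog_def, use R in simp, simp add: c' R)
    apply (rule write_root)
    apply (use R in \<open>simp_all add: c' tree_def\<close>)
    apply (rule ent_refl)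
    done
next
  case (PN a h l u)
  note IHl = PN.IH(1) and IHu = PN.IH(2)
  note c = PN.prems(1)
  note c' = c[unfolded consts_ok_def]
  note R = PN.prems(2-6)[unfolded addr_of.simps]
  let ?T = "PN a h l u" let ?p = "i + sz l"
  define H where "H = ht ?T"
  define E where "E = s + 20 * (H + 1)"
  define v where "v = val2 M ?p"
  define El where "El = s + 20 * (ht l + 1)"
  define Eu where "Eu = s + 20 * (ht u + 1)"
  have H0: "H \<noteq> 0" unfolding H_def by simp
  have H: "0 < H" "ht l + 1 \<le> H" "ht u + 1 \<le> H" unfolding H_def by auto
  have El: "El + 20 \<le> E" "El \<le> s + 20 * H" and Eu: "Eu + 20 \<le> E" "Eu \<le> s + 20 * H"
    unfolding El_def Eu_def E_def using H by auto
  have p: "i < ?p" "?p < i + sz ?T" using sz_pos[of l] sz_pos[of u] unfolding sz_PN by linarith+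
  have vL: "v \<le> L" unfolding v_def by (rule PN.prems(7)[OF p])
  have D: "D + 20 * H + 5 * L + 40 \<le> s" using PN.prems(8) unfolding H_def .
  have B: "E + 20 * (H + 2) \<le> B" using PN.prems(9) unfolding H_def E_def .
  have w: "build_work l i + build_work u ?p + 60 + 5 * v + 20 * (H + 2) \<le> w"
    using PN.prems(10) unfolding H_def v_def by simp
  have left: "asafe (build_work l i) D' El (QSlot a 0 El (build M l i)) 21 rs' (cell_any a 0 ** batch l)"
    if "consts_ok M rs'" "rs' 1 = NodeV (addr_of l)" "rs' 2 = IntV (int i)" "rs' 4 = NodeV a" "rs' 5 = IntV 0"
      "D' \<le> D + 20" for rs' D'
    unfolding El_def
    by (rule IHl) (use that D H B PN.prems(7) in \<open>auto simp: E_def\<close>)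
  have right: "asafe (build_work u ?p) D' Eu (QSlot a 1 Eu (build M u ?p)) 21 rs' (cell_any a 1 ** batch u)"
    if "consts_ok M rs'" "rs' 1 = NodeV (addr_of u)" "rs' 2 = IntV (int ?p)" "rs' 4 = NodeV a" "rs' 5 = IntV 1"
      "D' \<le> D + 20" for rs' D'
    unfolding Eu_def
    by (rule IHu) (use that D H B PN.prems(7) sz_pos[of l] in \<open>auto simp: E_def add.assoc\<close>)
  obtain v3 v4 v5 where bt: "batch ?T = cell a 2 (IntV (int H)) ** cell a 0 (NodeV (addr_of l)) **
     cell a 1 (NodeV (addr_of u)) ** cell a 3 v3 ** cell a 4 v4 ** cell a 5 v5 ** batch l ** batch u"
    unfolding H_def by simp
  \<comment> \<open>The minimum as the program computes it, by a branch; at \<open>M\<close> both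
    formulas agree.\<close>
  have cpos: "vpos M ?p = (if ?p < M then 2 * ?p else ?p + M)" unfolding vpos_def by auto
  have J: "asafe w' D' E (QSlot d sd E (build M ?T i)) 44 rs'
     (cell_any d sd ** jnode a (lb M ?p) ** tree El (build M l i) ** tree Eu (build M u ?p))"
    if "consts_ok M rs'" "rs' 1 = NodeV a" "rs' 6 = NodeV (addr_of (build M l i))"
      "rs' 7 = NodeV (addr_of (build M u ?p))" "rs' 9 = IntV (int (lb M ?p))" "rs' 4 = NodeV d"
      "rs' 5 = IntV (int sd)" "D' + 13 \<le> E" "20 * (H + 2) \<le> w'" for w' D' rs'
  proof -
    have "20 * ht (build M ?T i) \<le> 20 * (H + 2)"
      unfolding H_def using build_height by (rule mult_le_mono2)
    then have b: "E + 20 * ht (build M ?T i) \<le> B" "20 * ht (build M ?T i) \<le> w'"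
      using B that(9) by (auto simp only: intro: order_trans[OF add_left_mono] order_trans)
    show ?thesis
      using join_ok[of "lb M ?p" "build M l i" a "build M u ?p", unfolded join_safe_def] that R(5) El(1) Eu(1)
        b[unfolded build.simps]
      by (simp only: build.simps) auto
  qed
  have jn_cells: "cell a 0 x0 ** cell a 1 x1 ** cell a 2 (IntV (int r)) ** cell a 3 x3 ** cell a 4 x4 ** cell a 5 x5
      \<turnstile> jnode a r" for x0 x1 x3 x4 x5 r
    unfolding jnode_def by (intro ent_star ent_refl cell_ent_any)
  \<comment> \<open>Where the two branches for the position meet.\<close>
  have at34: "asafe w' D' E (QSlot d sd E (build M ?T i)) 34 rs'
    (hdl tu Eu (QSlot a 1 Eu (build M u ?p)) ** hdl tl El (QSlot a 0 El (build M l i)) **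
     cell_any d sd ** cell a 2 (IntV (int H)) ** cell a 3 v3 ** cell a 4 v4 ** cell a 5 v5)"
    if c2: "consts_ok M rs'" and r: "rs' 1 = NodeV a" "rs' 4 = NodeV d" "rs' 5 = IntV (int sd)"
      "rs' 8 = IntV (int (vpos M ?p))" "rs' 9 = IntV 1" "rs' 10 = ThreadV tl" "rs' 11 = ThreadV tu"
      and D': "D' \<le> D + 12" and w': "5 * v + 20 * (H + 2) + 20 \<le> w'" for rs' D' w' tl tu
  proof -
    note c2' = c2[unfolded consts_ok_def]
    have m: "multiplicity 2 (vpos M ?p) = v" unfolding v_def val2_def ..
    show ?thesis
      apply (rule loop_ok[where j = 0 and c = "vpos M ?p"])
      apply (simp_all add: c2' r pos_pos m)
      using p sz_pos[of l] apply simp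
      using w' apply linarith
      subgoal premises k for rs2
      proof -
        have r2: "rs2 1 = NodeV a" "rs2 4 = NodeV d" "rs2 5 = IntV (int sd)" "rs2 9 = IntV (2 ^ v)"
          "rs2 10 = ThreadV tl" "rs2 11 = ThreadV tu" "rs2 12 = NullV" "rs2 13 = IntV 0" "rs2 14 = IntV 2"
          "rs2 15 = IntV 1" "rs2 3 = IntV (int M)"
          using k r c2' by simp_all
        show ?thesis
          apply (rule step, simp, simp add: prog_def, use w' in simp, simp add: r2)
          apply (rule exI_conjI, ((rule upd_here upd_last upd_last_any | rule upd_skip)+)[1])
          apply (rule step, simp, simp add: prog_def, use w' in simp, simp add: r2)
          apply (rule exI, rule exI, rule exI_conjI, ((rule rem_here | rule rem_skip)+)[1])
          apply (rule conjI, use El in simp)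
          apply (rule conjI, use D D' vL E_def in simp)
          apply (simp only: star_assoc post.simps simp_thms)
          apply (rule step, simp, simp add: prog_def, use w' in simp, simp add: r2)
          apply (rule exI_conjI, ((rule has_here has_last | rule has_skip)+)[1])
          apply (rule step, simp, simp add: prog_def, use w' in simp, simp add: r2)
          apply (rule exI, rule exI, rule exI_conjI, ((rule rem_here | rule rem_skip)+)[1])
          apply (rule conjI, use Eu in simp)
          apply (rule conjI, use D D' vL E_def El H in simp)
          apply (simp only: star_assoc post.simps simp_thms)
          apply (rule step, simp, simp add: prog_def, use w' in simp, simp add: r2)
          apply (rule exI_conjI, ((rule has_here has_last | rule has_skip)+)[1])
          apply (rule asafe_ent[OF _ J[unfolded build.simps]])
          apply (rule ent_trans[of _ "(cell a 0 (NodeV (addr_of (build M l i))) ** cell a 1 (NodeV (addr_of (build M u ?p))) **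
             cell a 2 (IntV (int (lb M ?p))) ** cell a 3 v3 ** cell a 4 v4 ** cell a 5 v5) **
             cell_any d sd ** tree El (build M l i) ** tree Eu (build M u ?p)"])
          apply (simp add: star_ac v_def)
          apply (rule ent_trans[OF ent_star[OF jn_cells ent_refl]])
          apply (simp only: star_ac ent_refl)
          apply (use r2 El Eu D D' vL w' in \<open>simp_all add: consts_ok_def v_def E_def\<close>)
          done
      qed
      done
  qed
  have "asafe w D E (QSlot d sd E (build M ?T i)) 21 rs (cell_any d sd ** batch ?T)"
    unfolding bt
    apply (rule step, simp, simp add: prog_def, use w in simp, simp add: c' R)
    apply (rule exI_conjI, ((rule has_here has_last | rule has_skip)+)[1])
    apply (rule step, simp, simp add: prog_def, use w in simp, simp add: c' R H0)
    apply (rule step, simp, simp add: prog_def, use w in simp, simp add: c' R)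
    apply (rule exI_conjI, ((rule has_here has_last | rule has_skip)+)[1])
    apply (rule step, simp, simp add: prog_def, use w in simp, simp add: c' R)
    apply (rule exI_conjI, ((rule has_here has_last | rule has_skip)+)[1])
    apply (rule step, simp, simp add: prog_def, use w in simp, simp add: c' R)
    apply (rule exI_conjI, ((rule has_left[OF has_batch(2)] | rule has_skip)+)[1])
    apply (rule step, simp, simp add: prog_def, use w in simp, simp add: c' R)
    apply (rule asafe_fork[where ?A1.0 = "cell_any a 0 ** batch l" and ?A2.0 = "cell_any d sd **
        cell a 2 (IntV (int H)) ** cell a 1 (NodeV (addr_of u)) ** cell a 3 v3 ** cell a 4 v4 ** cell a 5 v5 ** batch u"
        and E' = El and q' = "QSlot a 0 El (build M l i)" and ?w1.0 = "build_work l i + 5"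
        and ?w2.0 = "build_work u ?p + 40 + 5 * v + 20 * (H + 2)"], simp, simp add: prog_def)
    apply (rule ent_trans[of _ "cell a 0 (NodeV (addr_of l)) ** batch l ** cell_any d sd **
    cell a 2 (IntV (int H)) ** cell a 1 (NodeV (addr_of u)) ** cell a 3 v3 ** cell a 4 v4 ** cell a 5 v5 ** batch u"])
    apply (simp only: star_ac ent_refl)
    apply (simp only: star_assoc post.simps simp_thms)
    apply (rule ent_star[OF cell_ent_any ent_refl])
    using El B apply simp
    using w apply simp
    subgoal
      apply (rule step, simp, simp add: prog_def, use w in simp, simp add: c' R)
      apply (rule step, simp, simp add: prog_def, use w in simp, simp add: c' R)
      apply (rule step, simp, simp add: prog_def, use w in simp, simp add: c' R)
      apply (rule step, simp, simp add: prog_def, use w in simp, simp add: c' R)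
      apply (rule asafe_mono[OF left _ order_refl])
      apply (simp_all add: consts_ok_def c' R)
      done
    subgoal for tl
      apply (rule asafe_fork[where ?A1.0 = "cell_any a 1 ** batch u" and ?A2.0 = "hdl tl El (QSlot a 0 El (build M l i)) ** cell_any d sd **
          cell a 2 (IntV (int H)) ** cell a 3 v3 ** cell a 4 v4 ** cell a 5 v5"
          and E' = Eu and q' = "QSlot a 1 Eu (build M u ?p)" and ?w1.0 = "build_work u ?p + 6"
          and ?w2.0 = "33 + 5 * v + 20 * (H + 2)"], simp, simp add: prog_def)
      apply (rule ent_trans[of _ "cell a 1 (NodeV (addr_of u)) ** batch u ** hdl tl El (QSlot a 0 El (build M l i)) ** cell_any d sd **
      cell a 2 (IntV (int H)) ** cell a 3 v3 ** cell a 4 v4 ** cell a 5 v5"])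
      apply (simp only: star_ac ent_refl)
      apply (simp only: star_assoc post.simps simp_thms)
      apply (rule ent_star[OF cell_ent_any ent_refl])
      using Eu B apply simp
      apply simp
      subgoal
        apply (rule step, simp, simp add: prog_def, use w in simp, simp add: c' R)
        apply (rule step, simp, simp add: prog_def, use w in simp, simp add: c' R)
        apply (rule step, simp, simp add: prog_def, use w in simp, simp add: c' R)
        apply (rule step, simp, simp add: prog_def, use w in simp, simp add: c' R)
        apply (rule step, simp, simp add: prog_def, use w in simp, simp add: c' R)
        apply (rule asafe_mono[OF right _ order_refl])
        apply (simp_all add: consts_ok_def c' R)
        done
      subgoal for tu
        apply (cases "?p < M")
        apply (rule step, simp, simp add: prog_def, use w in simp, simp add: c' R)
        apply (rule step, simp, simp add: prog_def, use w in simp, simp add: c' R)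
        apply (rule step, simp, simp add: prog_def, use w in simp, simp add: c' R)
        apply (rule at34[unfolded build.simps])
        apply (simp_all add: consts_ok_def c' R cpos)
        apply (rule step, simp, simp add: prog_def, use w in simp, simp add: c' R)
        apply (rule step, simp, simp add: prog_def, use w in simp, simp add: c' R)
        apply (rule step, simp, simp add: prog_def, use w in simp, simp add: c' R)
        apply (rule step, simp, simp add: prog_def, use w in simp, simp add: c' R)
        apply (rule at34[unfolded build.simps])
        apply (simp_all add: consts_ok_def c' R cpos)
        done
      done
    done
  then show ?case unfolding E_def H_def .
qed

end

section \<open>The last pass\<close>

lemma items_nonempty [simp]: "items t \<noteq> []"
  by (induction t) auto

context rebalance
begin

declare One_nat_def [simp del]

text \<open>The pass trails the delivery of the tree: a level is due 20 after the one above, and the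
  pass allows itself 32 per level down and 32 per level up. The work \<open>50 * sz T - 40\<close>
  is 10 for each leaf and 40 for each internal node. The heap order supplies nonzero priorities, by
  which the program tells internal nodes from leaves.\<close>

lemma fix_ok:
  assumes "cart M T i" "consts_ok M rs" "rs 1 = NodeV (addr_of T)" "s \<le> \<sigma>" "D \<le> \<sigma>"
    "\<sigma> + 64 * ht T + 40 \<le> B" "50 * sz T \<le> w + 40"
  shows "asafe w D (\<sigma> + 64 * ht T + 40) (QFix T) 89 rs (tree s T)"
  using assms
proof (induction T arbitrary: i rs s \<sigma> D w)
  case (PL a x)
  note c' = PL(2)[unfolded consts_ok_def]
  note R = PL(3-)[simplified]
  show ?case
    unfolding tree_def
    apply (rule step, simp, simp add: prog_def, use R in simp, simp add: c' R)
    apply (rule exI_conjI, ((rule has_here has_last | rule has_skip)+)[1])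
    apply (rule step, simp, simp add: prog_def, use R in simp, simp add: c' R)
    apply (rule step, simp, simp add: prog_def, use R in simp, simp add: c' R)
    apply (use R in simp)
    done
next
  case (PN a r l u)
  note IHl = PN.IH(1) and IHu = PN.IH(2)
  note c = PN.prems(2)
  note c' = c[unfolded consts_ok_def]
  note R = PN.prems(3)[unfolded addr_of.simps]
  let ?T = "PN a r l u"
  note t = PN.prems(4,5)
  define m where "m = max (ht l) (ht u)"
  have hT: "ht ?T = Suc m" "ht l \<le> m" "ht u \<le> m" unfolding m_def by auto
  have r0: "r \<noteq> 0" and ca: "cart M l i" "cart M u (i + sz l)" using PN.prems(1) by auto
  define E where "E = \<sigma> + 64 * ht ?T + 40"
  define El where "El = \<sigma> + 32 + 64 * ht l + 40"
  define Eu where "Eu = \<sigma> + 32 + 64 * ht u + 40"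
  have E: "El + 32 \<le> E" "Eu + 32 \<le> E" "\<sigma> + 104 \<le> E" "E \<le> B"
    unfolding E_def El_def Eu_def using hT PN.prems(6) by auto
  have w: "50 * sz l + 50 * sz u \<le> w + 40" using PN.prems(7) by simp
  have n: "1 \<le> sz l" "1 \<le> sz u" using sz_pos[of l] sz_pos[of u] by linarith+
  have w60: "60 \<le> w" using w n by linarith
  have left: "asafe (50 * sz l - 40) D' El (QFix l) 89 rs' (tree (s + 20) l)"
    if "consts_ok M rs'" "rs' 1 = NodeV (addr_of l)" "D' \<le> \<sigma> + 32" for rs' D'
    unfolding El_def by (rule IHl[OF ca(1)]) (use that t E in \<open>simp_all add: El_def\<close>)
  have right: "asafe (50 * sz u - 40) D' Eu (QFix u) 89 rs' (tree (s + 20) u)"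
    if "consts_ok M rs'" "rs' 1 = NodeV (addr_of u)" "D' \<le> \<sigma> + 32" for rs' D'
    unfolding Eu_def by (rule IHu[OF ca(2)]) (use that t E in \<open>simp_all add: Eu_def\<close>)
  \<comment> \<open>The common tail after both outcomes of the maximum of the heights.\<close>
  have at107: "asafe w' D' E (QFix ?T) 107 rs'
     (batch u ** batch l ** cell a 0 (NodeV (addr_of l)) ** cell a 1 (NodeV (addr_of u)) **
      cell a 2 v2 ** cell a 3 v3 ** cell a 4 v4 ** cell_any a 5)"
    if k: "rs' 1 = NodeV a" "rs' 6 = NodeV (addr_of l)" "rs' 7 = NodeV (addr_of u)" "rs' 15 = IntV 1"
      "rs' 8 = IntV (int m)" and D': "D' + 12 \<le> E" and w': "12 \<le> w'" for rs' D' w' v2 v3 v4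
    apply (rule step, simp, simp add: prog_def, use w' in simp, simp add: k)
    apply (rule step, simp, simp add: prog_def, use w' in simp, simp add: k)
    apply (rule exI_conjI, ((rule upd_here upd_last upd_last_any | rule upd_skip)+)[1])
    apply (rule step, simp, simp add: prog_def, use w' in simp, simp add: k)
    apply (rule exI_conjI, ((rule has_left[OF has_batch(2)] | rule has_skip)+)[1])
    apply (rule step, simp, simp add: prog_def, use w' in simp, simp add: k)
    apply (rule exI_conjI, ((rule has_left[OF has_batch(2)] | rule has_skip)+)[1])
    apply (rule step, simp, simp add: prog_def, use w' in simp, simp add: k)
    apply (rule step, simp, simp add: prog_def, use w' in simp, simp add: k)
    apply (rule exI_conjI, ((rule upd_here upd_last upd_last_any | rule upd_skip)+)[1])
    apply (rule step, simp, simp add: prog_def, use w' in simp, simp add: k)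
    apply (rule exI_conjI, ((rule has_left[OF has_batch(3)] | rule has_skip)+)[1])
    apply (rule step, simp, simp add: prog_def, use w' in simp, simp add: k)
    apply (rule exI_conjI, ((rule upd_here upd_last upd_last_any | rule upd_skip)+)[1])
    apply (rule step, simp, simp add: prog_def, use w' in simp, simp add: k)
    apply (rule exI_conjI, ((rule has_left[OF has_batch(4)] | rule has_skip)+)[1])
    apply (rule step, simp, simp add: prog_def, use w' in simp, simp add: k)
    apply (rule exI_conjI, ((rule upd_here upd_last upd_last_any | rule upd_skip)+)[1])
    apply (rule step, simp, simp add: prog_def, use w' in simp, simp add: k)
    apply (rule conjI)
    using D' apply simp
    apply (simp add: hT(1)[simplified] star_ac add.commute)
    done
  have at99: "asafe w' D' E (QFix ?T) 99 rs'
     (cell a 1 (NodeV (addr_of u)) ** tree (s + 20) u ** cell a 0 (NodeV (addr_of l)) ** tree (s + 20) l **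
      cell a 2 v2 ** cell a 3 v3 ** cell a 4 v4 ** cell_any a 5)"
    if k: "consts_ok M rs'" "rs' 1 = NodeV a" "rs' 6 = NodeV (addr_of l)" "rs' 7 = NodeV (addr_of u)"
      and D': "D' \<le> \<sigma> + 28" and w': "w \<le> w' + 10" for rs' D' w' v2 v3 v4
    apply (rule asafe_fork[where ?A1.0 = "tree (s + 20) l" and ?A2.0 = "cell a 1 (NodeV (addr_of u)) **
        tree (s + 20) u ** cell a 0 (NodeV (addr_of l)) ** cell a 2 v2 ** cell a 3 v3 ** cell a 4 v4 ** cell_any a 5"
        and E' = El and q' = "QFix l" and ?w1.0 = "50 * sz l - 38" and ?w2.0 = "50 * sz u - 13"],
        simp, simp add: prog_def)
    apply (simp only: star_ac ent_refl)
    using E apply simp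
    using w w' n apply linarith
    subgoal
      apply (rule step, simp, simp add: prog_def, use n in simp, simp add: k)
      apply (rule step, simp, simp add: prog_def, use n in simp, simp add: k)
      apply (rule asafe_mono[OF left _ order_refl])
      using k D' n by (simp_all add: consts_ok_def)
    subgoal for tl
      apply (rule asafe_fork[where ?A1.0 = "tree (s + 20) u" and ?A2.0 = "hdl tl El (QFix l) ** cell a 1 (NodeV (addr_of u)) **
          cell a 0 (NodeV (addr_of l)) ** cell a 2 v2 ** cell a 3 v3 ** cell a 4 v4 ** cell_any a 5"
          and E' = Eu and q' = "QFix u" and ?w1.0 = "50 * sz u - 38" and ?w2.0 = 20],
          simp, simp add: prog_def)
      apply (simp only: star_ac ent_refl)
      using E apply simp
      using n apply linarith
      subgoal
        apply (rule step, simp, simp add: prog_def, use n in simp, simp add: k)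
        apply (rule step, simp, simp add: prog_def, use n in simp, simp add: k)
        apply (rule asafe_mono[OF right _ order_refl])
        using k D' n by (simp_all add: consts_ok_def)
      subgoal for tu
        apply (rule step, simp, simp add: prog_def, use E in simp, simp add: k)
        apply (rule exI, rule exI, rule exI_conjI, ((rule rem_here | rule rem_skip)+)[1])
        apply (rule conjI, use E in simp)
        apply (rule conjI, use E D' in simp)
        apply (simp only: star_assoc post.simps simp_thms)
        apply (rule step, simp, simp add: prog_def, use E in simp, simp add: k)
        apply (rule exI, rule exI, rule exI_conjI, ((rule rem_here | rule rem_skip)+)[1])
        apply (rule conjI, use E in simp)
        apply (rule conjI, use E D' in simp)
        apply (simp only: star_assoc post.simps simp_thms)
        apply (rule step, simp, simp add: prog_def, use E in simp, simp add: k)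
        apply (rule exI_conjI, ((rule has_left[OF has_batch(1)] | rule has_skip)+)[1])
        apply (rule step, simp, simp add: prog_def, use E in simp, simp add: k)
        apply (rule exI_conjI, ((rule has_left[OF has_batch(1)] | rule has_skip)+)[1])
        apply (cases "ht u < ht l")
        apply (rule step, simp, simp add: prog_def, use E in simp, simp add: k)
        apply (rule asafe_ent[OF _ at107[where ?v2.0 = v2 and ?v3.0 = v3 and ?v4.0 = v4]])
        apply (simp only: star_ac ent_refl)
        apply (use k E D' in \<open>simp_all add: m_def consts_ok_def\<close>)
        apply (rule step, simp, simp add: prog_def, use E in simp, simp add: k)
        apply (rule step, simp, simp add: prog_def, use E in simp, simp add: k)
        apply (rule asafe_ent[OF _ at107[where ?v2.0 = v2 and ?v3.0 = v3 and ?v4.0 = v4]])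
        apply (simp only: star_ac ent_refl)
        apply (use k E D' in \<open>simp_all add: m_def consts_ok_def\<close>)
        done
      done
    done
  have start: "asafe w D E (QFix ?T) 89 rs (cell a 3 tv ** tfut a 0 (s + 20) l tv **
     cell a 4 tw ** tfut a 1 (s + 20) u tw ** cell a 2 (IntV (int r)) ** cell_any a 5)" for tv tw
    apply (rule step, simp, simp add: prog_def, use w60 in simp, simp add: c' R)
    apply (rule exI_conjI, ((rule has_here has_last | rule has_skip)+)[1])
    apply (rule step, simp, simp add: prog_def, use w60 in simp, simp add: c' R r0)
    apply (rule step, simp, simp add: prog_def, use w60 in simp, simp add: c' R)
    apply (rule exI_conjI, ((rule has_here has_last | rule has_skip)+)[1])
    apply (rule asafe_ent[of _ "tfut a 0 (s + 20) l tv ** cell a 3 tv **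
     cell a 4 tw ** tfut a 1 (s + 20) u tw ** cell a 2 (IntV (int r)) ** cell_any a 5"])
    apply (simp only: star_ac ent_refl)
    apply (rule await[where ?pc1.0 = 93 and ?pc2.0 = 94 and ?pc3.0 = 95],
       simp, simp add: prog_def, simp add: prog_def, simp add: prog_def, simp, simp, simp)
    apply (simp_all only: c' R fun_upd_apply)
    apply simp_all
    using t E apply simp
    using t E apply simp
    using w60 apply simp
    apply (rule step, simp, simp add: prog_def, use w60 in simp, simp add: c' R)
    apply (rule exI_conjI, ((rule has_here has_last | rule has_skip)+)[1])
    apply (rule asafe_ent[of _ "tfut a 1 (s + 20) u tw ** cell a 0 (NodeV (addr_of l)) **
     tree (s + 20) l ** cell a 2 (IntV (int r)) ** cell a 3 tv ** cell a 4 tw ** cell_any a 5"])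
    apply (simp only: star_ac ent_refl)
    apply (rule await[where ?pc1.0 = 97 and ?pc2.0 = 98 and ?pc3.0 = 99],
       simp, simp add: prog_def, simp add: prog_def, simp add: prog_def, simp, simp, simp)
    apply (simp_all only: c' R fun_upd_apply)
    apply simp_all
    using t E apply simp
    using t E apply simp
    using w60 apply simp
    apply (rule at99)
    using t E w60 by (simp_all add: consts_ok_def c' R)
  have open1: "asafe w D E (QFix ?T) 89 rs (tslot a 1 (s + 20) u ** cell a 3 tv **
     tfut a 0 (s + 20) l tv ** cell a 2 (IntV (int r)) ** cell_any a 5)" for tv
    apply (rule asafe_slot)
    subgoal for tw
      by (rule asafe_ent[OF _ start[of tv tw]]) (simp add: star_ac)
    done
  have "asafe w D E (QFix ?T) 89 rs (tslot a 0 (s + 20) l **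
     tslot a 1 (s + 20) u ** cell a 2 (IntV (int r)) ** cell_any a 5)"
    apply (rule asafe_slot)
    subgoal for tv
      by (rule asafe_ent[OF _ open1[of tv]]) (simp add: star_ac)
    done
  moreover have "tree s ?T = tslot a 0 (s + 20) l **
     tslot a 1 (s + 20) u ** cell a 2 (IntV (int r)) ** cell_any a 5"
    unfolding tree_def[of s ?T] addr_of.simps prio.simps trest_PN by (simp only: star_ac)
  ultimately show ?case unfolding E_def by simp
qed

section \<open>The main thread\<close>

lemma main_loop:
  assumes "rs 14 = IntV 2" "rs 8 = IntV (int n)" "rs 3 = IntV (2 ^ j)" "j \<le> h" "n \<le> 2 ^ h"
    "\<And>k. k < h \<Longrightarrow> 2 ^ k < n" "3 * (h - j) + 2 \<le> w"
    and "\<And>rs'. (\<And>k. k \<noteq> 3 \<Longrightarrow> rs' k = rs k) \<Longrightarrow> rs' 3 = IntV (2 ^ h) \<Longrightarrow>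
      asafe (w - (3 * (h - j) + 2)) (D + 3 * (h - j) + 2) E q 9 rs' A"
  shows "asafe w D E q 5 rs A"
  using assms
proof (induction "h - j" arbitrary: j rs w D)
  case 0
  then have j: "j = h" by simp
  have le: "\<not> 2 ^ h < n" using 0(6) by simp
  note A = 0(2-4) 0(8)
  show ?case
    apply (rule step, simp, simp add: prog_def, use A in simp, simp add: A j le)
    apply (rule step, simp, simp add: prog_def, use A in simp, simp add: A j)
    apply (rule asafe_mono)
    apply (rule 0(9))
    using A j by auto
next
  case (Suc x)
  then have j: "j < h" by simp
  note lt = Suc(8)[OF j]
  note A = Suc(3-5) Suc(9)
  have e: "h - j = Suc (h - Suc j)" using j by simp
  show ?case
    apply (rule step, simp, simp add: prog_def, use A e in simp, simp add: A lt)
    apply (rule step, simp, simp add: prog_def, use A e in simp, simp add: A lt)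
    apply (rule step, simp, simp add: prog_def, use A e in simp, simp add: A lt)
    apply (rule Suc(1)[where j = "Suc j"])
    using Suc(2) apply simp
    using A apply simp
    using A apply simp
    using A apply (simp add: mult.commute)
    using j apply simp
    using Suc(7) apply simp
    using Suc(8) apply simp
    using A e apply simp
    apply (rule asafe_mono)
    apply (rule Suc(10))
    using e by auto
qed

lemma fresh_ent: "0 < K \<Longrightarrow> (\<lambda>h. h = fresh_cells K a) \<turnstile> cell a 0 NullV ** (\<lambda>_. True)"
  unfolding ent_def star_def cell_def
  by (intro allI impI exI[of _ "[Cell a 0 \<mapsto> Val NullV]"] exI[of _ "(fresh_cells K a)(Cell a 0 := None)"])
     (auto simp: fresh_cells_def map_add_def fun_eq_iff split: option.splits)

lemma star_true: "(A ** C) h \<Longrightarrow> (A ** (\<lambda>_. True)) h"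
  unfolding star_def by blast

lemma main_ok:
  assumes K: "0 < K" and goal: "goal = build M g 0" and h: "2 ^ h = sz g + M" "\<And>k. k < h \<Longrightarrow> 2 ^ k < sz g"
    and B: "8 * h + 104 * ht g + 300 \<le> B"
  shows "asafe (build_work g 0 + 50 * sz g + 3 * h + 60) 0 B (QMain goal) 0
    ((\<lambda>_. NullV)(0 := NodeV (addr_of g))) (batch g)"
proof -
  \<comment> \<open>\<open>8 * h\<close> is \<open>3 * h\<close> for finding the power of two and
    \<open>5 * h\<close> for the longest priority loop; \<open>20 * ht g\<close> is the descent of
    the build.\<close>
  define s where "s = 8 * h + 20 * ht g + 60"
  define E where "E = s + 20 * (ht g + 1)"
  define F where "F = E + 10 + 64 * ht goal + 40"
  have hg: "ht goal \<le> ht g + 2" unfolding goal by (rule build_height)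
  have EF: "E + 20 * (ht g + 2) \<le> B" "F + 10 \<le> B" "E + 30 \<le> B" "3 * h + 40 \<le> B"
    using hg B unfolding E_def F_def s_def by auto
  have szg: "sz goal = sz g" unfolding goal using build_cart by simp
  have cg: "cart M goal 0" unfolding goal using build_cart by blast
  \<comment> \<open>Positions of splits are at most \<open>2 ^ h\<close>, so no priority loop
    exceeds \<open>h\<close> rounds.\<close>
  have L: "val2 M p \<le> h" if "0 < p" "p < sz g" for p
  proof -
    have "2 ^ val2 M p dvd vpos M p" using dvd_val2[OF that(1)] by blast
    then have "2 ^ val2 M p \<le> vpos M p" using pos_pos[of M p] that by (intro dvd_imp_le) auto
    also have "\<dots> \<le> 2 ^ h" unfolding h(1) vpos_def using that by auto
    finally show ?thesis by simp
  qed
  have sub: "int (2 ^ h) - int (sz g) = int M" unfolding h(1) by simp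
  have fixp: "asafe w' D' F (QFix goal) 89 rs' (tree E goal)"
    if "consts_ok M rs'" "rs' 1 = NodeV (addr_of goal)" "D' \<le> E + 10" "50 * sz g \<le> w'" for rs' D' w'
    unfolding F_def by (rule fix_ok[OF cg]) (use that EF szg F_def in simp_all)
  have buildp: "asafe w' D' E (QSlot d 0 E goal) 21 rs' (cell_any d 0 ** batch g)"
    if "consts_ok M rs'" "rs' 1 = NodeV (addr_of g)" "rs' 2 = IntV 0" "rs' 4 = NodeV d" "rs' 5 = IntV 0"
      "D' \<le> 3 * h + 20" "build_work g 0 \<le> w'" for rs' D' d w'
    unfolding E_def goal by (rule build_ok[where L = h]) (use that EF L in \<open>simp_all add: E_def s_def\<close>)
  let ?w = "build_work g 0 + 50 * sz g"
  have at9: "asafe w' D' B (QMain goal) 9 rs' (batch g)"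
    if k: "rs' 0 = NodeV (addr_of g)" "rs' 3 = IntV (2 ^ h)" "rs' 8 = IntV (int (sz g))" "rs' 12 = NullV"
      "rs' 13 = IntV 0" "rs' 14 = IntV 2" "rs' 15 = IntV 1"
      and D': "D' \<le> 3 * h + 10" and w': "?w + 30 \<le> w'" for rs' D' w'
    apply (rule step, simp, simp add: prog_def, use w' in simp, simp add: k sub[simplified])
    apply (rule step, simp, simp add: prog_def, use w' in simp, simp add: k)
    apply (rule conjI, use D' EF in simp)
    apply (rule allI)
    subgoal for d
      apply (rule asafe_ent[of _ "cell d 0 NullV ** batch g ** (\<lambda>_. True)"])
      apply (rule ent_trans[OF ent_star[OF ent_refl fresh_ent[OF K]]])
      apply (simp add: star_ac)
      apply (rule step, simp, simp add: prog_def, use w' in simp, simp add: k)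
      apply (rule step, simp, simp add: prog_def, use w' in simp, simp add: k)
      apply (rule step, simp, simp add: prog_def, use w' in simp, simp add: k)
      apply (rule asafe_fork[where ?A1.0 = "cell_any d 0 ** batch g" and ?A2.0 = "\<lambda>_. True"
          and E' = E and q' = "QSlot d 0 E goal" and ?w1.0 = "build_work g 0" and ?w2.0 = "50 * sz g + 12"],
          simp, simp add: prog_def)
      apply (simp only: star_assoc)
      apply (rule ent_star[OF cell_ent_any ent_refl])
      using EF apply simp
      using w' apply simp
      apply (rule buildp)
      apply (use k in \<open>simp add: consts_ok_def\<close>)
      apply (simp_all add: k)
      using D' apply simp
      subgoal for tb
        apply (rule step, simp, simp add: prog_def, use w' in simp, simp add: k)
        apply (rule exI, rule exI, rule exI_conjI, ((rule rem_here | rule rem_skip)+)[1])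
        apply (rule conjI, use EF in simp)
        apply (rule conjI, use EF D' in simp)
        apply (simp only: star_assoc post.simps simp_thms)
        apply (rule step, simp, simp add: prog_def, use w' in simp, simp add: k)
        apply (rule exI_conjI, ((rule has_here has_last | rule has_skip)+)[1])
        apply (rule step, simp, simp add: prog_def, use w' in simp, simp add: k)
        apply (rule asafe_fork[where ?A1.0 = "tree E goal" and ?A2.0 = "cell d 0 (NodeV (addr_of goal)) ** (\<lambda>_. True)"
            and E' = F and q' = "QFix goal" and ?w1.0 = "50 * sz g" and ?w2.0 = 5],
            simp, simp add: prog_def)
        apply (simp only: star_ac ent_refl)
        using EF apply simp
        using w' apply simp
        apply (rule fixp)
        apply (use k in \<open>simp add: consts_ok_def\<close>)
        apply simp
        using D' E_def s_def apply simp
        apply simp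
        subgoal for tf
          apply (rule step, simp, simp add: prog_def, use w' in simp, simp add: k)
          apply (rule exI, rule exI, rule exI_conjI, ((rule rem_here | rule rem_skip)+)[1])
          apply (rule conjI, use EF in simp)
          apply (rule conjI, use EF D' in simp)
          apply (simp only: star_assoc post.simps simp_thms)
          apply (rule step, simp, simp add: prog_def, use w' in simp, simp add: k)
          apply (rule conjI, use EF D' in simp)
          apply (simp add: ent_def)
          apply (intro allI impI)
          apply (erule star_true)
          done
        done
      done
    done
  have five: "Suc (Suc (Suc (Suc (Suc 0)))) = 5" by simp
  show ?thesis
    apply (rule step, simp, simp add: prog_def, simp, simp)
    apply (rule step, simp, simp add: prog_def, simp, simp)
    apply (rule step, simp, simp add: prog_def, simp, simp)
    apply (rule step, simp, simp add: prog_def, simp, simp)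
    apply (rule exI_conjI, rule has_batch)
    apply (rule step, simp, simp add: prog_def, simp, simp)
    apply (simp only: five)
    apply (rule main_loop[where j = 0 and h = h and n = "sz g"])
    using h apply simp_all
    apply (rule at9)
    by simp_all
qed

end

section \<open>Stored batches and the bounds\<close>

text \<open>Height at most twice the logarithm, avoiding Fibonacci numbers. If \<open>x\<close> and
  \<open>y\<close> are the sizes and \<open>a\<close> is the larger height, balance gives
  \<open>2 ^ a\<close> at most both \<open>x ^ 2\<close> and \<open>2 * y ^ 2\<close>, hence at most
  \<open>2 * x * y\<close>; so \<open>2 ^ (a + 1)\<close> is at most
  \<open>x ^ 2 + 2 * x * y\<close>. The other case is symmetric.\<close>

lemma bbt_height_le_size: "bbt t \<Longrightarrow> 2 ^ height t \<le> length (items t) ^ 2"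
proof (induction t)
  case (Leaf x)
  then show ?case by simp
next
  case (Branch l r)
  have main: "2 ^ Suc (max a b) \<le> (x + y) ^ 2"
    if h: "2 ^ a \<le> x ^ 2" "2 ^ b \<le> y ^ 2" "a \<le> Suc b" "b \<le> a" for a b x y :: nat
  proof -
    have *: "(2 ^ a :: nat) \<le> 2 * 2 ^ b" using h(3) by (metis power_Suc power_increasing one_le_numeral)
    have "(2 ^ a) ^ 2 \<le> (2 ^ a :: nat) * (2 * 2 ^ b)" using * by (simp add: power2_eq_square)
    also have "\<dots> \<le> x ^ 2 * (2 * y ^ 2)" using h(1,2) by (intro mult_mono) auto
    also have "\<dots> \<le> (2 * (x * y)) ^ 2" by (simp add: power_mult_distrib)
    finally have "2 ^ a \<le> 2 * (x * y)" by (rule power2_le_imp_le) simp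
    moreover have "2 ^ max a b = (2 ^ a :: nat)" using h(4) by (simp add: max_def)
    ultimately show ?thesis using h(1) by (simp add: power2_eq_square algebra_simps)
  qed
  show ?case
  proof (cases "height r \<le> height l")
    case True
    then show ?thesis using main[of "height l" "length (items l)" "height r" "length (items r)"] Branch by simp
  next
    case False
    then show ?thesis using main[of "height r" "length (items r)" "height l" "length (items l)"] Branch
      by (simp add: max.commute add.commute)
  qed
qed

text \<open>Heights sum to a linear amount in a balanced tree. The potentials
  \<open>20 * ht + 160\<close> of the subtrees pay for the work at their parent and leave its own
  potential, since balance gives \<open>2 * H \<le> hl + hu + 3\<close>; 160 is the value at which
  this just balances.\<close>

lemma build_work_arith:
  fixes x y v H n S hl nl Sl hu nu Su :: nat
  assumes "x + 20 * hl + 160 \<le> 200 * nl + 5 * Sl" "y + 20 * hu + 160 \<le> 200 * nu + 5 * Su"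
    "2 * H \<le> hl + hu + 3" "n = nl + nu" "S = v + (Sl + Su)"
  shows "x + y + 60 + 5 * v + 20 * (H + 2) + 20 * H + 160 \<le> 200 * n + 5 * S"
  using assms by simp

lemma (in rebalance) build_work_bound:
  "bbt (erase T) \<Longrightarrow>
     build_work T i + 20 * ht T + 160 \<le> 200 * sz T + 5 * (\<Sum>p = Suc i..<i + sz T. val2 M p)"
proof (induction T arbitrary: i)
  case (PL a x)
  then show ?case by simp
next
  case (PN a h l u)
  let ?p = "i + sz l"
  obtain x y where "sz l = Suc x" "sz u = Suc y"
    using sz_pos[of l] sz_pos[of u] by (metis gr0_conv_Suc)
  then have "{Suc i..<i + sz (PN a h l u)} = insert ?p ({Suc i..<?p} \<union> {Suc ?p..<?p + sz u})"
    by auto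
  moreover have "?p \<notin> {Suc i..<?p} \<union> {Suc ?p..<?p + sz u}" "{Suc i..<?p} \<inter> {Suc ?p..<?p + sz u} = {}"
    by auto
  ultimately have sum: "(\<Sum>p = Suc i..<i + sz (PN a h l u). val2 M p) = val2 M ?p +
      ((\<Sum>p = Suc i..<?p. val2 M p) + (\<Sum>p = Suc ?p..<?p + sz u. val2 M p))"
    by (simp add: sum.union_disjoint)
  have b: "bbt (erase l)" "bbt (erase u)" using PN.prems by auto
  show ?case
    unfolding build_work.simps
    by (rule build_work_arith[OF PN.IH(1)[OF b(1), of i] PN.IH(2)[OF b(2), of ?p] _ sz_PN sum])
       (use PN.prems in auto)
qed

section \<open>Conversion between stored batches and owned resources\<close>

lemma star_cell_intro: "X h \<Longrightarrow> h (Cell a c) = None \<Longrightarrow> (cell a c v ** X) (h(Cell a c \<mapsto> Val v))"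
  unfolding star_def cell_def
  by (intro exI[of _ "[Cell a c \<mapsto> Val v]"] exI[of _ h])
     (auto simp: map_add_def fun_eq_iff split: option.splits)

lemma star_cell_elim:
  assumes "(cell a c v ** X) h"
  obtains h' where "h = h'(Cell a c \<mapsto> Val v)" "h' (Cell a c) = None" "X h'"
proof -
  obtain h' where h: "h = [Cell a c \<mapsto> Val v] ++ h'" "Cell a c \<notin> dom h'" "X h'"
    using assms unfolding star_def cell_def by auto
  then have "h = h'(Cell a c \<mapsto> Val v)" by (auto simp: map_add_def fun_eq_iff split: option.splits)
  with h that[of h'] show ?thesis by (simp add: domIff)
qed

definition submem :: "'q res \<Rightarrow> memory \<Rightarrow> bool" where
  "submem h m \<longleftrightarrow> (\<forall>k x. h k = Some x \<longrightarrow>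
     (\<exists>a c cs. k = Cell a c \<and> m a = Some cs \<and> c < length cs \<and> x = Val (cs ! c)))"

lemma submem_upd:
  "submem h m \<Longrightarrow> m a = Some cs \<Longrightarrow> c < length cs \<Longrightarrow> cs ! c = x \<Longrightarrow> submem (h(Cell a c \<mapsto> Val x)) m"
  unfolding submem_def by auto

text \<open>The bound of the owned addresses by \<open>A\<close> makes the induction work: disjoint
  address sets of the subtrees give disjoint resources.\<close>

lemma stored_batch:
  assumes "stored m a t A"
  shows "\<exists>g h. addr_of g = a \<and> erase g = t \<and> batch g h \<and> submem h m \<and> (\<forall>b c. h (Cell b c) \<noteq> None \<longrightarrow> b \<in> A)"
  using assms
proof (induction t arbitrary: a A)
  case (Leaf x)
  let ?h = "Map.empty(Cell a 5 \<mapsto> Val x, Cell a 4 \<mapsto> Val x, Cell a 3 \<mapsto> Val (IntV 1), Cell a 1 \<mapsto> Val NullV,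
    Cell a 0 \<mapsto> Val NullV, Cell a 2 \<mapsto> Val (IntV 0)) :: spec res"
  \<comment> \<open>An empty last conjunct makes the introduction rule apply to the last cell as
    well.\<close>
  have e: "cell a 5 x = cell a 5 x ** (\<lambda>h :: spec res. h = Map.empty)"
    by (rule ext) (auto simp: star_def)
  have "batch (PL a x) ?h"
    unfolding batch.simps by (subst e, intro star_cell_intro) auto
  moreover obtain rest where ma: "m a = Some ([NullV, NullV, IntV 0, IntV 1, x, x] @ rest)" and "A = {a}"
    using Leaf unfolding stored.simps tree_node_def by auto
  have "submem ?h m" by (intro submem_upd[of _ m a, OF _ ma]) (simp_all add: submem_def)
  moreover have "\<forall>b c. ?h (Cell b c) \<noteq> None \<longrightarrow> b \<in> A" using \<open>A = {a}\<close> by auto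
  ultimately show ?case
    by (intro exI[of _ "PL a x"] exI[of _ ?h] conjI) (simp_all only: addr_of.simps erase.simps)
next
  case (Branch l r)
  obtain b c B C where s: "tree_node m a (NodeV b) (NodeV c) (Branch l r)" "stored m b l B" "stored m c r C"
    "B \<inter> C = {}" "a \<notin> B \<union> C" "A = insert a (B \<union> C)"
    using Branch.prems by auto
  obtain gl hl where l: "addr_of gl = b" "erase gl = l" "batch gl hl" "submem hl m" "\<And>b c. hl (Cell b c) \<noteq> None \<Longrightarrow> b \<in> B"
    using Branch.IH(1)[OF s(2)] by blast
  obtain gr hr where r: "addr_of gr = c" "erase gr = r" "batch gr hr" "submem hr m" "\<And>b c. hr (Cell b c) \<noteq> None \<Longrightarrow> b \<in> C"
    using Branch.IH(2)[OF s(3)] by blast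
  \<comment> \<open>An input batch determines no priorities; 0 is an arbitrary choice.\<close>
  let ?T = "PN a 0 gl gr"
  define h0 where "h0 = hl ++ hr"
  have dj: "dom hl \<inter> dom hr = {}"
  proof (rule ccontr)
    assume "dom hl \<inter> dom hr \<noteq> {}"
    then obtain k where k: "hl k \<noteq> None" "hr k \<noteq> None" by auto
    then obtain d e where "k = Cell d e" using l(4) unfolding submem_def by blast
    then show False using k l(5) r(5) s(4) by blast
  qed
  have b0: "(batch gl ** batch gr) h0" unfolding star_def h0_def using dj l(3) r(3) by blast
  have sub0: "submem h0 m" using l(4) r(4) unfolding submem_def h0_def by (auto simp: map_add_Some_iff)
  have in0: "d \<in> B \<union> C" if "h0 (Cell d e) \<noteq> None" for d e
  proof -
    have "hl (Cell d e) \<noteq> None \<or> hr (Cell d e) \<noteq> None"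
      using that unfolding h0_def by (auto simp: map_add_def split: option.splits)
    then show ?thesis using l(5) r(5) by blast
  qed
  have na: "h0 (Cell a e) = None" for e using in0[of a e] s(5) by blast
  let ?h = "h0(Cell a 5 \<mapsto> Val (last (items (erase ?T))), Cell a 4 \<mapsto> Val (hd (items (erase ?T))),
    Cell a 3 \<mapsto> Val (IntV (int (sz ?T))), Cell a 1 \<mapsto> Val (NodeV (addr_of gr)),
    Cell a 0 \<mapsto> Val (NodeV (addr_of gl)), Cell a 2 \<mapsto> Val (IntV (int (ht ?T))))"
  have "batch ?T ?h"
    unfolding batch.simps by (intro star_cell_intro b0) (auto simp: na)
  moreover obtain rest where ma: "m a = Some ([NodeV b, NodeV c, IntV (int (height (Branch l r))),
      IntV (int (length (items (Branch l r)))), hd (items (Branch l r)), last (items (Branch l r))] @ rest)"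
    using s(1) unfolding tree_node_def by auto
  have "submem ?h m" by (intro submem_upd[of _ m a, OF _ ma]) (use sub0 l(1,2) r(1,2) in simp_all)
  moreover have "\<forall>b c. ?h (Cell b c) \<noteq> None \<longrightarrow> b \<in> A" using s(6) in0 by (auto split: if_splits)
  ultimately show ?case
    by (intro exI[of _ ?T] exI[of _ ?h] conjI) (simp_all only: addr_of.simps erase.simps l r)
qed

lemma list6: "5 < length cs \<Longrightarrow> cs = [cs ! 0, cs ! 1, cs ! 2, cs ! 3, cs ! 4, cs ! 5] @ drop 6 cs"
proof (rule nth_equalityI)
  fix i assume "5 < length cs" "i < length cs"
  moreover have "i = 0 \<or> i = 1 \<or> i = 2 \<or> i = 3 \<or> i = 4 \<or> i = 5 \<or> 6 \<le> i" by linarith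
  ultimately show "cs ! i = ([cs ! 0, cs ! 1, cs ! 2, cs ! 3, cs ! 4, cs ! 5] @ drop 6 cs) ! i"
    by (elim disjE) (auto simp: nth_append)
qed simp

text \<open>Every tree node owns its own cell 0, so the set of nodes can be read off the
  resource.\<close>

lemma batch_stored:
  assumes "batch T h" "\<And>a c x. h (Cell a c) = Some x \<Longrightarrow> \<exists>cs. m a = Some cs \<and> c < length cs \<and> x = Val (cs ! c)"
  shows "stored m (addr_of T) (erase T) {b. h (Cell b 0) \<noteq> None}"
  using assms
proof (induction T arbitrary: h)
  case (PL a x)
  obtain h' where h: "h = h'(Cell a 5 \<mapsto> Val x, Cell a 4 \<mapsto> Val x, Cell a 3 \<mapsto> Val (IntV 1), Cell a 1 \<mapsto> Val NullV,
    Cell a 0 \<mapsto> Val NullV, Cell a 2 \<mapsto> Val (IntV 0))" "h' = Map.empty"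
    using PL(1) unfolding batch.simps
    by (elim star_cell_elim) (auto simp: cell_def)
  obtain cs where cs: "m a = Some cs" "5 < length cs" "x = cs ! 5" using PL(2)[of a 5 "Val x"] h by auto
  have v: "cs ! 0 = NullV" "cs ! 1 = NullV" "cs ! 2 = IntV 0" "cs ! 3 = IntV 1" "cs ! 4 = x"
    using PL(2)[of a 0] PL(2)[of a 1] PL(2)[of a 2] PL(2)[of a 3] PL(2)[of a 4] h cs by auto
  have "tree_node m a NullV NullV (Leaf x)"
    unfolding tree_node_def using list6[OF cs(2)] cs v by (intro exI[of _ "drop 6 cs"]) simp
  moreover have "{b. h (Cell b 0) \<noteq> None} = {a}" unfolding h by auto
  ultimately show ?case by simp
next
  case (PN a p l u)
  let ?T = "PN a p l u"
  obtain h0 where h: "h = h0(Cell a 5 \<mapsto> Val (last (items (erase ?T))), Cell a 4 \<mapsto> Val (hd (items (erase ?T))),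
    Cell a 3 \<mapsto> Val (IntV (int (sz ?T))), Cell a 1 \<mapsto> Val (NodeV (addr_of u)),
    Cell a 0 \<mapsto> Val (NodeV (addr_of l)), Cell a 2 \<mapsto> Val (IntV (int (ht ?T))))"
    "h0 (Cell a 0) = None" and b0: "(batch l ** batch u) h0"
    "h0 (Cell a 1) = None" "h0 (Cell a 2) = None" "h0 (Cell a 3) = None" "h0 (Cell a 4) = None" "h0 (Cell a 5) = None"
    using PN.prems(1) unfolding batch.simps by (elim star_cell_elim) auto
  obtain hl hu where hlu: "h0 = hl ++ hu" "dom hl \<inter> dom hu = {}" "batch l hl" "batch u hu"
    using b0 unfolding star_def by blast
  have up: "h k = Some x" if "h0 k = Some x" for k x using that h b0 by auto
  have sub: "h0 k = Some x" if "hl k = Some x \<or> hu k = Some x" for k x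
    using that hlu(1,2) by (auto simp: map_add_def split: option.splits)
  have l: "stored m (addr_of l) (erase l) {b. hl (Cell b 0) \<noteq> None}"
    by (rule PN.IH(1)[OF hlu(3)]) (use PN.prems(2) up sub in blast)
  have u: "stored m (addr_of u) (erase u) {b. hu (Cell b 0) \<noteq> None}"
    by (rule PN.IH(2)[OF hlu(4)]) (use PN.prems(2) up sub in blast)
  let ?L = "{b. hl (Cell b 0) \<noteq> None}" and ?U = "{b. hu (Cell b 0) \<noteq> None}"
  have "?L \<inter> ?U = {}" using hlu(2) by auto
  moreover have "hl (Cell a 0) = None" "hu (Cell a 0) = None" using h(2) sub by (metis not_Some_eq)+
  then have "a \<notin> ?L \<union> ?U" by simp
  moreover have "{b. h (Cell b 0) \<noteq> None} = insert a (?L \<union> ?U)"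
    unfolding h(1) hlu(1) by (auto simp: map_add_def split: option.splits)
  moreover obtain cs where cs: "m a = Some cs" "5 < length cs" "cs ! 5 = last (items (erase ?T))"
    using PN.prems(2)[of a 5 "Val (last (items (erase ?T)))"] h by auto
  have v: "cs ! 0 = NodeV (addr_of l)" "cs ! 1 = NodeV (addr_of u)" "cs ! 2 = IntV (int (ht ?T))"
    "cs ! 3 = IntV (int (sz ?T))" "cs ! 4 = hd (items (erase ?T))"
    using PN.prems(2)[of a 0] PN.prems(2)[of a 1] PN.prems(2)[of a 2] PN.prems(2)[of a 3] PN.prems(2)[of a 4]
      h(1) cs(1) by auto
  have "tree_node m a (NodeV (addr_of l)) (NodeV (addr_of u)) (erase ?T)"
    unfolding tree_node_def using list6[OF cs(2)] cs(1,3) v by (intro exI[of _ "drop 6 cs"]) simp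
  ultimately show ?case using l u unfolding addr_of.simps erase.simps stored.simps by blast
qed

section \<open>Instantiation and the constants of the bounds\<close>

lemma rebalance_computes:
  assumes K: "6 \<le> K" and m: "wf_memory K m" and b: "batch_at m v t"
  shows "computes_within K prog (initial m v)
     (\<lambda>m' v'. \<exists>t'. batch_at m' v' t' \<and> complete_btree t' \<and> items t' = items t)
     (400 * real (length (items t))) (220 * log 2 (real (length (items t))) + 320)"
proof -
  obtain a A where v: "v = NodeV a" "stored m a t A" and bt: "bbt t" using b unfolding batch_at_def by blast
  obtain g h where g: "addr_of g = a" "erase g = t" "batch g h" "submem h m"
    using stored_batch[OF v(2)] by blast
  define n where "n = sz g"
  have n0: "0 < n" unfolding n_def using sz_pos .
  define e where "e = (LEAST e. n \<le> 2 ^ e)"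
  have "n \<le> 2 ^ n" by (simp add: less_imp_le)
  then have e1: "n \<le> 2 ^ e" unfolding e_def by (rule LeastI)
  have e2: "2 ^ k < n" if "k < e" for k using not_less_Least[OF that[unfolded e_def]] by simp
  \<comment> \<open>Minimality of \<open>e\<close> keeps the grid below twice the number of items,
    hence \<open>M < n\<close>; for \<open>e = 0\<close> it follows from \<open>n0\<close>.\<close>
  have e3: "2 ^ e < 2 * n" using e2[of "e - 1"] n0 by (cases e) auto
  define M where "M = 2 ^ e - n"
  have M: "2 ^ e = n + M" "M < n" unfolding M_def using e1 e3 by auto
  define B where "B = 8 * e + 104 * ht g + 300"
  define goal where "goal = build M g 0"
  interpret rebalance K B M goal .
  define W where "W = build_work g 0 + 50 * n + 3 * e + 60"
  have "asafe W 0 B (QMain goal) 0 ((\<lambda>_. NullV)(0 := NodeV (addr_of g))) (batch g)"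
    unfolding W_def n_def
    by (rule main_ok[OF _ goal_def]) (use K M e2 in \<open>auto simp: B_def n_def\<close>)
  then have sf: "safe W 0 B (QMain goal) 0 ((\<lambda>_. NullV)(0 := v)) h"
    using g v unfolding asafe_def by simp
  have "computes_within K prog (initial m v)
     (\<lambda>m' v'. \<exists>t'. batch_at m' v' t' \<and> complete_btree t' \<and> items t' = items t) (real W) (real B)"
  proof (rule adequacy[OF sf order_refl m])
    show "\<exists>a c cs. k = Cell a c \<and> m a = Some cs \<and> c < length cs \<and> x = Val (cs ! c)"
      if "h k = Some x" for k x using g(4) that unfolding submem_def by blast
    fix m' rs h'
    assume p: "post (QMain goal) rs h'"
      and hm: "\<And>a c x. h' (Cell a c) = Some x \<Longrightarrow> \<exists>cs. m' a = Some cs \<and> c < length cs \<and> x = Val (cs ! c)"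
    obtain h1 h2 where h': "h' = h1 ++ h2" "dom h1 \<inter> dom h2 = {}" "batch goal h1" and r: "rs 0 = NodeV (addr_of goal)"
      using p unfolding post.simps star_def by blast
    have "h' k = Some x" if "h1 k = Some x" for k x
      using that h'(1,2) by (auto simp: map_add_def split: option.splits)
    then have "stored m' (addr_of goal) (erase goal) {b. h1 (Cell b 0) \<noteq> None}"
      using batch_stored[OF h'(3)] hm by blast
    moreover have "bbt (erase goal)" "complete_btree (erase goal)"
      unfolding goal_def using complete_build[of g e M] e1 M unfolding n_def by blast+
    moreover have "items (erase goal) = items t" unfolding goal_def using build_cart g(2) by simp
    ultimately show "\<exists>t'. batch_at m' (rs 0) t' \<and> complete_btree t' \<and> items t' = items t"
      unfolding batch_at_def r by blast
  qed
  moreover have "real W \<le> 400 * real (length (items t))"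
  proof -
    have "(\<Sum>p = Suc 0..<0 + n. val2 M p) \<le> 2 ^ e" using sum_val2[of n M e, unfolded One_nat_def] M n0 by simp
    moreover have "e \<le> n"
    proof (rule ccontr)
      assume "\<not> e \<le> n"
      then have "2 ^ n < n" using e2 by simp
      then show False using less_exp[of n] by simp
    qed
    moreover have "build_work g 0 + 20 * ht g + 160 \<le> 200 * n + 5 * (\<Sum>p = Suc 0..<0 + n. val2 M p)"
      using build_work_bound[of g 0] bt g(2) unfolding n_def by simp
    \<comment> \<open>The priority loops contribute at most \<open>5 * 2 ^ e\<close>, which is less
      than \<open>10 * n\<close>, and finding the power of two at most \<open>3 * n\<close>.\<close>
    ultimately have "W \<le> 400 * n" using e3 n0 unfolding W_def by linarith
    then show ?thesis using g(2) unfolding n_def by (simp flip: of_nat_le_iff[where ?'a = real])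
  qed
  moreover have "real B \<le> 220 * log 2 (real (length (items t))) + 320"
  proof -
    have n: "real n = real (length (items t))" "0 < real n" using g(2) n0 unfolding n_def by auto
    have "real e \<le> log 2 (real n) + 1"
    proof -
      have "(2::real) ^ e \<le> 2 * real n" using e3 by (metis less_imp_le of_nat_le_iff of_nat_mult of_nat_numeral of_nat_power)
      then have "log 2 (2 ^ e) \<le> log 2 (2 * real n)" using n by (subst log_le_cancel_iff) auto
      then show ?thesis using n by (simp add: log_mult log_nat_power)
    qed
    moreover have "real (ht g) \<le> 2 * log 2 (real n)"
    proof -
      have "2 ^ ht g \<le> n ^ 2" using bbt_height_le_size[OF bt] g(2) unfolding n_def by simp
      then have "(2::real) ^ ht g \<le> real n ^ 2" by (metis of_nat_le_iff of_nat_numeral of_nat_power)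
      then have "log 2 (2 ^ ht g) \<le> log 2 (real n ^ 2)" using n by (subst log_le_cancel_iff) auto
      then show ?thesis using n by (simp add: log_nat_power)
    qed
    moreover have "0 \<le> log 2 (real n)" using n0 by simp
    \<comment> \<open>With these estimates \<open>B\<close> is at most
      \<open>8 * (log 2 n + 1) + 104 * (2 * log 2 n) + 300\<close>.\<close>
    ultimately show ?thesis unfolding B_def n(1)[symmetric] by simp
  qed
  ultimately show ?thesis unfolding computes_within_def by (meson order_trans)
qed

theorem mainTheorem6:
  fixes K :: nat
  assumes "6 \<le> K"
  shows "\<exists>(P :: program) (W :: nat \<Rightarrow> real) (S :: nat \<Rightarrow> real).
           W \<in> O(\<lambda>n. real n) \<and> S \<in> O(\<lambda>n. ln (real n)) \<and>
           (\<forall>n m v t. wf_memory K m \<and> batch_at m v t \<and> length (items t) = n \<longrightarrow>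
              computes_within K P (initial m v)
                (\<lambda>m' v'. \<exists>t'. batch_at m' v' t' \<and> complete_btree t' \<and> items t' = items t)
                (W n) (S n))"
proof (intro exI conjI allI impI)
  show "(\<lambda>n. 400 * real n) \<in> O(\<lambda>n. real n)" by simp
  show "(\<lambda>n. 220 * log 2 (real n) + 320) \<in> O(\<lambda>n. ln (real n))"
  proof (rule bigoI)
    show "\<forall>\<^sub>F n in sequentially. norm (220 * log 2 (real n) + 320) \<le> (220 / ln 2 + 320) * norm (ln (real n))"
      using eventually_ge_at_top[of 3]
    proof eventually_elim
      case (elim n)
      \<comment> \<open>From \<open>n = 3\<close> on, \<open>ln n\<close> is at least 1 and absorbs
        the additive constant.\<close>
      then have "exp 1 \<le> real n" using exp_le by linarith
      then have "1 \<le> ln (real n)" using elim by (subst ln_ge_iff) auto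
      then show ?case by (simp add: log_def algebra_simps)
    qed
  qed
qed (use rebalance_computes[OF assms] in blast)

end
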